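(* Let $\theta$ be an inner function in $\mathbb{D}$ and let $\zeta\in AC(\theta)$ be a point which is not a point of localization for $K_\theta$. Let $\{z_n\}$ be a sequence in $\mathbb{D}$. Then: (1) If $z_n\to\zeta\in\mathbb{T}$ non-tangentially, then $\{\widetilde{k}_{z_n}\}$ is a minimal sequence that does not contain any uniformly minimal sequence. (2) If $z_n\to\zeta$, but $\|k_{z_n}-k_\zeta\|\not\to0$, then $\{\widetilde{k}_{z_n}\}$ contains a uniformly minimal sequence.
   Context: $\mathbb{D}$ is the open unit disc, $\mathbb{T}$ the unit circle, $H^2=H^2(\mathbb{D})$ the Hardy space. For an inner function $\theta$ in $\mathbb{D}$, the model space is $K_\theta=H^2\ominus\theta H^2$; for $\lambda\in\mathbb{D}$, $k_\lambda(z)=\frac{1-\overline{\theta(\lambda)}\theta(z)}{1-\overline{\lambda}z}$ is the reproducing kernel of $K_\theta$ at $\lambda$, and $\widetilde{k}_\lambda=k_\lambda/\|k_\lambda\|_2$. Ahern--Clark set: let $w_j$ be the zeros of $\theta$ (counting multiplicities) and $\nu$ the positive singular measure on $\mathbb{T}$ generating the singular inner factor of $\theta$. Then $AC(\theta)=\Big\{\zeta\in\mathbb{T}:\ \sum_j\frac{1-|w_j|^2}{|\zeta-w_j|^2}+\int_{\mathbb{T}}\frac{d\nu(z)}{|\zeta-z|^2}<\infty\Big\}$. If $\zeta\in AC(\theta)$, then $\theta$ has a unimodular non-tangential limit $\theta(\zeta)$ at $\zeta$, every $f\in K_\theta$ has a finite non-tangential limit $f(\zeta)$, and $k_\zeta(z)=\frac{1-\overline{\theta(\zeta)}\theta(z)}{1-\overline{\zeta}z}$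 belongs to $K_\theta$ and is the reproducing kernel at $\zeta$. Localization: for $\gamma>1$ the Stolz angle at $\zeta\in\mathbb{T}$ is $\Gamma_\gamma(\zeta)=\{z\in\mathbb{D}:|z-\zeta|\le\gamma(1-|z|)\}$. The point $\zeta$ is a point of localization for $K_\theta$ if every nonzero $f\in K_\theta$ has only finitely many zeros in any Stolz angle at $\zeta$. A sequence tends to $\zeta$ non-tangentially if it converges to $\zeta$ and is contained in some Stolz angle at $\zeta$. All sequences are infinite, and "contains a sequence" means that it has a subsequence with the stated property. A sequence of unit vectors $\{x_n\}$ in a Hilbert space is minimal if $x_n\notin\overline{\operatorname{Lin}}\{x_m:m\ne n\}$ for every $n$, and uniformly minimal if $\inf_n\operatorname{dist}(x_n,\overline{\operatorname{Lin}}\{x_m:m\ne n\})>0$.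
   Formalization: In (1), "is a minimal sequence" is replaced by "contains a minimal sequence", since the whole sequence need not be minimal (e.g. z_n=(1-1/(n+2))ζ, whose kernels remain complete after deleting one); that no subsequence is uniformly minimal is kept. *)

theory Defs
  imports "HOL-Analysis.Analysis"
begin

section \<open>The Hardy space\<close>

text \<open>
  Functions on the open unit disc are represented by functions of type
  \<open>complex \<Rightarrow> complex\<close> whose values outside the disc are irrelevant: no notion below
  that concerns elements of the Hardy space depends on them.
\<close>

definition hardy2 :: "(complex \<Rightarrow> complex) set" where
  "hardy2 = {f. f holomorphic_on ball 0 1 \<and>
     bdd_above ((\<lambda>r. 1 / (2 * pi) * integral {0..2 * pi} (\<lambda>t. (cmod (f (of_real r * cis t)))\<^sup>2)) ` {0..<1})}"

text \<open>For \<open>f, g \<in> hardy2\<close> the limit exists and is the \<open>L\<^sup>2\<close> inner product of the boundary functions.\<close>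

definition h2_inner :: "(complex \<Rightarrow> complex) \<Rightarrow> (complex \<Rightarrow> complex) \<Rightarrow> complex" where
  "h2_inner f g = Lim (at_left 1) (\<lambda>r.
     1 / (2 * of_real pi) *
       integral {0..2 * pi} (\<lambda>t. f (of_real r * cis t) * cnj (g (of_real r * cis t))))"

definition h2_norm :: "(complex \<Rightarrow> complex) \<Rightarrow> real" where
  "h2_norm f = sqrt (Re (h2_inner f f))"

section \<open>Inner functions, Stolz angles and model spaces\<close>

definition inner_function :: "(complex \<Rightarrow> complex) \<Rightarrow> bool" where
  "inner_function \<theta> \<longleftrightarrow>
     \<theta> holomorphic_on ball 0 1 \<and> (\<forall>z\<in>ball 0 1. cmod (\<theta> z) \<le> 1) \<and>
     (AE t in lborel. \<exists>L. cmod L = 1 \<and> ((\<lambda>r. \<theta> (of_real r * cis t)) \<longlongrightarrow> L) (at_left 1))"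

definition model_space :: "(complex \<Rightarrow> complex) \<Rightarrow> (complex \<Rightarrow> complex) set" where
  "model_space \<theta> = {f \<in> hardy2. \<forall>h\<in>hardy2. h2_inner f (\<lambda>z. \<theta> z * h z) = 0}"

definition stolz_angle :: "real \<Rightarrow> complex \<Rightarrow> complex set" where
  "stolz_angle \<gamma> \<zeta> = {z \<in> ball 0 1. cmod (z - \<zeta>) \<le> \<gamma> * (1 - cmod z)}"

definition tendsto_nontangentially :: "(nat \<Rightarrow> complex) \<Rightarrow> complex \<Rightarrow> bool" where
  "tendsto_nontangentially z \<zeta> \<longleftrightarrow> z \<longlonglongrightarrow> \<zeta> \<and> (\<exists>\<gamma>>1. range z \<subseteq> stolz_angle \<gamma> \<zeta>)"

definition nontangential_limit :: "(complex \<Rightarrow> complex) \<Rightarrow> complex \<Rightarrow> complex" where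
  "nontangential_limit f \<zeta> = (THE L. \<forall>\<gamma>>1. (f \<longlongrightarrow> L) (at \<zeta> within stolz_angle \<gamma> \<zeta>))"

definition extended_value :: "(complex \<Rightarrow> complex) \<Rightarrow> complex \<Rightarrow> complex" where
  "extended_value f a = (if a \<in> ball 0 1 then f a else nontangential_limit f a)"

text \<open>
  One formula for both kinds of kernels: \<open>a\<close> is a point of the disc or a point of the
  circle at which \<open>\<theta>\<close> has a non-tangential limit.
\<close>

definition kernel :: "(complex \<Rightarrow> complex) \<Rightarrow> complex \<Rightarrow> complex \<Rightarrow> complex" where
  "kernel \<theta> a z = (1 - cnj (extended_value \<theta> a) * \<theta> z) / (1 - cnj a * z)"

definition normalized_kernel :: "(complex \<Rightarrow> complex) \<Rightarrow> complex \<Rightarrow> complex \<Rightarrow> complex" where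
  "normalized_kernel \<theta> a z = kernel \<theta> a z / of_real (h2_norm (kernel \<theta> a))"

definition localization_point :: "(complex \<Rightarrow> complex) \<Rightarrow> complex \<Rightarrow> bool" where
  "localization_point \<theta> \<zeta> \<longleftrightarrow>
     (\<forall>f\<in>model_space \<theta>. (\<exists>z\<in>ball 0 1. f z \<noteq> 0) \<longrightarrow>
        (\<forall>\<gamma>>1. finite {z \<in> stolz_angle \<gamma> \<zeta>. f z = 0}))"

section \<open>Canonical factorization and the Ahern--Clark set\<close>

definition blaschke_factor :: "complex \<Rightarrow> complex \<Rightarrow> complex" where
  "blaschke_factor a z =
     (if a = 0 then z else of_real (cmod a) / a * (a - z) / (1 - cnj a * z))"

text \<open>
  Measures on the circle are Borel measures on the plane that are concentrated on the
  circle; the set \<open>N\<close> below carries \<open>\<nu>\<close> and has arc length zero.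
\<close>

definition singular_circle_measure :: "complex measure \<Rightarrow> bool" where
  "singular_circle_measure \<nu> \<longleftrightarrow>
     sets \<nu> = sets borel \<and> finite_measure \<nu> \<and>
     (\<exists>N\<in>sets borel. N \<subseteq> sphere 0 1 \<and> emeasure \<nu> (- N) = 0 \<and>
        emeasure lborel {t \<in> {0..2 * pi}. cis t \<in> N} = 0)"

definition singular_inner :: "complex measure \<Rightarrow> complex \<Rightarrow> complex" where
  "singular_inner \<nu> z = exp (- (\<integral>w. (w + z) / (w - z) \<partial>\<nu>))"

text \<open>
  The family \<open>w j\<close>, \<open>j \<in> J\<close>, lists the zeros of \<open>\<theta>\<close>, each as often as its
  multiplicity; the index set \<open>J\<close> may be empty, finite or infinite. Every inner function
  has such a factorization, in which \<open>\<nu>\<close> and, up to reindexing, the family are unique.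
\<close>

definition canonical_factorization ::
  "(complex \<Rightarrow> complex) \<Rightarrow> nat set \<Rightarrow> (nat \<Rightarrow> complex) \<Rightarrow> complex measure \<Rightarrow> bool" where
  "canonical_factorization \<theta> J w \<nu> \<longleftrightarrow>
     w ` J \<subseteq> ball 0 1 \<and> (\<lambda>j. 1 - cmod (w j)) summable_on J \<and>
     singular_circle_measure \<nu> \<and>
     (\<exists>c. cmod c = 1 \<and> (\<forall>z\<in>ball 0 1. \<exists>b.
        (\<lambda>j. if j \<in> J then blaschke_factor (w j) z else 1) has_prod b \<and>
        \<theta> z = c * b * singular_inner \<nu> z))"

text \<open>
  The quotient in the integral is taken in \<open>ennreal\<close>, where it is \<open>\<infinity>\<close> at the point
  \<open>\<zeta>\<close>; a real quotient would be \<open>0\<close> there and would hide a point mass of \<open>\<nu>\<close> at \<open>\<zeta>\<close>.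
\<close>

definition ahern_clark :: "(complex \<Rightarrow> complex) \<Rightarrow> complex set" where
  "ahern_clark \<theta> = {\<zeta> \<in> sphere 0 1. \<exists>J w \<nu>. canonical_factorization \<theta> J w \<nu> \<and>
     (\<lambda>j. (1 - (cmod (w j))\<^sup>2) / (cmod (\<zeta> - w j))\<^sup>2) summable_on J \<and>
     (\<integral>\<^sup>+ z. 1 / ennreal ((cmod (\<zeta> - z))\<^sup>2) \<partial>\<nu>) < \<infinity>}"

section \<open>Minimal and uniformly minimal sequences\<close>

definition lin :: "(complex \<Rightarrow> complex) set \<Rightarrow> (complex \<Rightarrow> complex) set" where
  "lin S = {\<lambda>z. \<Sum>g\<in>F. c g * g z | F c. finite F \<and> F \<subseteq> S}"

definition h2_closure :: "(complex \<Rightarrow> complex) set \<Rightarrow> (complex \<Rightarrow> complex) set" where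
  "h2_closure S = {f \<in> hardy2. \<forall>\<epsilon>>0. \<exists>g\<in>S. h2_norm (\<lambda>z. f z - g z) < \<epsilon>}"

definition minimal_seq :: "(nat \<Rightarrow> complex \<Rightarrow> complex) \<Rightarrow> bool" where
  "minimal_seq x \<longleftrightarrow> (\<forall>n. x n \<notin> h2_closure (lin {x m | m. m \<noteq> n}))"

definition uniformly_minimal_seq :: "(nat \<Rightarrow> complex \<Rightarrow> complex) \<Rightarrow> bool" where
  "uniformly_minimal_seq x \<longleftrightarrow>
     (INF n. INF g\<in>h2_closure (lin {x m | m. m \<noteq> n}). h2_norm (\<lambda>z. x n z - g z)) > 0"

definition contains_seq :: "((nat \<Rightarrow> 'a) \<Rightarrow> bool) \<Rightarrow> (nat \<Rightarrow> 'a) \<Rightarrow> bool" where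
  "contains_seq P x \<longleftrightarrow> (\<exists>r. strict_mono r \<and> P (x \<circ> r))"

end

theory Submission
  imports Defs "HOL-Complex_Analysis.Complex_Analysis"
begin

text \<open>
  The inner product of a function \<open>f\<close> in the model space \<open>K\<close> with the kernel \<open>k\<^sub>a\<close> is \<open>f(a)\<close>.
  So minimality of a sequence of kernels is a question about zeros of functions in \<open>K\<close>, and
  uniform minimality is a question about weak and strong convergence of the kernels.

  At an Ahern--Clark point \<open>\<zeta>\<close> the factorization of \<open>\<theta>\<close> bounds
  \<open>\<parallel>k\<^sub>a\<parallel>\<^sup>2 = (1 - \<bar>\<theta>(a)\<bar>\<^sup>2) / (1 - \<bar>a\<bar>\<^sup>2)\<close> on the radius to \<open>\<zeta>\<close>
  (\<open>ahern_clark_radial_defect\<close>). A weak limit of these kernels is a kernel \<open>k\<^sub>\<zeta>\<close> in \<open>K\<close>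
  formed with a unimodular number in place of \<open>\<theta>(\<zeta>)\<close>. Sarason's Hilbert space proof of the
  theorem of Julia and Caratheodory then shows that this number is the non-tangential limit of
  \<open>\<theta>\<close> and that \<open>k\<^sub>a \<rightarrow> k\<^sub>\<zeta>\<close> in norm as \<open>a \<rightarrow> \<zeta>\<close> non-tangentially
  (\<open>kernel_tendsto_norm_stolz\<close>).

  Let \<open>z\<^sub>n \<rightarrow> \<zeta>\<close> non-tangentially. The normalized kernels converge in norm to a unit vector, so
  no subsequence is separated, let alone uniformly minimal. For a minimal subsequence it suffices
  to find a nonzero \<open>g\<close> in \<open>K\<close> that vanishes at infinitely many distinct \<open>z\<^sub>n\<close>, because
  zeros can be divided out inside \<open>K\<close> (\<open>minimal_seq_of_common_zeros\<close>). As \<open>\<zeta>\<close> is not a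
  point of localization, some nonzero \<open>f\<close> in \<open>K\<close> has infinitely many zeros \<open>l\<close> in a Stolz
  angle. A zero \<open>l\<close> is moved to \<open>z\<^sub>n\<close> by adding \<open>(l - z\<^sub>n) f / (z - l)\<close>. If \<open>z\<^sub>n\<close> is closer to
  \<open>\<zeta>\<close> than \<open>l\<close>, the norm of this change is at most a constant times that of \<open>f\<close>, and by
  density of polynomials it tends to \<open>0\<close> as \<open>l \<rightarrow> \<zeta>\<close> (\<open>diff_quot_stolz_small\<close>). So infinitely
  many zeros can be moved in succession with a small total change (\<open>zero_set_transfer\<close>).

  Let now \<open>z\<^sub>n \<rightarrow> \<zeta>\<close> arbitrarily, with \<open>\<parallel>k\<^sub>z\<^sub>n - k\<^sub>\<zeta>\<parallel>\<close> bounded below on a subsequence. If the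
  norms of the kernels tend to infinity, the normalized kernels tend weakly to \<open>0\<close>. Otherwise
  the kernels are bounded on a further subsequence and converge weakly to a kernel at \<open>\<zeta>\<close>; its
  parameter must be the non-tangential limit of \<open>\<theta>\<close>, so the weak limit is \<open>k\<^sub>\<zeta>\<close>. In both cases the
  normalized kernels are multiples of a fixed vector plus a weakly null sequence that is bounded
  below in norm. Such a sequence has a subsequence whose weakly null parts are almost orthogonal
  to each other and to the fixed vector, and this one is uniformly minimal
  (\<open>contains_uniformly_minimal\<close>).
\<close>

section \<open>Fourier coefficients on circles\<close>

text \<open>
  The inner product of \<open>H\<^sup>2\<close> is the limit of these means as \<open>r \<rightarrow> 1\<close>.
\<close>

definition circle_inner :: "real \<Rightarrow> (complex \<Rightarrow> complex) \<Rightarrow> (complex \<Rightarrow> complex) \<Rightarrow> complex" where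
  "circle_inner r f g = 1 / (2 * of_real pi) *
     integral {0..2 * pi} (\<lambda>t. f (of_real r * cis t) * cnj (g (of_real r * cis t)))"

definition taylor_coeff :: "(complex \<Rightarrow> complex) \<Rightarrow> nat \<Rightarrow> complex" where
  "taylor_coeff f n = (deriv ^^ n) f 0 / fact n"

lemma taylor_coeff_sums:
  assumes "f holomorphic_on ball 0 1" "z \<in> ball 0 1"
  shows "(\<lambda>n. taylor_coeff f n * z ^ n) sums f z"
  using holomorphic_power_series[OF assms] by (simp add: taylor_coeff_def)

lemma powser_summable_norm:
  fixes a :: "nat \<Rightarrow> complex"
  assumes "\<And>z. z \<in> ball 0 1 \<Longrightarrow> (\<lambda>n. a n * z ^ n) sums f z" "0 \<le> r" "r < 1"
  shows "summable (\<lambda>n. cmod (a n) * r ^ n)"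
proof -
  have "summable (\<lambda>n. a n * of_real ((r + 1) / 2) ^ n)"
    using assms(1)[of "of_real ((r + 1) / 2)"] assms(2,3) by (auto simp: sums_iff simp del: of_real_add of_real_divide)
  then have "summable (\<lambda>n. norm (a n * of_real r ^ n))"
    by (rule powser_insidea) (use assms in \<open>auto simp del: of_real_add of_real_divide\<close>)
  then show ?thesis using assms by (simp add: norm_mult norm_power)
qed

lemma tendsto_integral_of_uniform_limit:
  fixes f :: "nat \<Rightarrow> real \<Rightarrow> complex"
  assumes "uniform_limit {a..b} f g sequentially" "\<And>n. continuous_on {a..b} (f n)"
  shows "(\<lambda>n. integral {a..b} (f n)) \<longlonglongrightarrow> integral {a..b} g"
  using uniform_limit_integral[OF assms] by (smt (verit) integral_unique tendsto_cong always_eventually sequentially_bot)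

lemma cis_in_ball: "\<bar>r\<bar> < 1 \<Longrightarrow> of_real r * cis t \<in> ball 0 1"
  by (simp add: norm_mult)

lemma integral_cis_int: "integral {0..2*pi} (\<lambda>t. cis (of_int k * t)) = (if k = 0 then 2 * of_real pi else 0)"
proof (cases "k = 0")
  case False
  have "((\<lambda>t. cis (of_int k * t)) has_integral
      (cis (of_int k * (2*pi)) / (\<i> * of_int k) - cis (of_int k * 0) / (\<i> * of_int k))) {0..2*pi}"
  proof (rule fundamental_theorem_of_calculus)
    fix x :: real
    have "((\<lambda>t. exp (\<i> * of_int k * of_real t) / (\<i> * of_int k)) has_vector_derivative
       cis (of_int k * x)) (at x within {0..2*pi})"
      unfolding cis_conv_exp
      by (rule has_vector_derivative_real_field)
         (use False in \<open>auto intro!: derivative_eq_intros simp: mult_ac\<close>)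
    then show "((\<lambda>t. cis (of_int k * t) / (\<i> * of_int k)) has_vector_derivative
       cis (of_int k * x)) (at x within {0..2*pi})"
      by (simp add: cis_conv_exp mult_ac)
  qed auto
  moreover have "cis (of_int k * (2*pi)) = 1"
    by (metis cis_multiple_2pi Ints_of_int mult.commute)
  ultimately show ?thesis using False by (simp add: integral_unique)
qed (simp add: scaleR_conv_of_real)

lemma cis_power_mult_cnj:
  "(of_real r * cis t) ^ n * cnj ((of_real r * cis t) ^ m)
    = of_real (r ^ (n + m)) * cis (of_int (int n - int m) * t)"
proof -
  have "cis t ^ n * cnj (cis t ^ m) = cis (of_int (int n - int m) * t)"
    by (simp add: Complex.DeMoivre cis_cnj cis_mult left_diff_distrib)
  moreover have "(of_real r * cis t) ^ n * cnj ((of_real r * cis t) ^ m)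
      = of_real (r ^ (n + m)) * (cis t ^ n * cnj (cis t ^ m))"
    by (simp add: power_mult_distrib power_add)
  ultimately show ?thesis by (simp only:)
qed

text \<open>
  On a circle inside the disc the power series converges uniformly, so it may be integrated
  term by term; this is what makes the coefficients Fourier coefficients.
\<close>

lemma powser_circle_uniform:
  assumes "\<And>z. z \<in> ball 0 1 \<Longrightarrow> (\<lambda>n. a n * z ^ n) sums f z" "0 \<le> r" "r < 1"
  shows "uniform_limit UNIV (\<lambda>N t. \<Sum>n<N. a n * (of_real r * cis t) ^ n) (\<lambda>t. f (of_real r * cis t)) sequentially"
proof -
  have "uniform_limit UNIV (\<lambda>N t. \<Sum>n<N. a n * (of_real r * cis t) ^ n) (\<lambda>t. \<Sum>n. a n * (of_real r * cis t) ^ n) sequentially"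
    by (rule Weierstrass_m_test[OF _ powser_summable_norm[OF assms]])
       (use assms in \<open>auto simp: norm_mult norm_power\<close>)
  moreover have "(\<Sum>n. a n * (of_real r * cis t) ^ n) = f (of_real r * cis t)" for t
    using assms(1)[OF cis_in_ball, of r t] assms by (simp add: sums_iff)
  ultimately show ?thesis by simp
qed

lemma continuous_on_powser_circle:
  assumes "\<And>z. z \<in> ball 0 1 \<Longrightarrow> (\<lambda>n. a n * z ^ n) sums f z" "0 \<le> r" "r < 1"
  shows "continuous_on UNIV (\<lambda>t. f (of_real r * cis t))"
  by (rule uniform_limit_theorem[OF _ powser_circle_uniform[OF assms]])
     (auto intro!: continuous_intros always_eventually)

lemma powser_circle_fourier:
  assumes "\<And>z. z \<in> ball 0 1 \<Longrightarrow> (\<lambda>n. a n * z ^ n) sums f z" "0 \<le> r" "r < 1"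
  shows "circle_inner r f (\<lambda>z. z ^ m) = a m * of_real (r ^ (2 * m))"
proof -
  let ?e = "\<lambda>t. cnj ((of_real r * cis t) ^ m)"
  let ?I = "\<lambda>N. integral {0..2*pi} (\<lambda>t. (\<Sum>n<N. a n * (of_real r * cis t) ^ n) * ?e t)"
  have "?I \<longlonglongrightarrow> integral {0..2*pi} (\<lambda>t. f (of_real r * cis t) * ?e t)"
  proof (rule tendsto_integral_of_uniform_limit)
    show "uniform_limit {0..2*pi} (\<lambda>N t. (\<Sum>n<N. a n * (of_real r * cis t) ^ n) * ?e t) (\<lambda>t. f (of_real r * cis t) * ?e t) sequentially"
    proof (rule uniform_lim_mult[OF uniform_limit_on_subset[OF powser_circle_uniform[OF assms]] uniform_limit_const])
      show "bounded ((\<lambda>t. f (complex_of_real r * cis t)) ` {0..2 * pi})"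
        by (intro compact_imp_bounded compact_continuous_image continuous_on_subset[OF continuous_on_powser_circle[OF assms]]) auto
      show "bounded (?e ` {0..2*pi})"
        by (intro compact_imp_bounded compact_continuous_image continuous_intros) auto
    qed auto
    show "\<And>N. continuous_on {0..2*pi} (\<lambda>t. (\<Sum>n<N. a n * (of_real r * cis t) ^ n) * ?e t)"
      by (auto intro!: continuous_intros)
  qed
  moreover have "?I N = (if m < N then 2 * of_real pi * a m * of_real (r ^ (2*m)) else 0)" for N
  proof -
    have "?I N = integral {0..2*pi} (\<lambda>t. \<Sum>n<N. (a n * of_real (r ^ (n + m))) * cis (of_int (int n - int m) * t))"
      by (rule integral_cong)
         (simp only: sum_distrib_right mult.assoc cis_power_mult_cnj)
    also have "\<dots> = (\<Sum>n<N. integral {0..2*pi} (\<lambda>t. (a n * of_real (r ^ (n + m))) * cis (of_int (int n - int m) * t)))"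
      by (intro integral_sum integrable_continuous_interval continuous_intros) auto
    also have "\<dots> = (\<Sum>n<N. if n = m then 2 * of_real pi * a m * of_real (r ^ (2*m)) else 0)"
      unfolding integral_mult_right integral_cis_int
      by (intro sum.cong refl) (simp add: mult_2[symmetric, where 'a = nat])
    also have "\<dots> = (if m < N then 2 * of_real pi * a m * of_real (r ^ (2*m)) else 0)"
      by (subst sum.delta) auto
    finally show ?thesis .
  qed
  moreover have "(\<lambda>N. (if m < N then 2 * of_real pi * a m * of_real (r ^ (2*m)) else 0)) \<longlonglongrightarrow> 2 * of_real pi * a m * of_real (r ^ (2*m))"
    by (rule tendsto_eventually) (auto simp: eventually_at_top_linorder intro!: exI[of _ "Suc m"])
  ultimately have "integral {0..2*pi} (\<lambda>t. f (of_real r * cis t) * ?e t) = 2 * of_real pi * a m * of_real (r ^ (2*m))"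
    using LIMSEQ_unique by simp
  then show ?thesis by (simp add: circle_inner_def)
qed

text \<open>
  Any power series that represents \<open>f\<close> on the disc has the same Fourier coefficients on the
  circle of radius \<open>1/2\<close>. This is how the Taylor coefficients of explicit functions are read
  off below, without computing derivatives.
\<close>

lemma taylor_coeff_unique:
  assumes "\<And>z. z \<in> ball 0 1 \<Longrightarrow> (\<lambda>n. a n * z ^ n) sums f z"
  shows "taylor_coeff f n = a n"
proof -
  have "f holomorphic_on ball 0 1"
    using power_series_holomorphic[of 0 1 a f] assms by simp
  then show ?thesis
    using powser_circle_fourier[OF assms, of "1/2" n] powser_circle_fourier[OF taylor_coeff_sums, of f "1/2" n]
    by simp
qed

lemma continuous_on_circle_product:
  assumes "f holomorphic_on ball 0 1" "g holomorphic_on ball 0 1" "0 \<le> r" "r < 1"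
  shows "continuous_on A (\<lambda>t. f (of_real r * cis t) * cnj (g (of_real r * cis t)))"
  by (intro continuous_intros; rule continuous_on_subset[OF continuous_on_powser_circle[OF taylor_coeff_sums]])
     (use assms in auto)

text \<open>
  The Taylor series of \<open>g\<close> is integrated term by term against \<open>f\<close>, each term being a Fourier
  coefficient of \<open>f\<close>. As \<open>r \<rightarrow> 1\<close> this identifies the inner product of \<open>H\<^sup>2\<close> with that of the
  coefficient sequences.
\<close>

theorem parseval_circle:
  assumes "f holomorphic_on ball 0 1" "g holomorphic_on ball 0 1" "0 \<le> r" "r < 1"
  shows "(\<lambda>n. taylor_coeff f n * cnj (taylor_coeff g n) * of_real (r ^ (2 * n))) sums circle_inner r f g"
proof -
  let ?f = "\<lambda>t. f (of_real r * cis t)"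
  let ?p = "\<lambda>N t. \<Sum>n<N. taylor_coeff g n * (of_real r * cis t) ^ n"
  let ?I = "\<lambda>N. integral {0..2*pi} (\<lambda>t. ?f t * cnj (?p N t))"
  note cf = continuous_on_powser_circle[OF taylor_coeff_sums, OF assms(1) _ assms(3,4)]
  have ug: "uniform_limit {0..2*pi} ?p (\<lambda>t. g (of_real r * cis t)) sequentially"
    by (rule uniform_limit_on_subset[OF powser_circle_uniform[OF taylor_coeff_sums]]) (use assms in auto)
  have "?I \<longlonglongrightarrow> integral {0..2*pi} (\<lambda>t. ?f t * cnj (g (of_real r * cis t)))"
  proof (rule tendsto_integral_of_uniform_limit)
    show "uniform_limit {0..2*pi} (\<lambda>N t. ?f t * cnj (?p N t)) (\<lambda>t. ?f t * cnj (g (of_real r * cis t))) sequentially"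
    proof (rule uniform_lim_mult[OF uniform_limit_const])
      show "uniform_limit {0..2*pi} (\<lambda>N t. cnj (?p N t)) (\<lambda>t. cnj (g (of_real r * cis t))) sequentially"
        by (rule bounded_linear.uniform_limit[OF bounded_linear_cnj ug])
      show "bounded (?f ` {0..2 * pi})"
        by (intro compact_imp_bounded compact_continuous_image continuous_on_subset[OF cf]) auto
      show "bounded ((\<lambda>t. cnj (g (of_real r * cis t))) ` {0..2*pi})"
        by (intro compact_imp_bounded compact_continuous_image continuous_intros
          continuous_on_subset[OF continuous_on_powser_circle[OF taylor_coeff_sums, OF assms(2) _ assms(3,4)]]) auto
    qed
    show "\<And>N. continuous_on {0..2*pi} (\<lambda>t. ?f t * cnj (?p N t))"
      by (auto intro!: continuous_intros continuous_on_subset[OF cf])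
  qed
  then have "(\<lambda>N. 1 / (2 * of_real pi) * ?I N) \<longlonglongrightarrow> circle_inner r f g"
    unfolding circle_inner_def by (rule tendsto_mult_left)
  moreover have "1 / (2 * of_real pi) * ?I N = (\<Sum>n<N. taylor_coeff f n * cnj (taylor_coeff g n) * of_real (r ^ (2 * n)))" for N
  proof -
    have "?I N = integral {0..2*pi} (\<lambda>t. \<Sum>n<N. cnj (taylor_coeff g n) * (?f t * cnj ((of_real r * cis t) ^ n)))"
      unfolding cnj_sum sum_distrib_left complex_cnj_mult by (simp add: mult_ac)
    also have "\<dots> = (\<Sum>n<N. integral {0..2*pi} (\<lambda>t. cnj (taylor_coeff g n) * (?f t * cnj ((of_real r * cis t) ^ n))))"
      by (rule integral_sum) (auto intro!: integrable_continuous_interval continuous_intros continuous_on_subset[OF cf])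
    also have "\<dots> = (\<Sum>n<N. cnj (taylor_coeff g n) * integral {0..2*pi} (\<lambda>t. (?f t * cnj ((of_real r * cis t) ^ n))))"
      by simp
    finally have I: "?I N = (\<Sum>n<N. cnj (taylor_coeff g n) * integral {0..2*pi} (\<lambda>t. (?f t * cnj ((of_real r * cis t) ^ n))))" .
    have "1 / (2 * of_real pi) * ?I N = (\<Sum>n<N. cnj (taylor_coeff g n) * circle_inner r f (\<lambda>z. z ^ n))"
      unfolding I sum_distrib_left circle_inner_def by (intro sum.cong refl mult.left_commute)
    also have "\<dots> = (\<Sum>n<N. taylor_coeff f n * cnj (taylor_coeff g n) * of_real (r ^ (2 * n)))"
      by (subst powser_circle_fourier[OF taylor_coeff_sums, OF assms(1) _ assms(3,4)]) (simp_all add: mult_ac)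
    finally show ?thesis .
  qed
  ultimately show ?thesis by (simp add: sums_def)
qed

section \<open>The Hardy space as a space of square-summable coefficients\<close>

definition mean_sq :: "real \<Rightarrow> (complex \<Rightarrow> complex) \<Rightarrow> real" where
  "mean_sq r f = 1 / (2 * pi) * integral {0..2 * pi} (\<lambda>t. (cmod (f (of_real r * cis t)))\<^sup>2)"

lemma circle_inner_self:
  assumes "f holomorphic_on ball 0 1" "0 \<le> r" "r < 1"
  shows "circle_inner r f f = of_real (mean_sq r f)"
proof -
  let ?h = "\<lambda>t. (cmod (f (of_real r * cis t)))\<^sup>2"
  have "continuous_on {0..2*pi} (\<lambda>t. f (of_real r * cis t))"
    by (rule continuous_on_subset[OF continuous_on_powser_circle[OF taylor_coeff_sums]]) (use assms in auto)
  then have "continuous_on {0..2*pi} ?h"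
    by (intro continuous_intros)
  then have "(?h has_integral integral {0..2*pi} ?h) {0..2*pi}"
    by (intro integrable_integral integrable_continuous_interval)
  then have "((\<lambda>t. complex_of_real (?h t)) has_integral of_real (integral {0..2*pi} ?h)) {0..2*pi}"
    by (rule has_integral_of_real)
  then have "integral {0..2*pi} (\<lambda>t. f (of_real r * cis t) * cnj (f (of_real r * cis t))) = of_real (integral {0..2*pi} ?h)"
    unfolding complex_norm_square by (rule integral_unique)
  then show ?thesis by (simp add: circle_inner_def mean_sq_def)
qed

lemma mean_sq_sums:
  assumes "f holomorphic_on ball 0 1" "0 \<le> r" "r < 1"
  shows "(\<lambda>n. (cmod (taylor_coeff f n))\<^sup>2 * r ^ (2 * n)) sums mean_sq r f"
proof -
  have "(\<lambda>n. complex_of_real ((cmod (taylor_coeff f n))\<^sup>2 * r ^ (2 * n))) sums complex_of_real (mean_sq r f)"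
    using parseval_circle[OF assms(1,1,2,3)] circle_inner_self[OF assms]
    by (simp add: complex_norm_square[symmetric] del: of_real_power)
  then show ?thesis by (simp only: sums_of_real_iff)
qed

text \<open>
  By Parseval the means increase with the radius, so a bound on them near the boundary is
  enough. The bound then passes to every partial sum of the squared coefficients, because a
  partial sum is continuous in \<open>r\<close> up to \<open>r = 1\<close>.
\<close>

lemma hardy2_of_mean_bound:
  assumes "f holomorphic_on ball 0 1" "r0 < 1" "\<And>r. r0 \<le> r \<Longrightarrow> 0 \<le> r \<Longrightarrow> r < 1 \<Longrightarrow> mean_sq r f \<le> B"
  shows "summable (\<lambda>n. (cmod (taylor_coeff f n))\<^sup>2)" "(\<Sum>n. (cmod (taylor_coeff f n))\<^sup>2) \<le> B"
proof -
  have part: "(\<Sum>n<N. (cmod (taylor_coeff f n))\<^sup>2) \<le> B" for N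
  proof -
    have "((\<lambda>r. \<Sum>n<N. (cmod (taylor_coeff f n))\<^sup>2 * r ^ (2 * n)) \<longlongrightarrow> (\<Sum>n<N. (cmod (taylor_coeff f n))\<^sup>2 * 1 ^ (2 * n))) (at_left (1::real))"
      by (intro tendsto_intros)
    moreover have "\<forall>\<^sub>F r in at_left 1. (\<Sum>n<N. (cmod (taylor_coeff f n))\<^sup>2 * r ^ (2 * n)) \<le> B"
    proof -
      have "\<forall>\<^sub>F r in at_left 1. r \<in> {max 0 r0<..<1}"
        by (rule eventually_at_left_real) (use assms(2) in auto)
      then show ?thesis
      proof eventually_elim
        case (elim r)
        have "(\<Sum>n<N. (cmod (taylor_coeff f n))\<^sup>2 * r ^ (2 * n)) \<le> mean_sq r f"
          using mean_sq_sums[OF assms(1), of r] elim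
          by (intro sum_le_suminf[THEN order_trans]) (auto simp: sums_iff)
        also have "\<dots> \<le> B" using assms(3)[of r] elim by auto
        finally show ?case .
      qed
    qed
    ultimately show ?thesis
      by (auto intro: tendsto_upperbound)
  qed
  show S: "summable (\<lambda>n. (cmod (taylor_coeff f n))\<^sup>2)"
    by (rule summableI_nonneg_bounded[OF _ part]) auto
  show "(\<Sum>n. (cmod (taylor_coeff f n))\<^sup>2) \<le> B"
    by (rule suminf_le_const[OF S part])
qed

lemma mean_sq_le:
  assumes "f holomorphic_on ball 0 1" "0 \<le> r" "r < 1" "summable (\<lambda>n. (cmod (taylor_coeff f n))\<^sup>2)"
  shows "mean_sq r f \<le> (\<Sum>n. (cmod (taylor_coeff f n))\<^sup>2)"
proof -
  have "(\<Sum>n. (cmod (taylor_coeff f n))\<^sup>2 * r ^ (2 * n)) \<le> (\<Sum>n. (cmod (taylor_coeff f n))\<^sup>2)"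
    using mean_sq_sums[OF assms(1-3)] assms
    by (intro suminf_le) (auto simp: sums_iff power_le_one mult_left_le)
  then show ?thesis using mean_sq_sums[OF assms(1-3)] by (simp add: sums_iff)
qed

lemma hardy2_iff:
  "f \<in> hardy2 \<longleftrightarrow> f holomorphic_on ball 0 1 \<and> summable (\<lambda>n. (cmod (taylor_coeff f n))\<^sup>2)"
proof (cases "f holomorphic_on ball 0 1")
  case True
  have "f \<in> hardy2 \<longleftrightarrow> bdd_above ((\<lambda>r. mean_sq r f) ` {0..<1})"
    using True by (simp add: hardy2_def mean_sq_def)
  also have "\<dots> \<longleftrightarrow> summable (\<lambda>n. (cmod (taylor_coeff f n))\<^sup>2)"
  proof
    assume "bdd_above ((\<lambda>r. mean_sq r f) ` {0..<1})"
    then obtain B where "\<And>r. 0 \<le> r \<Longrightarrow> r < 1 \<Longrightarrow> mean_sq r f \<le> B"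
      unfolding bdd_above_def by (meson atLeastLessThan_iff imageI)
    then show "summable (\<lambda>n. (cmod (taylor_coeff f n))\<^sup>2)"
      using hardy2_of_mean_bound(1)[OF True, of 0 B] by simp
  next
    assume "summable (\<lambda>n. (cmod (taylor_coeff f n))\<^sup>2)"
    then show "bdd_above ((\<lambda>r. mean_sq r f) ` {0..<1})"
      using mean_sq_le[OF True] by (intro bdd_aboveI2) auto
  qed
  finally show ?thesis using True by simp
qed (simp add: hardy2_def)

lemma hardy2_holomorphic: "f \<in> hardy2 \<Longrightarrow> f holomorphic_on ball 0 1"
  by (simp add: hardy2_iff)

lemma hardy2_summable_mult:
  assumes "f \<in> hardy2" "g \<in> hardy2"
  shows "summable (\<lambda>n. cmod (taylor_coeff f n) * cmod (taylor_coeff g n))"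
proof (rule summable_comparison_test')
  show "summable (\<lambda>n. (cmod (taylor_coeff f n))\<^sup>2 + (cmod (taylor_coeff g n))\<^sup>2)"
    using assms by (intro summable_add) (auto simp: hardy2_iff)
  fix n
  have "0 \<le> cmod (taylor_coeff f n) * cmod (taylor_coeff g n)" by simp
  with sum_squares_bound[of "cmod (taylor_coeff f n)" "cmod (taylor_coeff g n)"]
  show "norm (cmod (taylor_coeff f n) * cmod (taylor_coeff g n)) \<le> (cmod (taylor_coeff f n))\<^sup>2 + (cmod (taylor_coeff g n))\<^sup>2"
    unfolding real_norm_def abs_of_nonneg[OF \<open>0 \<le> cmod (taylor_coeff f n) * cmod (taylor_coeff g n)\<close>] by linarith
qed

text \<open>
  Passing to \<open>r \<rightarrow> 1\<close> under the sum is Tannery's theorem, with the moduli of the products of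
  coefficients as summable majorant.
\<close>

lemma h2_inner_tendsto_suminf:
  assumes "f \<in> hardy2" "g \<in> hardy2"
  shows "((\<lambda>r. circle_inner r f g) \<longlongrightarrow> (\<Sum>n. taylor_coeff f n * cnj (taylor_coeff g n))) (at_left 1)"
proof -
  let ?a = "\<lambda>n (r::real). taylor_coeff f n * cnj (taylor_coeff g n) * of_real (r ^ (2 * n))"
  have ev: "\<forall>\<^sub>F r in at_left (1::real). r \<in> {0<..<1}"
    by (rule eventually_at_left_real) auto
  have "((\<lambda>r. suminf (\<lambda>n. ?a n r)) \<longlongrightarrow> (\<Sum>n. taylor_coeff f n * cnj (taylor_coeff g n))) (at_left 1)"
  proof (rule tannerys_theorem[THEN conjunct2, THEN conjunct2])
    fix n
    have "((\<lambda>r. ?a n r) \<longlongrightarrow> taylor_coeff f n * cnj (taylor_coeff g n) * of_real (1 ^ (2 * n))) (at_left 1)"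
      by (intro tendsto_intros)
    then show "((\<lambda>r. ?a n r) \<longlongrightarrow> taylor_coeff f n * cnj (taylor_coeff g n)) (at_left 1)" by simp
  next
    have "\<forall>\<^sub>F (k, r) in sequentially \<times>\<^sub>F at_left 1. True \<and> r \<in> {0<..<1::real}"
      unfolding case_prod_beta by (rule eventually_prodI[OF always_eventually[of "\<lambda>_. True"] ev]) simp
    then show "\<forall>\<^sub>F (k, r) in sequentially \<times>\<^sub>F at_left 1. norm (?a k r) \<le> cmod (taylor_coeff f k) * cmod (taylor_coeff g k)"
      by (rule eventually_mono) (auto simp: norm_mult norm_power power_le_one intro!: mult_left_le)
  qed (use hardy2_summable_mult[OF assms] in auto)
  moreover have "\<forall>\<^sub>F r in at_left 1. suminf (\<lambda>n. ?a n r) = circle_inner r f g"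
    using ev by eventually_elim
      (use parseval_circle assms in \<open>auto simp: sums_iff hardy2_iff\<close>)
  ultimately show ?thesis by (rule Lim_transform_eventually)
qed

lemma h2_inner_sums:
  assumes "f \<in> hardy2" "g \<in> hardy2"
  shows "(\<lambda>n. taylor_coeff f n * cnj (taylor_coeff g n)) sums h2_inner f g"
proof -
  have "h2_inner f g = (\<Sum>n. taylor_coeff f n * cnj (taylor_coeff g n))"
    unfolding h2_inner_def
    by (rule tendsto_Lim) (use h2_inner_tendsto_suminf[OF assms] in \<open>auto simp: circle_inner_def\<close>)
  moreover have "summable (\<lambda>n. taylor_coeff f n * cnj (taylor_coeff g n))"
    by (rule summable_norm_cancel) (use hardy2_summable_mult[OF assms] in \<open>simp add: norm_mult\<close>)
  ultimately show ?thesis by (simp add: summable_sums)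
qed

lemma circle_inner_tendsto:
  assumes "f \<in> hardy2" "g \<in> hardy2"
  shows "((\<lambda>r. circle_inner r f g) \<longlongrightarrow> h2_inner f g) (at_left 1)"
  using h2_inner_tendsto_suminf[OF assms] h2_inner_sums[OF assms] by (simp add: sums_iff)

lemma h2_inner_self_suminf:
  assumes "f \<in> hardy2"
  shows "h2_inner f f = of_real (\<Sum>n. (cmod (taylor_coeff f n))\<^sup>2)"
proof -
  have "(\<lambda>n. complex_of_real ((cmod (taylor_coeff f n))\<^sup>2)) sums of_real (\<Sum>n. (cmod (taylor_coeff f n))\<^sup>2)"
    using assms by (intro sums_of_real summable_sums) (simp add: hardy2_iff)
  then show ?thesis
    using h2_inner_sums[OF assms assms] unfolding complex_norm_square by (rule sums_unique2[symmetric])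
qed

lemma h2_norm_nonneg: "f \<in> hardy2 \<Longrightarrow> 0 \<le> h2_norm f"
  by (simp add: h2_norm_def h2_inner_self_suminf suminf_nonneg hardy2_iff)

lemma h2_norm_sq: "f \<in> hardy2 \<Longrightarrow> (h2_norm f)\<^sup>2 = (\<Sum>n. (cmod (taylor_coeff f n))\<^sup>2)"
  by (simp add: h2_norm_def h2_inner_self_suminf suminf_nonneg hardy2_iff)

lemma h2_inner_self: "f \<in> hardy2 \<Longrightarrow> h2_inner f f = of_real ((h2_norm f)\<^sup>2)"
  by (simp add: h2_norm_sq h2_inner_self_suminf)

lemma taylor_coeff_cong:
  assumes "f holomorphic_on ball 0 1" "\<And>z. z \<in> ball 0 1 \<Longrightarrow> f z = g z"
  shows "taylor_coeff g n = taylor_coeff f n"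
  by (rule taylor_coeff_unique) (use taylor_coeff_sums assms in metis)

lemma hardy2_cong:
  assumes "f \<in> hardy2" "\<And>z. z \<in> ball 0 1 \<Longrightarrow> f z = g z"
  shows "g \<in> hardy2"
  using assms taylor_coeff_cong[OF _ assms(2)] holomorphic_cong[of "ball 0 1" "ball 0 1" f g]
  by (auto simp: hardy2_iff)

text \<open>
  Only the values in the disc matter, which allows formulas for kernels and quotients to be
  rewritten there alone.
\<close>

lemma h2_inner_cong:
  assumes "f \<in> hardy2" "g \<in> hardy2" "\<And>z. z \<in> ball 0 1 \<Longrightarrow> f z = f' z" "\<And>z. z \<in> ball 0 1 \<Longrightarrow> g z = g' z"
  shows "h2_inner f' g' = h2_inner f g"
proof -
  have "f' \<in> hardy2" "g' \<in> hardy2" using assms hardy2_cong by blast+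
  then show ?thesis
    using h2_inner_sums[of f' g'] h2_inner_sums[OF assms(1,2)]
      taylor_coeff_cong[OF _ assms(3)] taylor_coeff_cong[OF _ assms(4)] assms(1,2)
    by (simp add: hardy2_holomorphic sums_iff)
qed

lemma h2_norm_cong:
  assumes "f \<in> hardy2" "\<And>z. z \<in> ball 0 1 \<Longrightarrow> f z = f' z"
  shows "h2_norm f' = h2_norm f"
  unfolding h2_norm_def using h2_inner_cong[OF assms(1,1) assms(2,2)] by simp

lemma h2_inner_commute:
  assumes "f \<in> hardy2" "g \<in> hardy2"
  shows "h2_inner f g = cnj (h2_inner g f)"
proof -
  have "(\<lambda>n. cnj (taylor_coeff g n * cnj (taylor_coeff f n))) sums cnj (h2_inner g f)"
    using h2_inner_sums[OF assms(2,1)] by (simp only: sums_cnj)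
  then show ?thesis
    using h2_inner_sums[OF assms] by (simp add: mult.commute sums_iff)
qed

lemma taylor_coeff_add:
  assumes "f holomorphic_on ball 0 1" "g holomorphic_on ball 0 1"
  shows "taylor_coeff (\<lambda>z. f z + g z) n = taylor_coeff f n + taylor_coeff g n"
  by (rule taylor_coeff_unique) (use sums_add[OF taylor_coeff_sums taylor_coeff_sums] assms in \<open>auto simp: algebra_simps\<close>)

lemma taylor_coeff_cmult:
  assumes "f holomorphic_on ball 0 1"
  shows "taylor_coeff (\<lambda>z. c * f z) n = c * taylor_coeff f n"
  by (rule taylor_coeff_unique) (use sums_mult[OF taylor_coeff_sums, of f _ c] assms in \<open>auto simp: algebra_simps\<close>)

lemma hardy2_add:
  assumes "f \<in> hardy2" "g \<in> hardy2"
  shows "(\<lambda>z. f z + g z) \<in> hardy2"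
proof -
  have "summable (\<lambda>n. (cmod (taylor_coeff f n + taylor_coeff g n))\<^sup>2)"
  proof (rule summable_comparison_test')
    show "summable (\<lambda>n. 2 * (cmod (taylor_coeff f n))\<^sup>2 + 2 * (cmod (taylor_coeff g n))\<^sup>2)"
      using assms by (intro summable_add summable_mult) (auto simp: hardy2_iff)
    fix n
    have "(cmod (taylor_coeff f n + taylor_coeff g n))\<^sup>2 \<le> (cmod (taylor_coeff f n) + cmod (taylor_coeff g n))\<^sup>2"
      by (intro power_mono norm_triangle_ineq) auto
    also have "\<dots> \<le> 2 * (cmod (taylor_coeff f n))\<^sup>2 + 2 * (cmod (taylor_coeff g n))\<^sup>2"
      using sum_squares_bound[of "cmod (taylor_coeff f n)" "cmod (taylor_coeff g n)"] by (simp add: power2_sum)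
    finally show "norm ((cmod (taylor_coeff f n + taylor_coeff g n))\<^sup>2) \<le> 2 * (cmod (taylor_coeff f n))\<^sup>2 + 2 * (cmod (taylor_coeff g n))\<^sup>2"
      by simp
  qed
  then show ?thesis using assms by (auto simp: hardy2_iff taylor_coeff_add intro!: holomorphic_intros)
qed

lemma hardy2_cmult: "f \<in> hardy2 \<Longrightarrow> (\<lambda>z. c * f z) \<in> hardy2"
  by (auto simp: hardy2_iff taylor_coeff_cmult norm_mult power_mult_distrib intro!: holomorphic_intros summable_mult)

lemma hardy2_diff:
  assumes "f \<in> hardy2" "g \<in> hardy2"
  shows "(\<lambda>z. f z - g z) \<in> hardy2"
  using hardy2_add[OF assms(1) hardy2_cmult[OF assms(2), of "-1"]] by simp

lemma hardy2_zero: "(\<lambda>_. 0) \<in> hardy2"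
  by (auto simp: hardy2_def intro: bdd_aboveI2)

lemma hardy2_sum:
  "(\<And>i. i \<in> A \<Longrightarrow> f i \<in> hardy2) \<Longrightarrow> (\<lambda>z. \<Sum>i\<in>A. f i z) \<in> hardy2"
  by (induction A rule: infinite_finite_induct) (auto simp: hardy2_zero hardy2_add)

lemma h2_inner_add_left:
  assumes "f \<in> hardy2" "g \<in> hardy2" "h \<in> hardy2"
  shows "h2_inner (\<lambda>z. f z + g z) h = h2_inner f h + h2_inner g h"
proof -
  have "(\<lambda>n. taylor_coeff (\<lambda>z. f z + g z) n * cnj (taylor_coeff h n)) sums (h2_inner f h + h2_inner g h)"
    using sums_add[OF h2_inner_sums h2_inner_sums, OF assms(1,3) assms(2,3)] assms
    by (simp add: taylor_coeff_add hardy2_iff ring_distribs)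
  then show ?thesis
    using h2_inner_sums[OF hardy2_add[OF assms(1,2)] assms(3)] by (rule sums_unique2[symmetric])
qed

lemma h2_inner_cmult_left:
  assumes "f \<in> hardy2" "h \<in> hardy2"
  shows "h2_inner (\<lambda>z. c * f z) h = c * h2_inner f h"
proof -
  have "(\<lambda>n. taylor_coeff (\<lambda>z. c * f z) n * cnj (taylor_coeff h n)) sums (c * h2_inner f h)"
    using sums_mult[OF h2_inner_sums, OF assms, of c] assms
    by (simp add: taylor_coeff_cmult hardy2_iff mult.assoc)
  then show ?thesis
    using h2_inner_sums[OF hardy2_cmult[OF assms(1)] assms(2)] by (rule sums_unique2[symmetric])
qed

lemma h2_inner_diff_left:
  assumes "f \<in> hardy2" "g \<in> hardy2" "h \<in> hardy2"
  shows "h2_inner (\<lambda>z. f z - g z) h = h2_inner f h - h2_inner g h"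
  using h2_inner_add_left[OF assms(1) hardy2_cmult[OF assms(2), of "-1"] assms(3)]
    h2_inner_cmult_left[OF assms(2,3), of "-1"] by simp

lemma h2_inner_add_right:
  assumes "f \<in> hardy2" "g \<in> hardy2" "h \<in> hardy2"
  shows "h2_inner h (\<lambda>z. f z + g z) = h2_inner h f + h2_inner h g"
  unfolding h2_inner_commute[OF assms(3) hardy2_add[OF assms(1,2)]] h2_inner_add_left[OF assms]
    h2_inner_commute[OF assms(3,1)] h2_inner_commute[OF assms(3,2)] by simp

lemma h2_inner_cmult_right:
  assumes "f \<in> hardy2" "h \<in> hardy2"
  shows "h2_inner h (\<lambda>z. c * f z) = cnj c * h2_inner h f"
  unfolding h2_inner_commute[OF assms(2) hardy2_cmult[OF assms(1)]] h2_inner_cmult_left[OF assms]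
    h2_inner_commute[OF assms(2,1)] by simp

lemma h2_inner_diff_right:
  assumes "f \<in> hardy2" "g \<in> hardy2" "h \<in> hardy2"
  shows "h2_inner h (\<lambda>z. f z - g z) = h2_inner h f - h2_inner h g"
  unfolding h2_inner_commute[OF assms(3) hardy2_diff[OF assms(1,2)]] h2_inner_diff_left[OF assms]
    h2_inner_commute[OF assms(3,1)] h2_inner_commute[OF assms(3,2)] by simp

lemma h2_inner_zero_left: "h \<in> hardy2 \<Longrightarrow> h2_inner (\<lambda>_. 0) h = 0"
  using h2_inner_cmult_left[OF hardy2_zero, of h 0] by simp

lemma h2_inner_sum_left:
  assumes "\<And>i. i \<in> A \<Longrightarrow> f i \<in> hardy2" "h \<in> hardy2"
  shows "h2_inner (\<lambda>z. \<Sum>i\<in>A. f i z) h = (\<Sum>i\<in>A. h2_inner (f i) h)"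
  using assms(1)
  by (induction A rule: infinite_finite_induct)
     (auto simp: h2_inner_zero_left assms(2) h2_inner_add_left hardy2_sum)

lemma h2_inner_sum_right:
  assumes "\<And>i. i \<in> A \<Longrightarrow> f i \<in> hardy2" "h \<in> hardy2"
  shows "h2_inner h (\<lambda>z. \<Sum>i\<in>A. f i z) = (\<Sum>i\<in>A. h2_inner h (f i))"
proof -
  have "h2_inner h (\<lambda>z. \<Sum>i\<in>A. f i z) = cnj (h2_inner (\<lambda>z. \<Sum>i\<in>A. f i z) h)"
    by (rule h2_inner_commute[OF assms(2) hardy2_sum[OF assms(1)]])
  also have "\<dots> = (\<Sum>i\<in>A. cnj (h2_inner (f i) h))"
    by (subst h2_inner_sum_left[OF assms]) (auto simp: cnj_sum)
  also have "\<dots> = (\<Sum>i\<in>A. h2_inner h (f i))"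
    by (intro sum.cong refl h2_inner_commute[symmetric] assms)
  finally show ?thesis .
qed

lemma h2_cauchy_schwarz:
  assumes "f \<in> hardy2" "g \<in> hardy2"
  shows "cmod (h2_inner f g) \<le> h2_norm f * h2_norm g"
proof (rule LIMSEQ_le_const2)
  show "(\<lambda>N. cmod (\<Sum>n<N. taylor_coeff f n * cnj (taylor_coeff g n))) \<longlonglongrightarrow> cmod (h2_inner f g)"
    using h2_inner_sums[OF assms] by (intro tendsto_norm) (simp add: sums_def)
  have L2: "L2_set (\<lambda>n. cmod (taylor_coeff f n)) {..<N} \<le> h2_norm f" if "f \<in> hardy2" for f N
    unfolding L2_set_def using that h2_norm_sq[OF that] h2_norm_nonneg[OF that]
    by (intro real_le_lsqrt sum_nonneg) (auto simp: hardy2_iff intro!: sum_le_suminf)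
  have "cmod (\<Sum>n<N. taylor_coeff f n * cnj (taylor_coeff g n)) \<le> h2_norm f * h2_norm g" for N
  proof -
    have "cmod (\<Sum>n<N. taylor_coeff f n * cnj (taylor_coeff g n)) \<le> (\<Sum>n<N. \<bar>cmod (taylor_coeff f n)\<bar> * \<bar>cmod (taylor_coeff g n)\<bar>)"
      by (rule order_trans[OF norm_sum]) (simp add: norm_mult)
    also have "\<dots> \<le> L2_set (\<lambda>n. cmod (taylor_coeff f n)) {..<N} * L2_set (\<lambda>n. cmod (taylor_coeff g n)) {..<N}"
      by (rule L2_set_mult_ineq)
    also have "\<dots> \<le> h2_norm f * h2_norm g"
      using assms by (intro mult_mono L2) (auto simp: h2_norm_nonneg)
    finally show ?thesis .
  qed
  then show "\<exists>N. \<forall>n\<ge>N. cmod (\<Sum>n<n. taylor_coeff f n * cnj (taylor_coeff g n)) \<le> h2_norm f * h2_norm g" by blast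
qed

lemma h2_norm_add_sq:
  assumes "f \<in> hardy2" "g \<in> hardy2"
  shows "(h2_norm (\<lambda>z. f z + g z))\<^sup>2 = (h2_norm f)\<^sup>2 + 2 * Re (h2_inner f g) + (h2_norm g)\<^sup>2"
proof -
  have "of_real ((h2_norm (\<lambda>z. f z + g z))\<^sup>2) = h2_inner f f + h2_inner f g + h2_inner g f + h2_inner g g"
    using assms by (simp add: h2_inner_self[symmetric] hardy2_add h2_inner_add_left h2_inner_add_right del: of_real_power)
  also have "h2_inner g f = cnj (h2_inner f g)" by (rule h2_inner_commute[OF assms(2,1)])
  also have "h2_inner f f + h2_inner f g + cnj (h2_inner f g) + h2_inner g g =
    of_real ((h2_norm f)\<^sup>2 + 2 * Re (h2_inner f g) + (h2_norm g)\<^sup>2)"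
    using assms by (simp add: h2_inner_self complex_eq_iff)
  finally show ?thesis by (simp only: of_real_eq_iff)
qed

lemma h2_norm_triangle:
  assumes "f \<in> hardy2" "g \<in> hardy2"
  shows "h2_norm (\<lambda>z. f z + g z) \<le> h2_norm f + h2_norm g"
proof (rule power2_le_imp_le)
  have "Re (h2_inner f g) \<le> h2_norm f * h2_norm g"
    using h2_cauchy_schwarz[OF assms] complex_Re_le_cmod order_trans by blast
  then show "(h2_norm (\<lambda>z. f z + g z))\<^sup>2 \<le> (h2_norm f + h2_norm g)\<^sup>2"
    by (simp add: h2_norm_add_sq[OF assms] power2_sum)
qed (use assms in \<open>simp add: h2_norm_nonneg\<close>)

lemma h2_norm_cmult:
  assumes "f \<in> hardy2"
  shows "h2_norm (\<lambda>z. c * f z) = cmod c * h2_norm f"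
proof (rule power2_eq_imp_eq)
  have "complex_of_real ((h2_norm (\<lambda>z. c * f z))\<^sup>2) = h2_inner (\<lambda>z. c * f z) (\<lambda>z. c * f z)"
    by (rule h2_inner_self[symmetric, OF hardy2_cmult[OF assms]])
  also have "\<dots> = c * (cnj c * h2_inner f f)"
    using assms by (simp only: h2_inner_cmult_left h2_inner_cmult_right hardy2_cmult)
  also have "\<dots> = of_real ((cmod c * h2_norm f)\<^sup>2)"
    unfolding h2_inner_self[OF assms] power_mult_distrib of_real_mult complex_norm_square by (rule mult.assoc[symmetric])
  finally show "(h2_norm (\<lambda>z. c * f z))\<^sup>2 = (cmod c * h2_norm f)\<^sup>2" by (simp only: of_real_eq_iff)
qed (use assms in \<open>auto simp: h2_norm_nonneg hardy2_cmult\<close>)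

lemma h2_norm_minus_commute:
  assumes "f \<in> hardy2" "g \<in> hardy2"
  shows "h2_norm (\<lambda>z. f z - g z) = h2_norm (\<lambda>z. g z - f z)"
  using h2_norm_cmult[OF hardy2_diff[OF assms], of "-1"] by simp

lemma h2_norm_diff_sq:
  assumes "f \<in> hardy2" "g \<in> hardy2"
  shows "(h2_norm (\<lambda>z. f z - g z))\<^sup>2 = (h2_norm f)\<^sup>2 - 2 * Re (h2_inner f g) + (h2_norm g)\<^sup>2"
proof -
  have "h2_inner f (\<lambda>z. - g z) = - h2_inner f g" "h2_norm (\<lambda>z. - g z) = h2_norm g"
    using h2_inner_cmult_right[OF assms(2,1), of "-1"] h2_norm_cmult[OF assms(2), of "-1"] by simp_all
  then show ?thesis
    using h2_norm_add_sq[OF assms(1) hardy2_cmult[OF assms(2), of "-1"]] by simp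
qed

lemma h2_norm_triangle_sub:
  assumes "f \<in> hardy2" "g \<in> hardy2"
  shows "h2_norm f \<le> h2_norm g + h2_norm (\<lambda>z. f z - g z)"
  using h2_norm_triangle[OF assms(2) hardy2_diff[OF assms]] by simp

lemma h2_norm_triangle3:
  assumes "f \<in> hardy2" "g \<in> hardy2" "h \<in> hardy2"
  shows "h2_norm (\<lambda>z. f z - h z) \<le> h2_norm (\<lambda>z. f z - g z) + h2_norm (\<lambda>z. g z - h z)"
  using h2_norm_triangle[OF hardy2_diff[OF assms(1,2)] hardy2_diff[OF assms(2,3)]] by simp

section \<open>Szego kernels and weak limits\<close>

text \<open>
  A pointwise comparison near the boundary is a comparison of the means over circles close to
  the boundary, hence of norms. It covers both multiplication by a bounded function and
  division by \<open>z - w\<close>, where the comparison fails near \<open>w\<close>.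
\<close>

lemma hardy2_dominated:
  assumes "f holomorphic_on ball 0 1" "g \<in> hardy2" "0 \<le> C" "r0 < 1"
    and le: "\<And>z. z \<in> ball 0 1 \<Longrightarrow> r0 \<le> cmod z \<Longrightarrow> cmod (f z) \<le> C * cmod (g z)"
  shows "f \<in> hardy2" "h2_norm f \<le> C * h2_norm g"
proof -
  have B: "mean_sq r f \<le> (C * h2_norm g)\<^sup>2" if r: "r0 \<le> r" "0 \<le> r" "r < 1" for r
  proof -
    have cont: "continuous_on {0..2*pi} (\<lambda>t. (cmod (h (of_real r * cis t)))\<^sup>2)" if "h holomorphic_on ball 0 1" for h
      by (intro continuous_intros continuous_on_subset[OF continuous_on_powser_circle[OF taylor_coeff_sums]])
         (use that r in auto)
    have "integral {0..2*pi} (\<lambda>t. (cmod (f (of_real r * cis t)))\<^sup>2)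
        \<le> integral {0..2*pi} (\<lambda>t. C\<^sup>2 * (cmod (g (of_real r * cis t)))\<^sup>2)"
    proof (rule integral_le)
      fix t
      have "cmod (f (of_real r * cis t)) \<le> C * cmod (g (of_real r * cis t))"
        using r by (intro le cis_in_ball) (auto simp: norm_mult)
      then show "(cmod (f (of_real r * cis t)))\<^sup>2 \<le> C\<^sup>2 * (cmod (g (of_real r * cis t)))\<^sup>2"
        unfolding power_mult_distrib[symmetric] by (intro power_mono) auto
    qed (use assms in \<open>intro integrable_continuous_interval continuous_on_mult continuous_on_const cont, auto simp: hardy2_holomorphic\<close>)+
    then have "mean_sq r f \<le> C\<^sup>2 * mean_sq r g"
      by (simp add: mean_sq_def divide_right_mono)
    also have "\<dots> \<le> C\<^sup>2 * (h2_norm g)\<^sup>2"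
      using r mean_sq_le[of g r] assms(2) by (intro mult_left_mono) (auto simp: hardy2_iff h2_norm_sq)
    finally show ?thesis by (simp add: power_mult_distrib)
  qed
  show f: "f \<in> hardy2"
    using hardy2_of_mean_bound(1)[OF assms(1,4) B] assms(1) by (simp add: hardy2_iff)
  show "h2_norm f \<le> C * h2_norm g"
  proof (rule power2_le_imp_le)
    show "(h2_norm f)\<^sup>2 \<le> (C * h2_norm g)\<^sup>2"
      using hardy2_of_mean_bound(2)[OF assms(1,4) B] by (simp add: h2_norm_sq[OF f])
  qed (use assms in \<open>simp add: h2_norm_nonneg\<close>)
qed

lemma hardy2_mult_bounded:
  assumes "u holomorphic_on ball 0 1" "\<And>z. z \<in> ball 0 1 \<Longrightarrow> cmod (u z) \<le> C" "0 \<le> C" "g \<in> hardy2"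
  shows "(\<lambda>z. u z * g z) \<in> hardy2" "h2_norm (\<lambda>z. u z * g z) \<le> C * h2_norm g"
proof -
  have holo: "(\<lambda>z. u z * g z) holomorphic_on ball 0 1"
    by (intro holomorphic_intros assms(1) hardy2_holomorphic[OF assms(4)])
  have le: "cmod (u z * g z) \<le> C * cmod (g z)" if "z \<in> ball 0 1" for z
    using assms(2)[OF that] by (simp add: norm_mult mult_right_mono)
  show "(\<lambda>z. u z * g z) \<in> hardy2" "h2_norm (\<lambda>z. u z * g z) \<le> C * h2_norm g"
    by (rule hardy2_dominated[OF holo assms(4,3), of 0]; use le in simp)+
qed

lemma taylor_coeff_monomial: "taylor_coeff (\<lambda>z. z ^ m) n = (if n = m then 1 else 0)"
proof (rule taylor_coeff_unique)
  fix z :: complex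
  have "(\<lambda>n. if n = m then z ^ n else 0) sums z ^ m" by (rule sums_single)
  moreover have "(\<lambda>n. if n = m then z ^ n else 0) = (\<lambda>n. (if n = m then 1 else 0) * z ^ n)" by auto
  ultimately show "(\<lambda>n. (if n = m then 1 else 0) * z ^ n) sums z ^ m" by simp
qed

lemma hardy2_monomial: "(\<lambda>z. z ^ m) \<in> hardy2"
proof -
  have "(\<lambda>n. (cmod (taylor_coeff (\<lambda>z. z ^ m) n))\<^sup>2) = (\<lambda>n. if n = m then 1 else 0)"
    by (auto simp: taylor_coeff_monomial)
  then show ?thesis
    using sums_single[of m "\<lambda>_. 1::real"] by (auto simp: hardy2_iff sums_iff intro!: holomorphic_intros)
qed

lemma hardy2_const: "(\<lambda>z. c) \<in> hardy2"
  using hardy2_cmult[OF hardy2_monomial[of 0], of c] by simp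

lemma h2_norm_const: "h2_norm (\<lambda>z. c) = cmod c"
proof -
  have "(\<lambda>n. (cmod (taylor_coeff (\<lambda>z. z ^ 0) n))\<^sup>2) = (\<lambda>n. if n = 0 then 1 else 0)"
    unfolding taylor_coeff_monomial by auto
  then have "(h2_norm (\<lambda>z. z ^ 0))\<^sup>2 = 1"
    using sums_single[of 0 "\<lambda>_. 1::real"] by (simp only: h2_norm_sq[OF hardy2_monomial] sums_iff)
  then have "h2_norm (\<lambda>z. 1) = 1"
    using h2_norm_nonneg[OF hardy2_monomial[of 0]] by (auto simp: power2_eq_1_iff)
  then show ?thesis using h2_norm_cmult[OF hardy2_const[of 1], of c] by simp
qed

lemma h2_inner_monomial:
  assumes "f \<in> hardy2"
  shows "h2_inner f (\<lambda>z. z ^ m) = taylor_coeff f m"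
proof -
  have "(\<lambda>n. taylor_coeff f n * cnj (taylor_coeff (\<lambda>z. z ^ m) n)) = (\<lambda>n. if n = m then taylor_coeff f n else 0)"
    by (auto simp: taylor_coeff_monomial)
  then show ?thesis
    using h2_inner_sums[OF assms hardy2_monomial, of m] sums_single[of m "taylor_coeff f"]
    by (auto intro: sums_unique2)
qed

definition taylor_part :: "nat \<Rightarrow> (complex \<Rightarrow> complex) \<Rightarrow> complex \<Rightarrow> complex" where
  "taylor_part N f z = (\<Sum>n<N. taylor_coeff f n * z ^ n)"

lemma hardy2_taylor_part: "taylor_part N f \<in> hardy2"
  unfolding taylor_part_def[abs_def] by (intro hardy2_sum hardy2_cmult hardy2_monomial)

text \<open>
  The squared distance is a tail of the convergent series of squared coefficients. Thus
  polynomials are dense, which is used wherever a statement about all of \<open>H\<^sup>2\<close> is reduced to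
  one about bounded functions.
\<close>

lemma taylor_part_tendsto:
  assumes "f \<in> hardy2"
  shows "(\<lambda>N. h2_norm (\<lambda>z. f z - taylor_part N f z)) \<longlonglongrightarrow> 0"
proof -
  note d = hardy2_diff[OF assms hardy2_taylor_part]
  have c: "taylor_coeff (\<lambda>z. f z - taylor_part N f z) n = (if n < N then 0 else taylor_coeff f n)" for N n
  proof (rule taylor_coeff_unique)
    fix z :: complex assume z: "z \<in> ball 0 1"
    have "(\<lambda>n. if n \<in> {..<N} then taylor_coeff f n * z ^ n else 0) sums taylor_part N f z"
      unfolding taylor_part_def by (rule sums_If_finite_set) auto
    then have "(\<lambda>n. taylor_coeff f n * z ^ n - (if n \<in> {..<N} then taylor_coeff f n * z ^ n else 0)) sums (f z - taylor_part N f z)"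
      using assms z by (intro sums_diff taylor_coeff_sums) (auto simp: hardy2_iff)
    also have "(\<lambda>n. taylor_coeff f n * z ^ n - (if n \<in> {..<N} then taylor_coeff f n * z ^ n else 0)) = (\<lambda>n. (if n < N then 0 else taylor_coeff f n) * z ^ n)"
      by auto
    finally show "(\<lambda>n. (if n < N then 0 else taylor_coeff f n) * z ^ n) sums (f z - taylor_part N f z)" .
  qed
  have sf: "(\<lambda>n. (cmod (taylor_coeff f n))\<^sup>2) sums (h2_norm f)\<^sup>2"
    using assms by (simp add: h2_norm_sq hardy2_iff summable_sums)
  have "(h2_norm (\<lambda>z. f z - taylor_part N f z))\<^sup>2 = (h2_norm f)\<^sup>2 - (\<Sum>n<N. (cmod (taylor_coeff f n))\<^sup>2)" for N
  proof -
    have "(\<lambda>n. if n \<in> {..<N} then (cmod (taylor_coeff f n))\<^sup>2 else 0) sums (\<Sum>n<N. (cmod (taylor_coeff f n))\<^sup>2)"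
      by (rule sums_If_finite_set) auto
    then have "(\<lambda>n. (cmod (taylor_coeff f n))\<^sup>2 - (if n \<in> {..<N} then (cmod (taylor_coeff f n))\<^sup>2 else 0)) sums ((h2_norm f)\<^sup>2 - (\<Sum>n<N. (cmod (taylor_coeff f n))\<^sup>2))"
      by (intro sums_diff sf)
    also have "(\<lambda>n. (cmod (taylor_coeff f n))\<^sup>2 - (if n \<in> {..<N} then (cmod (taylor_coeff f n))\<^sup>2 else 0)) = (\<lambda>n. (cmod (taylor_coeff (\<lambda>z. f z - taylor_part N f z) n))\<^sup>2)"
      by (auto simp: c)
    finally show ?thesis by (simp add: h2_norm_sq[OF d] sums_iff)
  qed
  moreover have "(\<lambda>N. (h2_norm f)\<^sup>2 - (\<Sum>n<N. (cmod (taylor_coeff f n))\<^sup>2)) \<longlonglongrightarrow> (h2_norm f)\<^sup>2 - (h2_norm f)\<^sup>2"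
    by (intro tendsto_diff tendsto_const) (use sf in \<open>simp add: sums_def\<close>)
  ultimately have "(\<lambda>N. (h2_norm (\<lambda>z. f z - taylor_part N f z))\<^sup>2) \<longlonglongrightarrow> 0" by simp
  then have "(\<lambda>N. sqrt ((h2_norm (\<lambda>z. f z - taylor_part N f z))\<^sup>2)) \<longlonglongrightarrow> sqrt 0"
    by (rule tendsto_real_sqrt)
  then show ?thesis by (simp add: h2_norm_nonneg[OF d])
qed

lemma taylor_coeff_shift:
  assumes "f holomorphic_on ball 0 1"
  shows "taylor_coeff (\<lambda>z. z * f z) n = (case n of 0 \<Rightarrow> 0 | Suc m \<Rightarrow> taylor_coeff f m)"
proof (rule taylor_coeff_unique)
  fix z :: complex assume z: "z \<in> ball 0 1"
  let ?a = "\<lambda>n. (case n of 0 \<Rightarrow> 0 | Suc m \<Rightarrow> taylor_coeff f m) * z ^ n"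
  have "(\<lambda>n. z * (taylor_coeff f n * z ^ n)) sums (z * f z)"
    by (intro sums_mult taylor_coeff_sums assms z)
  then have "(\<lambda>n. ?a (Suc n)) sums (z * f z)" by (simp add: mult_ac)
  then show "?a sums (z * f z)" by (subst (asm) sums_Suc_iff) simp
qed

lemma hardy2_shift: "f \<in> hardy2 \<Longrightarrow> (\<lambda>z. z * f z) \<in> hardy2"
  by (rule hardy2_mult_bounded(1)[where C = 1]) (auto intro: holomorphic_intros)

lemma h2_inner_shift:
  assumes "f \<in> hardy2" "g \<in> hardy2"
  shows "h2_inner (\<lambda>z. z * f z) (\<lambda>z. z * g z) = h2_inner f g"
proof -
  let ?a = "\<lambda>n. taylor_coeff (\<lambda>z. z * f z) n * cnj (taylor_coeff (\<lambda>z. z * g z) n)"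
  have "(\<lambda>n. ?a (Suc n)) sums h2_inner f g"
    using h2_inner_sums[OF assms] assms by (simp add: taylor_coeff_shift hardy2_holomorphic)
  then have "?a sums h2_inner f g"
    using assms by (subst (asm) sums_Suc_iff) (simp add: taylor_coeff_shift hardy2_holomorphic)
  then show ?thesis
    using h2_inner_sums[OF hardy2_shift hardy2_shift, OF assms] by (rule sums_unique2[symmetric])
qed

definition szego :: "complex \<Rightarrow> complex \<Rightarrow> complex" where
  "szego w z = 1 / (1 - cnj w * z)"

lemma one_minus_cnj_mult_nz:
  assumes "cmod w \<le> 1" "z \<in> ball 0 1"
  shows "1 - cnj w * z \<noteq> 0"
proof
  assume "1 - cnj w * z = 0"
  then have "cmod (cnj w * z) = 1" by (metis norm_one right_minus_eq)
  moreover have "cmod w * cmod z \<le> 1 * cmod z" using assms by (intro mult_right_mono) auto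
  ultimately show False using assms(2) by (simp add: norm_mult)
qed

lemma cmod_one_minus_cnj_mult_ge:
  assumes "z \<in> ball 0 1"
  shows "1 - cmod w \<le> cmod (1 - cnj w * z)"
proof -
  have "cmod w * cmod z \<le> cmod w" using assms by (simp add: mult_left_le)
  then show ?thesis
    using norm_triangle_ineq2[of 1 "cnj w * z"] by (simp add: norm_mult)
qed

lemma cmod_one_minus_cnj_mult: "cmod \<zeta> = 1 \<Longrightarrow> cmod (1 - cnj \<zeta> * w) = cmod (w - \<zeta>)"
proof -
  assume "cmod \<zeta> = 1"
  then have "\<zeta> * cnj \<zeta> = 1" by (metis complex_norm_square of_real_1 power_one)
  then have "\<zeta> * (1 - cnj \<zeta> * w) = \<zeta> - w" by (simp add: algebra_simps)
  then have "cmod \<zeta> * cmod (1 - cnj \<zeta> * w) = cmod (\<zeta> - w)" by (metis norm_mult)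
  then show ?thesis using \<open>cmod \<zeta> = 1\<close> by (simp add: norm_minus_commute)
qed

lemma szego_holomorphic: "cmod w \<le> 1 \<Longrightarrow> szego w holomorphic_on ball 0 1"
  unfolding szego_def[abs_def] by (intro holomorphic_intros) (use one_minus_cnj_mult_nz in auto)

lemma taylor_coeff_szego:
  assumes "w \<in> ball 0 1"
  shows "taylor_coeff (szego w) n = cnj w ^ n"
proof (rule taylor_coeff_unique)
  fix z :: complex assume z: "z \<in> ball 0 1"
  have "cmod w * cmod z \<le> 1 * cmod z" using assms by (intro mult_right_mono) auto
  then have "cmod (cnj w * z) < 1" using z by (simp add: norm_mult)
  from geometric_sums[OF this] show "(\<lambda>n. cnj w ^ n * z ^ n) sums szego w z"
    by (simp add: szego_def power_mult_distrib)
qed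

lemma hardy2_szego:
  assumes "w \<in> ball 0 1"
  shows "szego w \<in> hardy2"
proof -
  have "(\<lambda>n. (cmod (taylor_coeff (szego w) n))\<^sup>2) = (\<lambda>n. ((cmod w)\<^sup>2) ^ n)"
    by (simp add: taylor_coeff_szego[OF assms] norm_power power_mult[symmetric] mult.commute)
  then show ?thesis
    using assms by (simp add: hardy2_iff szego_holomorphic power_less_one_iff abs_square_less_1 summable_geometric)
qed

lemma h2_inner_szego:
  assumes "f \<in> hardy2" "w \<in> ball 0 1"
  shows "h2_inner f (szego w) = f w"
  using h2_inner_sums[OF assms(1) hardy2_szego[OF assms(2)]] taylor_coeff_sums[of f w] assms
  by (auto simp: taylor_coeff_szego[OF assms(2)] hardy2_holomorphic intro: sums_unique2)

lemma one_minus_cmod_sq_pos: "w \<in> ball 0 1 \<Longrightarrow> 0 < 1 - (cmod w)\<^sup>2"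
  by (simp add: abs_square_less_1)

lemma h2_norm_szego:
  assumes "w \<in> ball 0 1"
  shows "(h2_norm (szego w))\<^sup>2 = 1 / (1 - (cmod w)\<^sup>2)"
proof -
  have "complex_of_real ((h2_norm (szego w))\<^sup>2) = szego w w"
    using h2_inner_self[OF hardy2_szego[OF assms]] h2_inner_szego[OF hardy2_szego assms, OF assms] by simp
  also have "\<dots> = of_real (1 / (1 - (cmod w)\<^sup>2))"
    unfolding szego_def using complex_norm_square[of w] by (simp add: mult.commute)
  finally show ?thesis by (simp only: of_real_eq_iff)
qed

lemma hardy2_point_bound:
  assumes "f \<in> hardy2" "w \<in> ball 0 1"
  shows "cmod (f w) \<le> h2_norm f / sqrt (1 - (cmod w)\<^sup>2)"
proof -
  have "h2_norm (szego w) = sqrt (1 / (1 - (cmod w)\<^sup>2))"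
    using h2_norm_szego[OF assms(2)] h2_norm_nonneg[OF hardy2_szego[OF assms(2)]]
    by (metis real_sqrt_unique)
  then show ?thesis
    using h2_cauchy_schwarz[OF assms(1) hardy2_szego[OF assms(2)]] h2_inner_szego[OF assms]
    by (simp add: real_sqrt_divide)
qed

lemma h2_norm_pos:
  assumes "f \<in> hardy2" "w \<in> ball 0 1" "f w \<noteq> 0"
  shows "0 < h2_norm f"
proof -
  have "0 < cmod (f w)" using assms by simp
  also have "\<dots> \<le> h2_norm f / sqrt (1 - (cmod w)\<^sup>2)" by (rule hardy2_point_bound[OF assms(1,2)])
  finally show ?thesis using one_minus_cmod_sq_pos[OF assms(2)] by (simp add: zero_less_divide_iff)
qed

text \<open>
  A coefficient is an integral over the circle of radius \<open>1/2\<close>, where a norm bound becomes a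
  uniform bound and dominated convergence applies.
\<close>

lemma taylor_coeff_tendsto:
  assumes F: "\<And>n. F n \<in> hardy2" "\<And>n. h2_norm (F n) \<le> M"
    and f: "f holomorphic_on ball 0 1" "\<And>z. z \<in> ball 0 1 \<Longrightarrow> (\<lambda>n. F n z) \<longlonglongrightarrow> f z"
  shows "(\<lambda>n. taylor_coeff (F n) m) \<longlonglongrightarrow> taylor_coeff f m"
proof -
  let ?z = "\<lambda>t. of_real (1/2) * cis t"
  let ?h = "\<lambda>g t. g (?z t) * cnj ((?z t) ^ m)"
  have fourier: "circle_inner (1/2) g (\<lambda>z. z ^ m) = taylor_coeff g m * of_real ((1/2) ^ (2 * m))"
    if "g holomorphic_on ball 0 1" for g
    by (rule powser_circle_fourier[OF taylor_coeff_sums[OF that]]) auto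
  have "(\<lambda>n. integral {0..2*pi} (?h (F n))) \<longlonglongrightarrow> integral {0..2*pi} (?h f)"
  proof (rule dominated_convergence(2))
    show "?h (F n) integrable_on {0..2*pi}" for n
      by (intro integrable_continuous_interval continuous_on_circle_product)
         (use F in \<open>auto simp: hardy2_holomorphic intro!: holomorphic_intros\<close>)
    show "(\<lambda>_. M / sqrt (1 - (1/2)\<^sup>2)) integrable_on {0..2*pi}"
      by (intro integrable_continuous_interval continuous_intros)
    fix n t
    have z: "?z t \<in> ball 0 1" by (rule cis_in_ball) auto
    have "cmod (F n (?z t)) \<le> h2_norm (F n) / sqrt (1 - (cmod (?z t))\<^sup>2)"
      by (rule hardy2_point_bound[OF F(1) z])
    also have "cmod (?z t) = 1/2" by (simp add: norm_mult)
    also have "h2_norm (F n) / sqrt (1 - (1/2)\<^sup>2) \<le> M / sqrt (1 - (1/2)\<^sup>2)"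
      by (intro divide_right_mono F(2)) (auto simp: power2_eq_square)
    finally have "cmod (F n (?z t)) \<le> M / sqrt (1 - (1/2)\<^sup>2)" .
    moreover have "cmod (cnj ((?z t) ^ m)) \<le> 1"
      by (simp add: norm_mult norm_power power_le_one)
    ultimately show "norm (?h (F n) t) \<le> M / sqrt (1 - (1/2)\<^sup>2)"
      unfolding norm_mult by (smt (verit) mult_left_le norm_ge_zero)
    show "(\<lambda>n. ?h (F n) t) \<longlonglongrightarrow> ?h f t"
      by (intro tendsto_mult tendsto_const f(2) z)
  qed
  then have "(\<lambda>n. circle_inner (1/2) (F n) (\<lambda>z. z ^ m)) \<longlonglongrightarrow> circle_inner (1/2) f (\<lambda>z. z ^ m)"
    unfolding circle_inner_def by (rule tendsto_mult_left)
  then have "(\<lambda>n. taylor_coeff (F n) m * of_real ((1/2) ^ (2 * m))) \<longlonglongrightarrow> taylor_coeff f m * of_real ((1/2) ^ (2 * m))"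
    using fourier F f by (simp only: hardy2_holomorphic)
  then have "(\<lambda>n. taylor_coeff (F n) m * of_real ((1/2) ^ (2 * m)) * of_real (2 ^ (2*m))) \<longlonglongrightarrow> taylor_coeff f m * of_real ((1/2) ^ (2 * m)) * of_real (2 ^ (2*m))"
    by (rule tendsto_mult_right)
  moreover have "complex_of_real ((1/2) ^ (2 * m)) * of_real (2 ^ (2*m)) = 1"
    unfolding of_real_mult[symmetric] power_mult_distrib[symmetric] by simp
  ultimately show ?thesis by (simp only: mult.assoc mult_1_right)
qed

text \<open>
  Bounded sequences in a Hilbert space converge weakly as soon as they converge against a
  dense set. Here pointwise convergence in the disc gives convergence of each coefficient,
  that is, convergence against polynomials.
\<close>

theorem hardy2_weak_limit:
  assumes F: "\<And>n. F n \<in> hardy2" "\<And>n. h2_norm (F n) \<le> M"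
    and f: "f holomorphic_on ball 0 1" "\<And>z. z \<in> ball 0 1 \<Longrightarrow> (\<lambda>n. F n z) \<longlonglongrightarrow> f z"
  shows "f \<in> hardy2" "h2_norm f \<le> M" "g \<in> hardy2 \<Longrightarrow> (\<lambda>n. h2_inner (F n) g) \<longlonglongrightarrow> h2_inner f g"
proof -
  note tc = taylor_coeff_tendsto[OF assms]
  have M: "0 \<le> M" using F h2_norm_nonneg order_trans by blast
  have part: "(\<Sum>m<N. (cmod (taylor_coeff f m))\<^sup>2) \<le> M\<^sup>2" for N
  proof (rule LIMSEQ_le_const2)
    show "(\<lambda>n. \<Sum>m<N. (cmod (taylor_coeff (F n) m))\<^sup>2) \<longlonglongrightarrow> (\<Sum>m<N. (cmod (taylor_coeff f m))\<^sup>2)"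
      by (intro tendsto_intros tc)
    have "(\<Sum>m<N. (cmod (taylor_coeff (F n) m))\<^sup>2) \<le> M\<^sup>2" for n
    proof -
      have "(\<Sum>m<N. (cmod (taylor_coeff (F n) m))\<^sup>2) \<le> (h2_norm (F n))\<^sup>2"
        unfolding h2_norm_sq[OF F(1)] using F(1)[of n] by (intro sum_le_suminf) (auto simp: hardy2_iff)
      also have "\<dots> \<le> M\<^sup>2" using F h2_norm_nonneg by (intro power_mono) auto
      finally show ?thesis .
    qed
    then show "\<exists>K. \<forall>n\<ge>K. (\<Sum>m<N. (cmod (taylor_coeff (F n) m))\<^sup>2) \<le> M\<^sup>2" by blast
  qed
  have "summable (\<lambda>n. (cmod (taylor_coeff f n))\<^sup>2)"
    by (rule summableI_nonneg_bounded[OF _ part]) auto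
  then show f2: "f \<in> hardy2" using f by (simp add: hardy2_iff)
  have "(h2_norm f)\<^sup>2 \<le> M\<^sup>2"
    unfolding h2_norm_sq[OF f2] using f2 part by (intro suminf_le_const) (auto simp: hardy2_iff)
  then show fM: "h2_norm f \<le> M" using M by (rule power2_le_imp_le)
  show "(\<lambda>n. h2_inner (F n) g) \<longlonglongrightarrow> h2_inner f g" if g: "g \<in> hardy2"
  proof (rule LIMSEQ_I)
    fix e :: real assume e: "e > 0"
    have "e / (4 * (M + 1)) > 0" using e M by simp
    then obtain N where N: "h2_norm (\<lambda>z. g z - taylor_part N g z) < e / (4 * (M + 1))"
      using LIMSEQ_D[OF taylor_part_tendsto[OF g], of "e / (4 * (M + 1))"]
        h2_norm_nonneg[OF hardy2_diff[OF g hardy2_taylor_part]] by auto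
    let ?p = "taylor_part N g"
    have ip: "h2_inner h ?p = (\<Sum>m<N. cnj (taylor_coeff g m) * taylor_coeff h m)" if "h \<in> hardy2" for h
    proof -
      have "h2_inner h ?p = (\<Sum>m<N. h2_inner h (\<lambda>z. taylor_coeff g m * z ^ m))"
        unfolding taylor_part_def[abs_def]
        by (rule h2_inner_sum_right) (auto intro: hardy2_cmult hardy2_monomial that)
      then show ?thesis
        by (simp only: h2_inner_cmult_right[OF hardy2_monomial that] h2_inner_monomial[OF that])
    qed
    have "(\<lambda>n. h2_inner (F n) ?p) \<longlonglongrightarrow> h2_inner f ?p"
      unfolding ip[OF F(1)] ip[OF f2] by (intro tendsto_intros tc)
    then obtain K where K: "\<And>n. n \<ge> K \<Longrightarrow> cmod (h2_inner (F n) ?p - h2_inner f ?p) < e / 2"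
      using LIMSEQ_D[of _ _ "e/2"] e by (metis half_gt_zero)
    show "\<exists>K. \<forall>n\<ge>K. cmod (h2_inner (F n) g - h2_inner f g) < e"
    proof (intro exI allI impI)
      fix n assume n: "n \<ge> K"
      let ?d = "\<lambda>z. F n z - f z" and ?r = "\<lambda>z. g z - ?p z"
      note d = hardy2_diff[OF F(1) f2, of n] and r = hardy2_diff[OF g hardy2_taylor_part, of N g]
      have "h2_inner (F n) g - h2_inner f g = h2_inner ?d g"
        by (simp add: h2_inner_diff_left[OF F(1) f2 g])
      also have "\<dots> = h2_inner ?d ?p + h2_inner ?d ?r"
        using h2_inner_add_right[OF hardy2_taylor_part[of N g] r d] by simp
      finally have "cmod (h2_inner (F n) g - h2_inner f g) \<le> cmod (h2_inner ?d ?p) + h2_norm ?d * h2_norm ?r"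
        using order_trans[OF norm_triangle_ineq add_left_mono[OF h2_cauchy_schwarz[OF d r]]] by simp
      moreover have "cmod (h2_inner ?d ?p) < e / 2"
        using K[OF n] by (simp add: h2_inner_diff_left[OF F(1) f2 hardy2_taylor_part])
      moreover have "h2_norm ?d * h2_norm ?r \<le> (2 * (M + 1)) * (e / (4 * (M + 1)))"
      proof (rule mult_mono)
        have "h2_norm ?d \<le> h2_norm (F n) + h2_norm f"
          using h2_norm_triangle[OF F(1) hardy2_cmult[OF f2, of "-1"]] h2_norm_cmult[OF f2, of "-1"] by simp
        then show "h2_norm ?d \<le> 2 * (M + 1)" using F(2)[of n] fM by simp
      qed (use N M h2_norm_nonneg[OF r] in auto)
      moreover have "(2 * (M + 1)) * (e / (4 * (M + 1))) = e / 2" using M by (simp add: field_simps)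
      ultimately show "cmod (h2_inner (F n) g - h2_inner f g) < e" by linarith
    qed
  qed
qed

section \<open>Difference quotients\<close>

definition diff_quot :: "(complex \<Rightarrow> complex) \<Rightarrow> complex \<Rightarrow> complex \<Rightarrow> complex" where
  "diff_quot f w z = (if z = w then deriv f w else (f z - f w) / (z - w))"

lemma diff_quot_mult: "(z - w) * diff_quot f w z = f z - f w"
  by (simp add: diff_quot_def)

text \<open>
  Away from \<open>w\<close> the denominator is bounded below; near \<open>w\<close> the quotient is holomorphic, which
  is all that counts.
\<close>

lemma hardy2_diff_quot:
  assumes "f \<in> hardy2" "w \<in> ball 0 1"
  shows "diff_quot f w \<in> hardy2"
proof (rule hardy2_dominated(1))
  show "diff_quot f w holomorphic_on ball 0 1"
    unfolding diff_quot_def[abs_def]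
    by (rule pole_lemma_open) (use assms in \<open>auto simp: hardy2_holomorphic\<close>)
  show "(\<lambda>z. f z - f w) \<in> hardy2" using assms by (intro hardy2_diff hardy2_const)
  show "(1 + cmod w) / 2 < 1" "0 \<le> 2 / (1 - cmod w)" using assms by auto
  fix z assume "(1 + cmod w) / 2 \<le> cmod z"
  then have z: "(1 - cmod w) / 2 \<le> cmod (z - w)" "z \<noteq> w" "0 < 1 - cmod w"
    using norm_triangle_ineq2[of z w] assms by auto
  then have "cmod (f z - f w) * ((1 - cmod w) / 2) \<le> cmod (f z - f w) * cmod (z - w)"
    by (intro mult_left_mono) auto
  then show "cmod (diff_quot f w z) \<le> 2 / (1 - cmod w) * cmod (f z - f w)"
  proof -
    assume *: "cmod (f z - f w) * ((1 - cmod w) / 2) \<le> cmod (f z - f w) * cmod (z - w)"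
    have e: "f z - f w = (z - w) * diff_quot f w z" by (simp only: diff_quot_mult)
    have "(1 - cmod w) / 2 * cmod (diff_quot f w z) \<le> cmod (f z - f w)"
      unfolding e norm_mult using z by (intro mult_right_mono) auto
    then show ?thesis using z by (simp add: field_simps)
  qed
qed

text \<open>
  With \<open>q\<close> the difference quotient, \<open>z q + f(w) = w q + f\<close>. On the left the constant is
  orthogonal to \<open>z q\<close> and \<open>\<parallel>z q\<parallel> = \<parallel>q\<parallel>\<close>, so \<open>\<parallel>q\<parallel> \<le> \<bar>w\<bar> \<parallel>q\<parallel> + \<parallel>f\<parallel>\<close>. It matters that the bound
  does not contain \<open>f(w)\<close>: it is applied to remainders of Taylor series, which need not vanish
  at \<open>w\<close>.
\<close>

lemma h2_norm_diff_quot: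
  assumes "f \<in> hardy2" "w \<in> ball 0 1"
  shows "(1 - cmod w) * h2_norm (diff_quot f w) \<le> h2_norm f"
proof -
  let ?q = "diff_quot f w" and ?H = "\<lambda>z. z * diff_quot f w z + f w"
  note q = hardy2_diff_quot[OF assms] and zq = hardy2_shift[OF hardy2_diff_quot[OF assms]]
  have "h2_inner (\<lambda>z. z * ?q z) (\<lambda>_. 1) = 0"
    using h2_inner_monomial[OF zq, of 0] taylor_coeff_shift[OF hardy2_holomorphic[OF q], of 0] by simp
  then have orth: "h2_inner (\<lambda>z. z * ?q z) (\<lambda>_. f w) = 0"
    using h2_inner_cmult_right[OF hardy2_const[of 1] zq, of "f w"] by simp
  have "(h2_norm ?q)\<^sup>2 = (h2_norm (\<lambda>z. z * ?q z))\<^sup>2"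
    by (simp add: h2_norm_def h2_inner_shift[OF q q])
  also have "\<dots> \<le> (h2_norm ?H)\<^sup>2"
    using h2_norm_add_sq[OF zq hardy2_const[of "f w"]] orth by simp
  finally have "h2_norm ?q \<le> h2_norm ?H"
    using hardy2_add[OF zq hardy2_const] h2_norm_nonneg power2_le_imp_le by blast
  also have "?H = (\<lambda>z. w * ?q z + f z)"
    using diff_quot_mult[of _ w f] by (auto simp: algebra_simps)
  also have "h2_norm \<dots> \<le> cmod w * h2_norm ?q + h2_norm f"
    using h2_norm_triangle[OF hardy2_cmult[OF q] assms(1)] h2_norm_cmult[OF q] by simp
  finally show ?thesis by (simp add: algebra_simps)
qed

text \<open>
  A polynomial is Lipschitz on the disc, and the bound is its Lipschitz constant; it does not
  depend on \<open>w\<close>.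
\<close>

lemma h2_norm_diff_quot_taylor_part:
  assumes "w \<in> ball 0 1"
  shows "h2_norm (diff_quot (taylor_part N f) w) \<le> (\<Sum>n<N. cmod (taylor_coeff f n) * n)"
proof -
  let ?p = "taylor_part N f" and ?C = "\<Sum>n<N. cmod (taylor_coeff f n) * n"
  have "h2_norm (diff_quot ?p w) \<le> ?C * h2_norm (\<lambda>_. 1)"
  proof (rule hardy2_dominated(2))
    show "diff_quot ?p w holomorphic_on ball 0 1"
      using hardy2_holomorphic[OF hardy2_diff_quot[OF hardy2_taylor_part assms]] .
    show "(1 + cmod w) / 2 < 1" using assms by auto
    show "0 \<le> ?C" by (intro sum_nonneg) auto
    fix z :: complex assume z: "z \<in> ball 0 1" "(1 + cmod w) / 2 \<le> cmod z"
    then have zw: "z \<noteq> w" using assms by auto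
    have "cmod (?p z - ?p w) = cmod (\<Sum>n<N. taylor_coeff f n * (z ^ n - w ^ n))"
      by (simp add: taylor_part_def sum_subtractf right_diff_distrib)
    also have "\<dots> \<le> (\<Sum>n<N. cmod (taylor_coeff f n) * (n * cmod (z - w)))"
    proof (rule order_trans[OF norm_sum], rule sum_mono)
      fix n
      have "cmod (z ^ n - w ^ n) \<le> n * cmod (z - w)"
        using z assms by (intro norm_power_diff) auto
      then show "cmod (taylor_coeff f n * (z ^ n - w ^ n)) \<le> cmod (taylor_coeff f n) * (n * cmod (z - w))"
        by (simp add: norm_mult mult_left_mono)
    qed
    finally have "cmod (?p z - ?p w) \<le> ?C * cmod (z - w)"
      by (simp add: sum_distrib_right mult.assoc)
    then show "cmod (diff_quot ?p w z) \<le> ?C * cmod 1"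
      using zw by (simp add: diff_quot_def norm_divide pos_divide_le_eq)
  qed (rule hardy2_const)
  then show ?thesis by (simp add: h2_norm_const)
qed

lemma diff_quot_split:
  assumes "f holomorphic_on ball 0 1" "g holomorphic_on ball 0 1" "w \<in> ball 0 1"
  shows "diff_quot f w z = diff_quot g w z + diff_quot (\<lambda>z. f z - g z) w z"
proof -
  have "f field_differentiable at w" "g field_differentiable at w"
    using assms by (auto intro: holomorphic_on_imp_differentiable_at[of _ "ball 0 1"])
  then show ?thesis
    by (simp add: diff_quot_def diff_divide_distrib add_divide_distrib)
qed

text \<open>
  The operators \<open>f \<mapsto> (w - a) (f - f(w)) / (z - w)\<close> are bounded by \<open>2 \<gamma>\<close>, because
  \<open>\<bar>w - a\<bar> \<le> 2 \<bar>w - \<zeta>\<bar> \<le> 2 \<gamma> (1 - \<bar>w\<bar>)\<close> when \<open>w\<close> lies in the Stolz angle and \<open>a\<close> is closer to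
  \<open>\<zeta>\<close> than \<open>w\<close>. On polynomials they tend to \<open>0\<close> as \<open>w \<rightarrow> \<zeta>\<close>, hence they do so on all of \<open>H\<^sup>2\<close>.
\<close>

theorem diff_quot_stolz_small:
  assumes f: "f \<in> hardy2" and e: "e > 0" and \<gamma>: "\<gamma> > 0"
  obtains d where "d > 0" "\<And>w a. w \<in> stolz_angle \<gamma> \<zeta> \<Longrightarrow> cmod (w - \<zeta>) < d \<Longrightarrow> cmod (a - \<zeta>) \<le> cmod (w - \<zeta>)
      \<Longrightarrow> cmod (w - a) * h2_norm (diff_quot f w) < e"
proof -
  have "e / (4 * \<gamma>) > 0" using e \<gamma> by simp
  then obtain N where N: "h2_norm (\<lambda>z. f z - taylor_part N f z) < e / (4 * \<gamma>)"
    using LIMSEQ_D[OF taylor_part_tendsto[OF f], of "e / (4 * \<gamma>)"]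
      h2_norm_nonneg[OF hardy2_diff[OF f hardy2_taylor_part]] by auto
  let ?p = "taylor_part N f" and ?r = "\<lambda>z. f z - taylor_part N f z"
  define C where "C = (\<Sum>n<N. cmod (taylor_coeff f n) * n)"
  have C: "C \<ge> 0" unfolding C_def by (intro sum_nonneg) auto
  note p = hardy2_taylor_part[of N f] and r = hardy2_diff[OF f hardy2_taylor_part, of N f]
  define d where "d = e / (4 * (C + 1))"
  have d: "d > 0" using e C by (simp add: d_def)
  show thesis
  proof (rule that[OF d])
    fix w a assume w: "w \<in> stolz_angle \<gamma> \<zeta>" and wd: "cmod (w - \<zeta>) < d" and a: "cmod (a - \<zeta>) \<le> cmod (w - \<zeta>)"
    have wb: "w \<in> ball 0 1" and ws: "cmod (w - \<zeta>) \<le> \<gamma> * (1 - cmod w)"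
      using w by (auto simp: stolz_angle_def)
    have wa: "cmod (w - a) \<le> 2 * cmod (w - \<zeta>)"
      using norm_triangle_ineq4[of "w - \<zeta>" "a - \<zeta>"] a by simp
    have "diff_quot f w = (\<lambda>z. diff_quot ?p w z + diff_quot ?r w z)"
      by (rule ext, rule diff_quot_split) (use f p wb in \<open>auto simp: hardy2_holomorphic\<close>)
    then have "h2_norm (diff_quot f w) \<le> h2_norm (diff_quot ?p w) + h2_norm (diff_quot ?r w)"
      using h2_norm_triangle[OF hardy2_diff_quot[OF p wb] hardy2_diff_quot[OF r wb]] by simp
    then have "cmod (w - a) * h2_norm (diff_quot f w)
        \<le> cmod (w - a) * h2_norm (diff_quot ?p w) + cmod (w - a) * h2_norm (diff_quot ?r w)"
      by (metis distrib_left mult_left_mono norm_ge_zero)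
    moreover have "cmod (w - a) * h2_norm (diff_quot ?p w) < e / 2"
    proof -
      have "cmod (w - a) * h2_norm (diff_quot ?p w) \<le> (2 * d) * C"
        using wa wd h2_norm_diff_quot_taylor_part[OF wb, of N f] h2_norm_nonneg[OF hardy2_diff_quot[OF p wb]]
          d
        by (intro mult_mono) (auto simp: C_def)
      also have "\<dots> < e / 2" using C e by (simp add: d_def field_simps)
      finally show ?thesis .
    qed
    moreover have "cmod (w - a) * h2_norm (diff_quot ?r w) \<le> e / 2"
    proof -
      have "cmod (w - a) * h2_norm (diff_quot ?r w) \<le> (2 * \<gamma> * (1 - cmod w)) * h2_norm (diff_quot ?r w)"
        using wa ws h2_norm_nonneg[OF hardy2_diff_quot[OF r wb]] by (intro mult_right_mono) auto
      also have "\<dots> = 2 * \<gamma> * ((1 - cmod w) * h2_norm (diff_quot ?r w))" by simp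
      also have "\<dots> \<le> 2 * \<gamma> * (e / (4 * \<gamma>))"
        using \<gamma> N h2_norm_diff_quot[OF r wb] by (intro mult_left_mono) auto
      finally show ?thesis using \<gamma> by simp
    qed
    ultimately show "cmod (w - a) * h2_norm (diff_quot f w) < e" by linarith
  qed
qed

section \<open>Model spaces and reproducing kernels\<close>

lemma inner_function_holomorphic: "inner_function \<theta> \<Longrightarrow> \<theta> holomorphic_on ball 0 1"
  by (simp add: inner_function_def)

lemma inner_function_le_1: "inner_function \<theta> \<Longrightarrow> z \<in> ball 0 1 \<Longrightarrow> cmod (\<theta> z) \<le> 1"
  by (simp add: inner_function_def)

lemma hardy2_inner_mult:
  assumes "inner_function \<theta>" "h \<in> hardy2"
  shows "(\<lambda>z. \<theta> z * h z) \<in> hardy2" "h2_norm (\<lambda>z. \<theta> z * h z) \<le> h2_norm h"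
  using hardy2_mult_bounded[OF inner_function_holomorphic[OF assms(1)] _ _ assms(2), of 1]
    inner_function_le_1[OF assms(1)] by auto

lemma hardy2_inner_function: "inner_function \<theta> \<Longrightarrow> \<theta> \<in> hardy2"
  using hardy2_inner_mult(1)[OF _ hardy2_const[of 1]] by simp

text \<open>
  The radial limits have modulus \<open>1\<close> almost everywhere, so by dominated convergence the means
  of \<open>\<bar>\<theta>\<bar>\<^sup>2\<close> tend to \<open>1\<close>. All isometry properties of multiplication by \<open>\<theta>\<close> follow from it
  algebraically.
\<close>

lemma h2_norm_inner_function:
  assumes "inner_function \<theta>"
  shows "h2_norm \<theta> = 1"
proof -
  note \<theta> = hardy2_inner_function[OF assms] and holo = inner_function_holomorphic[OF assms]
  \<comment> \<open>Dominated convergence is stated for sequences, so a sequence of radii is fixed.\<close>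
  define r :: "nat \<Rightarrow> real" where "r k = 1 - inverse (real (Suc k))" for k
  have r: "0 \<le> r k" "r k < 1" for k by (auto simp: r_def inverse_le_1_iff)
  have r1: "r \<longlonglongrightarrow> 1" unfolding r_def using tendsto_diff[OF tendsto_const LIMSEQ_inverse_real_of_nat, of 1] by simp
  have rl: "filterlim r (at_left 1) sequentially"
    unfolding filterlim_at using r r1 by (auto simp: less_imp_neq)
  let ?s = "\<lambda>k t. (cmod (\<theta> (of_real (r k) * cis t)))\<^sup>2"
  have cont: "continuous_on {0..2*pi} (?s k)" for k
    by (intro continuous_intros continuous_on_subset[OF continuous_on_powser_circle[OF taylor_coeff_sums[OF holo] r]]) auto
  have int: "set_integrable lborel {0..2*pi} (?s k)" for k
    by (rule borel_integrable_atLeastAtMost'[OF cont])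
  have "(\<lambda>k. integral\<^sup>L lborel (\<lambda>t. indicator {0..2*pi} t *\<^sub>R ?s k t)) \<longlonglongrightarrow> integral\<^sup>L lborel (indicator {0..2*pi} :: real \<Rightarrow> real)"
  proof (rule integral_dominated_convergence[where w = "indicator {0..2*pi}"])
    show "integrable lborel (indicator {0..2*pi} :: real \<Rightarrow> real)" by simp
    show "(\<lambda>t. indicator {0..2*pi} t *\<^sub>R ?s k t) \<in> borel_measurable lborel" for k
      using int[of k] unfolding set_integrable_def by (rule borel_measurable_integrable)
    have "AE t in lborel. \<exists>L. cmod L = 1 \<and> ((\<lambda>r. \<theta> (of_real r * cis t)) \<longlongrightarrow> L) (at_left 1)"
      using assms by (simp add: inner_function_def)
    then show "AE t in lborel. (\<lambda>k. indicator {0..2*pi} t *\<^sub>R ?s k t) \<longlonglongrightarrow> indicator {0..2*pi} t"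
    proof eventually_elim
      case (elim t)
      then obtain L where L: "cmod L = 1" "((\<lambda>r. \<theta> (of_real r * cis t)) \<longlongrightarrow> L) (at_left 1)" by blast
      have "(\<lambda>k. \<theta> (of_real (r k) * cis t)) \<longlonglongrightarrow> L"
        by (rule filterlim_compose[OF L(2) rl])
      then have "(\<lambda>k. indicator {0..2*pi} t *\<^sub>R ?s k t) \<longlonglongrightarrow> indicator {0..2*pi} t *\<^sub>R (cmod L)\<^sup>2"
        by (intro tendsto_intros)
      then show ?case using L by simp
    qed
    show "AE t in lborel. norm (indicator {0..2*pi} t *\<^sub>R ?s k t) \<le> indicator {0..2*pi} t" for k
    proof (rule always_eventually, rule allI)
      fix t
      have "of_real (r k) * cis t \<in> ball 0 1" using r[of k] by (intro cis_in_ball) auto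
      then have "?s k t \<le> 1" using inner_function_le_1[OF assms] by (intro power_le_one) auto
      then show "norm (indicator {0..2*pi} t *\<^sub>R ?s k t) \<le> indicator {0..2*pi} t"
        by (auto simp: indicator_def)
    qed
  qed simp
  moreover have "integral\<^sup>L lborel (\<lambda>t. indicator {0..2*pi} t *\<^sub>R ?s k t) = 2 * pi * mean_sq (r k) \<theta>" for k
    using set_borel_integral_eq_integral(2)[OF int[of k]]
    by (simp add: set_lebesgue_integral_def mean_sq_def)
  ultimately have "(\<lambda>k. 2 * pi * mean_sq (r k) \<theta>) \<longlonglongrightarrow> 2 * pi" by simp
  then have "(\<lambda>k. 2 * pi * mean_sq (r k) \<theta> / (2 * pi)) \<longlonglongrightarrow> 2 * pi / (2 * pi)"
    by (intro tendsto_divide tendsto_const) auto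
  then have "(\<lambda>k. mean_sq (r k) \<theta>) \<longlonglongrightarrow> 1" by simp
  then have "(\<lambda>k. complex_of_real (mean_sq (r k) \<theta>)) \<longlonglongrightarrow> of_real 1" by (rule tendsto_of_real)
  moreover have "(\<lambda>k. circle_inner (r k) \<theta> \<theta>) \<longlonglongrightarrow> h2_inner \<theta> \<theta>"
    by (rule filterlim_compose[OF circle_inner_tendsto[OF \<theta> \<theta>] rl])
  ultimately have "h2_inner \<theta> \<theta> = of_real 1"
    unfolding circle_inner_self[OF holo r] using LIMSEQ_unique by blast
  then show ?thesis by (simp add: h2_norm_def)
qed

text \<open>
  The form \<open>\<langle>g, h\<rangle> - \<langle>\<theta> g, \<theta> h\<rangle>\<close> is positive semidefinite, because multiplication by \<open>\<theta>\<close> is a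
  contraction. A vector on which such a form vanishes is in its kernel.
\<close>

lemma inner_mult_isometric_extend:
  assumes \<theta>: "inner_function \<theta>" and f: "f \<in> hardy2" and h: "h \<in> hardy2"
    and eq: "h2_norm (\<lambda>z. \<theta> z * f z) = h2_norm f"
  shows "h2_inner (\<lambda>z. \<theta> z * h z) (\<lambda>z. \<theta> z * f z) = h2_inner h f"
proof -
  let ?T = "\<lambda>g z. \<theta> z * g z"
  define b where "b = h2_inner h f - h2_inner (?T h) (?T f)"
  define D where "D = (h2_norm h)\<^sup>2 - (h2_norm (?T h))\<^sup>2"
  note Tf = hardy2_inner_mult(1)[OF \<theta> f] and Th = hardy2_inner_mult(1)[OF \<theta> h]
  have key: "2 * real n * (cmod b)\<^sup>2 \<le> D" for n
  proof -
    \<comment> \<open>Among all perturbations of \<open>h\<close> by multiples of \<open>f\<close>, these make the linear term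
       equal to \<open>- 2 n \<bar>b\<bar>\<^sup>2\<close>; the quadratic terms cancel by \<open>eq\<close>.\<close>
    define t where "t = - of_nat n * b"
    let ?g = "\<lambda>z. h z + t * f z"
    have g: "?g \<in> hardy2" by (intro hardy2_add hardy2_cmult f h)
    have "?T ?g = (\<lambda>z. ?T h z + t * ?T f z)" by (auto simp: algebra_simps)
    then have "(h2_norm (?T ?g))\<^sup>2 = (h2_norm (?T h))\<^sup>2 + 2 * Re (cnj t * h2_inner (?T h) (?T f)) + (cmod t * h2_norm f)\<^sup>2"
      by (simp only: h2_norm_add_sq[OF Th hardy2_cmult[OF Tf]] h2_inner_cmult_right[OF Tf Th] h2_norm_cmult[OF Tf] eq)
    moreover have "(h2_norm ?g)\<^sup>2 = (h2_norm h)\<^sup>2 + 2 * Re (cnj t * h2_inner h f) + (cmod t * h2_norm f)\<^sup>2"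
      by (simp only: h2_norm_add_sq[OF h hardy2_cmult[OF f]] h2_inner_cmult_right[OF f h] h2_norm_cmult[OF f])
    moreover have "(h2_norm (?T ?g))\<^sup>2 \<le> (h2_norm ?g)\<^sup>2"
      using hardy2_inner_mult[OF \<theta> g] h2_norm_nonneg by (intro power_mono) auto
    moreover have "Re (cnj t * h2_inner h f) - Re (cnj t * h2_inner (?T h) (?T f)) = Re (cnj t * b)"
      by (simp add: b_def algebra_simps)
    moreover have "Re (cnj t * b) = - real n * (cmod b)\<^sup>2"
    proof -
      have "cnj t * b = - of_nat n * (b * cnj b)" by (simp add: t_def)
      also have "\<dots> = of_real (- real n * (cmod b)\<^sup>2)"
        unfolding complex_norm_square[symmetric] by simp
      finally show ?thesis by (metis Re_complex_of_real)
    qed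
    ultimately show ?thesis unfolding D_def by argo
  qed
  have "b = 0"
  proof (rule ccontr)
    assume "b \<noteq> 0"
    then have "0 < 2 * (cmod b)\<^sup>2" by simp
    then obtain n :: nat where "D < n * (2 * (cmod b)\<^sup>2)"
      using reals_Archimedean3 by blast
    with key[of n] show False by (simp add: mult_ac)
  qed
  then show ?thesis by (simp add: b_def)
qed

text \<open>
  Let \<open>s\<close> be the Szego kernel. The defect form of the previous lemma vanishes on the constant
  \<open>1\<close>, so \<open>1\<close> is in its kernel, and it is invariant under multiplication of both arguments by
  \<open>z\<close>. Inserting \<open>s = 1 + cnj w * z * s\<close> shows that its value at \<open>s\<close> is \<open>\<bar>w\<bar>\<^sup>2\<close> times itself,
  hence \<open>0\<close>.
\<close>

lemma h2_inner_inner_mult_szego: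
  assumes \<theta>: "inner_function \<theta>" and h: "h \<in> hardy2" and w: "w \<in> ball 0 1"
  shows "h2_inner (\<lambda>z. \<theta> z * h z) (\<lambda>z. \<theta> z * szego w z) = h w"
proof -
  let ?s = "szego w" and ?T = "\<lambda>g z. \<theta> z * g z"
  note s = hardy2_szego[OF w] and Ts = hardy2_inner_mult(1)[OF \<theta> hardy2_szego[OF w]]
  have one: "h2_inner (?T g) \<theta> = h2_inner g (\<lambda>_. 1)" if "g \<in> hardy2" for g
    using inner_mult_isometric_extend[OF \<theta> hardy2_const[of 1] that]
    by (simp add: h2_norm_inner_function[OF \<theta>] h2_norm_const)
  have split: "?s z = 1 + cnj w * (z * ?s z)" if "z \<in> ball 0 1" for z
    using one_minus_cnj_mult_nz[of w z] w that by (simp add: szego_def field_simps)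
  have s': "(\<lambda>z. cnj w * (z * ?s z)) \<in> hardy2" by (intro hardy2_cmult hardy2_shift s)
  have Tsplit: "?T ?s z = \<theta> z + cnj w * (z * ?T ?s z)" if "z \<in> ball 0 1" for z
    using split[OF that] by (metis (no_types, lifting) distrib_left mult.left_commute mult.right_neutral)
  have zTs: "(\<lambda>z. z * ?T ?s z) \<in> hardy2" by (intro hardy2_shift Ts)
  have inner_sq: "of_real ((h2_norm g)\<^sup>2) = h2_inner g k + w * h2_inner g (\<lambda>z. z * g z)"
    if "g \<in> hardy2" "k \<in> hardy2" "\<And>z. z \<in> ball 0 1 \<Longrightarrow> g z = k z + cnj w * (z * g z)" for g k
  proof -
    note zg = hardy2_shift[OF that(1)]
    have "h2_inner g g = h2_inner g (\<lambda>z. k z + cnj w * (z * g z))"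
      by (rule h2_inner_cong) (use that hardy2_add[OF that(2) hardy2_cmult[OF zg]] in auto)
    then show ?thesis
      by (simp add: h2_inner_self[OF that(1)] h2_inner_add_right[OF that(2) hardy2_cmult[OF zg] that(1)]
        h2_inner_cmult_right[OF zg that(1)])
  qed
  have inner_shift: "h2_inner g (\<lambda>z. z * g z) = h2_inner k (\<lambda>z. z * g z) + cnj w * of_real ((h2_norm g)\<^sup>2)"
    if "g \<in> hardy2" "k \<in> hardy2" "\<And>z. z \<in> ball 0 1 \<Longrightarrow> g z = k z + cnj w * (z * g z)" for g k
  proof -
    note zg = hardy2_shift[OF that(1)]
    have "h2_inner g (\<lambda>z. z * g z) = h2_inner (\<lambda>z. k z + cnj w * (z * g z)) (\<lambda>z. z * g z)"
      by (rule h2_inner_cong) (use that zg hardy2_add[OF that(2) hardy2_cmult[OF zg]] in auto)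
    also have "\<dots> = h2_inner k (\<lambda>z. z * g z) + cnj w * h2_inner (\<lambda>z. z * g z) (\<lambda>z. z * g z)"
      by (simp only: h2_inner_add_left[OF that(2) hardy2_cmult[OF zg] zg] h2_inner_cmult_left[OF zg zg])
    finally show ?thesis by (simp add: h2_inner_shift[OF that(1,1)] h2_inner_self[OF that(1)])
  qed
  have k1: "h2_inner ?s (\<lambda>_. 1) = h2_inner (?T ?s) \<theta>" using one[OF s] by simp
  have k2: "h2_inner (\<lambda>_. 1) (\<lambda>z. z * ?s z) = h2_inner \<theta> (\<lambda>z. z * ?T ?s z)"
  proof -
    have "h2_inner (\<lambda>z. z * ?T ?s z) \<theta> = h2_inner (\<lambda>z. z * ?s z) (\<lambda>_. 1)"
      using one[OF hardy2_shift[OF s]] by (simp add: mult.left_commute)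
    then show ?thesis
      using h2_inner_commute[OF hardy2_const hardy2_shift[OF s], of 1]
        h2_inner_commute[OF hardy2_inner_function[OF \<theta>] zTs] by simp
  qed
  note i1 = inner_sq[OF s hardy2_const split] and i2 = inner_sq[OF Ts hardy2_inner_function[OF \<theta>] Tsplit]
    and i3 = inner_shift[OF s hardy2_const split] and i4 = inner_shift[OF Ts hardy2_inner_function[OF \<theta>] Tsplit]
  have "complex_of_real ((h2_norm ?s)\<^sup>2 - (h2_norm (?T ?s))\<^sup>2)
      = w * (h2_inner ?s (\<lambda>z. z * ?s z) - h2_inner (?T ?s) (\<lambda>z. z * ?T ?s z))"
    using i1 i2 k1 unfolding of_real_diff right_diff_distrib by (simp only: add_diff_cancel_left)
  also have "\<dots> = w * (cnj w * of_real ((h2_norm ?s)\<^sup>2 - (h2_norm (?T ?s))\<^sup>2))"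
    using i3 i4 k2 unfolding of_real_diff right_diff_distrib by (simp only: distrib_left add_diff_cancel_left)
  finally have "complex_of_real ((h2_norm ?s)\<^sup>2 - (h2_norm (?T ?s))\<^sup>2) = w * cnj w * of_real ((h2_norm ?s)\<^sup>2 - (h2_norm (?T ?s))\<^sup>2)"
    by (simp only: mult.assoc)
  then have "(h2_norm ?s)\<^sup>2 - (h2_norm (?T ?s))\<^sup>2 = (cmod w)\<^sup>2 * ((h2_norm ?s)\<^sup>2 - (h2_norm (?T ?s))\<^sup>2)"
    unfolding complex_norm_square[symmetric] of_real_mult[symmetric] of_real_eq_iff .
  then have "(1 - (cmod w)\<^sup>2) * ((h2_norm ?s)\<^sup>2 - (h2_norm (?T ?s))\<^sup>2) = 0" by (simp add: algebra_simps)
  then have "(h2_norm (?T ?s))\<^sup>2 = (h2_norm ?s)\<^sup>2"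
    using one_minus_cmod_sq_pos[OF w] unfolding mult_eq_0_iff by linarith
  then have "h2_norm (?T ?s) = h2_norm ?s"
    by (rule power2_eq_imp_eq[OF _ h2_norm_nonneg[OF Ts] h2_norm_nonneg[OF s]])
  from inner_mult_isometric_extend[OF \<theta> s h this] show ?thesis
    by (simp add: h2_inner_szego[OF h w])
qed

lemma model_space_hardy2: "f \<in> model_space \<theta> \<Longrightarrow> f \<in> hardy2"
  by (simp add: model_space_def)

lemma model_space_orth: "f \<in> model_space \<theta> \<Longrightarrow> h \<in> hardy2 \<Longrightarrow> h2_inner f (\<lambda>z. \<theta> z * h z) = 0"
  by (simp add: model_space_def)

lemma model_space_add:
  assumes "inner_function \<theta>" "f \<in> model_space \<theta>" "g \<in> model_space \<theta>"
  shows "(\<lambda>z. f z + g z) \<in> model_space \<theta>"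
  using assms by (simp add: model_space_def hardy2_add h2_inner_add_left hardy2_inner_mult)

lemma model_space_cmult:
  assumes "inner_function \<theta>" "f \<in> model_space \<theta>"
  shows "(\<lambda>z. c * f z) \<in> model_space \<theta>"
  using assms by (simp add: model_space_def hardy2_cmult h2_inner_cmult_left hardy2_inner_mult)

lemma model_space_diff:
  assumes "inner_function \<theta>" "f \<in> model_space \<theta>" "g \<in> model_space \<theta>"
  shows "(\<lambda>z. f z - g z) \<in> model_space \<theta>"
  using model_space_add[OF assms(1,2) model_space_cmult[OF assms(1,3), of "-1"]] by simp

lemma model_space_weak_limit:
  assumes "inner_function \<theta>" "\<And>n. F n \<in> model_space \<theta>" "\<And>n. h2_norm (F n) \<le> M"
    and "f holomorphic_on ball 0 1" "\<And>z. z \<in> ball 0 1 \<Longrightarrow> (\<lambda>n. F n z) \<longlonglongrightarrow> f z"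
  shows "f \<in> model_space \<theta>"
proof -
  note lim = hardy2_weak_limit[of F M f, OF model_space_hardy2[OF assms(2)] assms(3,4)]
  have "h2_inner f (\<lambda>z. \<theta> z * h z) = 0" if h: "h \<in> hardy2" for h
  proof -
    have "(\<lambda>n. h2_inner (F n) (\<lambda>z. \<theta> z * h z)) \<longlonglongrightarrow> h2_inner f (\<lambda>z. \<theta> z * h z)"
      by (rule lim(3)) (use assms(5) hardy2_inner_mult(1)[OF assms(1) h] in auto)
    then show ?thesis
      using model_space_orth[OF assms(2) h] by (simp add: LIMSEQ_const_iff)
  qed
  moreover have "f \<in> hardy2" by (rule lim(1)) (use assms(5) in auto)
  ultimately show ?thesis by (simp add: model_space_def)
qed

lemma kernel_eq_szego:
  assumes "w \<in> ball 0 1"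
  shows "kernel \<theta> w z = szego w z - cnj (\<theta> w) * (\<theta> z * szego w z)"
  using assms by (simp add: kernel_def extended_value_def szego_def diff_divide_distrib)

text \<open>
  For \<open>h \<in> H\<^sup>2\<close> both parts of the kernel pair with \<open>\<theta> h\<close> to the conjugate of \<open>\<theta>(w) h(w)\<close>: the
  Szego kernel by reproduction, the other part by the isometry of multiplication by \<open>\<theta>\<close>.
\<close>

lemma kernel_in_model_space:
  assumes \<theta>: "inner_function \<theta>" and w: "w \<in> ball 0 1"
  shows "kernel \<theta> w \<in> model_space \<theta>"
proof -
  note s = hardy2_szego[OF w] and Ts = hardy2_inner_mult(1)[OF \<theta> hardy2_szego[OF w]]
  have eq: "kernel \<theta> w = (\<lambda>z. szego w z - cnj (\<theta> w) * (\<theta> z * szego w z))"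
    by (rule ext) (rule kernel_eq_szego[OF w])
  have "h2_inner (kernel \<theta> w) (\<lambda>z. \<theta> z * h z) = 0" if h: "h \<in> hardy2" for h
  proof -
    note Th = hardy2_inner_mult(1)[OF \<theta> h]
    have "h2_inner (szego w) (\<lambda>z. \<theta> z * h z) = cnj (\<theta> w * h w)"
      unfolding h2_inner_commute[OF s Th] h2_inner_szego[OF Th w] ..
    moreover have "h2_inner (\<lambda>z. \<theta> z * szego w z) (\<lambda>z. \<theta> z * h z) = cnj (h w)"
      unfolding h2_inner_commute[OF Ts Th] h2_inner_inner_mult_szego[OF \<theta> h w] ..
    ultimately show ?thesis
      unfolding eq h2_inner_diff_left[OF s hardy2_cmult[OF Ts] Th] h2_inner_cmult_left[OF Ts Th] by simp
  qed
  moreover have "kernel \<theta> w \<in> hardy2" unfolding eq by (intro hardy2_diff hardy2_cmult s Ts)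
  ultimately show ?thesis by (simp add: model_space_def)
qed

lemma hardy2_kernel: "inner_function \<theta> \<Longrightarrow> w \<in> ball 0 1 \<Longrightarrow> kernel \<theta> w \<in> hardy2"
  by (rule model_space_hardy2[OF kernel_in_model_space])

text \<open>
  The second part of the kernel is a multiple of \<open>\<theta>\<close> times the Szego kernel, to which \<open>f\<close> is
  orthogonal.
\<close>

lemma h2_inner_kernel:
  assumes \<theta>: "inner_function \<theta>" and w: "w \<in> ball 0 1" and f: "f \<in> model_space \<theta>"
  shows "h2_inner f (kernel \<theta> w) = f w"
proof -
  note s = hardy2_szego[OF w] and Ts = hardy2_inner_mult(1)[OF \<theta> hardy2_szego[OF w]]
  have eq: "kernel \<theta> w = (\<lambda>z. szego w z - cnj (\<theta> w) * (\<theta> z * szego w z))"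
    by (rule ext) (rule kernel_eq_szego[OF w])
  note f2 = model_space_hardy2[OF f]
  show ?thesis
    unfolding eq h2_inner_diff_right[OF s hardy2_cmult[OF Ts] f2] h2_inner_cmult_right[OF Ts f2]
    by (simp add: model_space_orth[OF f s] h2_inner_szego[OF f2 w])
qed

lemma h2_norm_kernel_sq:
  assumes \<theta>: "inner_function \<theta>" and w: "w \<in> ball 0 1"
  shows "(h2_norm (kernel \<theta> w))\<^sup>2 = (1 - (cmod (\<theta> w))\<^sup>2) / (1 - (cmod w)\<^sup>2)"
proof -
  have "complex_of_real ((h2_norm (kernel \<theta> w))\<^sup>2) = kernel \<theta> w w"
    unfolding h2_inner_self[OF hardy2_kernel[OF assms], symmetric]
    by (rule h2_inner_kernel[OF assms kernel_in_model_space[OF assms]])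
  also have "\<dots> = of_real ((1 - (cmod (\<theta> w))\<^sup>2) / (1 - (cmod w)\<^sup>2))"
    using w unfolding of_real_divide of_real_diff complex_norm_square
    by (simp add: kernel_def extended_value_def mult.commute)
  finally show ?thesis by (simp only: of_real_eq_iff)
qed

text \<open>
  Write \<open>f = (z - w) q\<close>. On the circle \<open>z - w\<close> is \<open>z\<close> times the conjugate of \<open>1 - cnj w * z\<close>,
  so pairing \<open>q\<close> with \<open>\<theta> h\<close> is the same as pairing \<open>f\<close> with \<open>\<theta> z h / (1 - cnj w * z)\<close>, and
  this is \<open>0\<close>.
\<close>

lemma model_space_diff_quot:
  assumes \<theta>: "inner_function \<theta>" and f: "f \<in> model_space \<theta>" and w: "w \<in> ball 0 1" and 0: "f w = 0"
  shows "diff_quot f w \<in> model_space \<theta>"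
proof -
  let ?q = "diff_quot f w"
  note f2 = model_space_hardy2[OF f]
  note q = hardy2_diff_quot[OF f2 w]
  have "h2_inner ?q (\<lambda>z. \<theta> z * h z) = 0" if h: "h \<in> hardy2" for h
  proof -
    \<comment> \<open>\<open>z * ?v\<close> is \<open>\<theta>\<close> times a function in \<open>H\<^sup>2\<close>, and \<open>(1 - cnj w * z) * ?v = \<theta> h\<close>.\<close>
    let ?v = "\<lambda>z. \<theta> z * (szego w z * h z)"
    have sz: "cmod (szego w z) \<le> 1 / (1 - cmod w)" if z: "z \<in> ball 0 1" for z
      using cmod_one_minus_cnj_mult_ge[OF z, of w] w by (simp add: szego_def norm_divide frac_le)
    have sh: "(\<lambda>z. szego w z * h z) \<in> hardy2"
      by (rule hardy2_mult_bounded(1)[OF szego_holomorphic sz _ h]) (use w in auto)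
    have v: "?v \<in> hardy2" by (rule hardy2_inner_mult(1)[OF \<theta> sh])
    note zv = hardy2_shift[OF v] and zq = hardy2_shift[OF q]
    have "(\<lambda>z. z * ?v z) = (\<lambda>z. \<theta> z * (z * (szego w z * h z)))" by (auto simp: mult_ac)
    then have "0 = h2_inner f (\<lambda>z. z * ?v z)"
      using model_space_orth[OF f hardy2_shift[OF sh]] by simp
    also have "f = (\<lambda>z. z * ?q z - w * ?q z)"
      using diff_quot_mult[of _ w f] 0 by (auto simp: algebra_simps)
    also have "h2_inner \<dots> (\<lambda>z. z * ?v z) = h2_inner ?q ?v - w * h2_inner ?q (\<lambda>z. z * ?v z)"
      by (simp only: h2_inner_diff_left[OF zq hardy2_cmult[OF q] zv] h2_inner_shift[OF q v] h2_inner_cmult_left[OF q zv])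
    also have "\<dots> = h2_inner ?q (\<lambda>z. ?v z - cnj w * (z * ?v z))"
      by (simp only: h2_inner_diff_right[OF v hardy2_cmult[OF zv] q] h2_inner_cmult_right[OF zv q] complex_cnj_cnj)
    also have "\<dots> = h2_inner ?q (\<lambda>z. \<theta> z * h z)"
    proof (rule h2_inner_cong[OF q hardy2_inner_mult(1)[OF \<theta> h]])
      fix z :: complex assume z: "z \<in> ball 0 1"
      have "?v z - cnj w * (z * ?v z) = \<theta> z * h z * ((1 - cnj w * z) * szego w z)"
        by (simp add: algebra_simps)
      then show "\<theta> z * h z = ?v z - cnj w * (z * ?v z)"
        using one_minus_cnj_mult_nz[of w z] w z by (simp add: szego_def)
    qed auto
    finally show ?thesis by simp
  qed
  then show ?thesis using q by (simp add: model_space_def)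
qed

text \<open>
  Divide by \<open>z - w\<close> as often as \<open>w\<close> is a zero of \<open>f\<close>. The induction is on the order of the
  zero, and the local factorization is the invariant.
\<close>

lemma model_space_remove_zero:
  assumes \<theta>: "inner_function \<theta>" and f: "f \<in> model_space \<theta>" "\<exists>z\<in>ball 0 1. f z \<noteq> 0" and w: "w \<in> ball 0 1"
  shows "\<exists>q\<in>model_space \<theta>. q w \<noteq> 0 \<and> (\<forall>u\<in>ball 0 1. u \<noteq> w \<longrightarrow> f u = 0 \<longrightarrow> q u = 0)"
proof -
  have *: "\<exists>q\<in>model_space \<theta>. q w \<noteq> 0 \<and> (\<forall>u\<in>ball 0 1. u \<noteq> w \<longrightarrow> f u = 0 \<longrightarrow> q u = 0)"
    if "f \<in> model_space \<theta>" "r > 0" "cball w r \<subseteq> ball 0 1" "continuous_on (cball w r) g" "g w \<noteq> 0"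
      "\<forall>u\<in>cball w r. f u = g u * (u - w) ^ n" for f g r n
    using that
  proof (induction n arbitrary: f)
    case 0
    have "f w = g w" using 0 by simp
    with 0 show ?case by (intro bexI[of _ f]) auto
  next
    case (Suc n)
    have fw: "f w = 0" using Suc.prems(2,6) by simp
    let ?q = "diff_quot f w"
    have q: "?q \<in> model_space \<theta>" by (rule model_space_diff_quot[OF \<theta> Suc.prems(1) w fw])
    have eq: "?q u = g u * (u - w) ^ n" if "u \<in> cball w r" "u \<noteq> w" for u
      using Suc.prems(6) that fw by (simp add: diff_quot_def)
    have "?q w = g w * (w - w) ^ n"
    proof (rule LIM_unique)
      have "continuous_on (ball w r) ?q"
        using hardy2_holomorphic[OF model_space_hardy2[OF q]] Suc.prems(3)
        by (meson ball_subset_cball continuous_on_subset holomorphic_on_imp_continuous_on order_trans)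
      then have "(?q \<longlongrightarrow> ?q w) (at w)"
        using \<open>r > 0\<close> by (metis at_within_open centre_in_ball continuous_on_def open_ball)
      then show "?q \<midarrow>w\<rightarrow> ?q w" .
      have "continuous_on (ball w r) (\<lambda>u. g u * (u - w) ^ n)"
        by (intro continuous_intros continuous_on_subset[OF Suc.prems(4)]) auto
      then have "((\<lambda>u. g u * (u - w) ^ n) \<longlongrightarrow> g w * (w - w) ^ n) (at w)"
        using \<open>r > 0\<close> by (metis (no_types, lifting) at_within_open centre_in_ball continuous_on_def open_ball)
      moreover have "\<forall>\<^sub>F u in at w. g u * (u - w) ^ n = ?q u"
        unfolding eventually_at by (intro exI[of _ r]) (use \<open>r > 0\<close> eq in \<open>auto simp: dist_commute\<close>)
      ultimately show "?q \<midarrow>w\<rightarrow> g w * (w - w) ^ n" by (rule Lim_transform_eventually)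
    qed
    then have "\<forall>u\<in>cball w r. ?q u = g u * (u - w) ^ n" using eq by metis
    from Suc.IH[OF q Suc.prems(2-5) this] obtain p where
      p: "p \<in> model_space \<theta>" "p w \<noteq> 0" "\<And>u. u \<in> ball 0 1 \<Longrightarrow> u \<noteq> w \<Longrightarrow> ?q u = 0 \<Longrightarrow> p u = 0" by blast
    have "?q u = 0" if "u \<noteq> w" "f u = 0" for u using that fw by (simp add: diff_quot_def)
    with p show ?case by (intro bexI[of _ p]) auto
  qed
  obtain r where r: "r > 0" "cball w r \<subseteq> ball 0 1" "zor_poly f w holomorphic_on cball w r"
    "\<forall>u\<in>cball w r. f u = zor_poly f w u * (u - w) ^ nat (zorder f w) \<and> zor_poly f w u \<noteq> 0"
    using zorder_exist_zero[of f "ball 0 1" w] hardy2_holomorphic[OF model_space_hardy2[OF f(1)]] f(2) w by auto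
  show ?thesis
    by (rule *[OF f(1) r(1,2) holomorphic_on_imp_continuous_on[OF r(3)]]) (use r in auto)
qed

text \<open>
  A nonzero model space contains a function that does not vanish at \<open>w\<close>, so evaluation at \<open>w\<close>
  is not the zero functional.
\<close>

lemma kernel_nonzero:
  assumes \<theta>: "inner_function \<theta>" and f: "f \<in> model_space \<theta>" "\<exists>z\<in>ball 0 1. f z \<noteq> 0" and w: "w \<in> ball 0 1"
  shows "0 < h2_norm (kernel \<theta> w)"
proof -
  obtain q where q: "q \<in> model_space \<theta>" "q w \<noteq> 0" using model_space_remove_zero[OF assms] by blast
  have "cmod (q w) \<le> h2_norm q * h2_norm (kernel \<theta> w)"
    using h2_cauchy_schwarz[OF model_space_hardy2[OF q(1)] hardy2_kernel[OF \<theta> w]] h2_inner_kernel[OF \<theta> w q(1)] by simp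
  then have "h2_norm (kernel \<theta> w) \<noteq> 0" using q by auto
  then show ?thesis using h2_norm_nonneg[OF hardy2_kernel[OF \<theta> w]] by simp
qed

lemma inner_value_0_less_1:
  assumes \<theta>: "inner_function \<theta>" and f: "f \<in> model_space \<theta>" "\<exists>z\<in>ball 0 1. f z \<noteq> 0"
  shows "cmod (\<theta> 0) < 1"
proof -
  have "0 < (h2_norm (kernel \<theta> 0))\<^sup>2" using kernel_nonzero[OF assms, of 0] by simp
  then have "(cmod (\<theta> 0))\<^sup>2 < 1" using h2_norm_kernel_sq[OF \<theta>, of 0] by simp
  then show ?thesis by (simp add: abs_square_less_1)
qed

text \<open>
  The value of the kernel at \<open>0\<close> is already bounded below, uniformly in \<open>a\<close>. If \<open>\<bar>\<theta>(0)\<bar> < 1\<close>,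
  this keeps the normalizing factors bounded.
\<close>

lemma kernel_lower_bound:
  assumes \<theta>: "inner_function \<theta>" and a: "a \<in> ball 0 1"
  shows "1 - cmod (\<theta> 0) \<le> h2_norm (kernel \<theta> a)"
proof -
  have "cmod (cnj (\<theta> a) * \<theta> 0) \<le> cmod (\<theta> 0)"
    unfolding norm_mult using inner_function_le_1[OF \<theta> a] by (simp add: mult_left_le_one_le)
  then have "1 - cmod (\<theta> 0) \<le> cmod (1 - cnj (\<theta> a) * \<theta> 0)"
    using norm_triangle_ineq2[of 1 "cnj (\<theta> a) * \<theta> 0"] by simp
  also have "\<dots> = cmod (kernel \<theta> a 0)" using a by (simp add: kernel_def extended_value_def)
  also have "\<dots> \<le> h2_norm (kernel \<theta> a)" using hardy2_point_bound[OF hardy2_kernel[OF assms], of 0] by simp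
  finally show ?thesis .
qed

lemma kernel_bounded:
  assumes \<theta>: "inner_function \<theta>" and w: "w \<in> ball 0 1" and u: "u \<in> ball 0 1"
  shows "cmod (kernel \<theta> w u) \<le> 2 / (1 - cmod w)"
proof -
  have "cmod (cnj (\<theta> w) * \<theta> u) \<le> 1"
    unfolding norm_mult using inner_function_le_1[OF \<theta> w] inner_function_le_1[OF \<theta> u] by (simp add: mult_le_one)
  then have num: "cmod (1 - cnj (\<theta> w) * \<theta> u) \<le> 2"
    using norm_triangle_ineq4[of 1 "cnj (\<theta> w) * \<theta> u"] by simp
  show ?thesis
    using frac_le[OF _ num _ cmod_one_minus_cnj_mult_ge[OF u, of w]] w by (simp add: kernel_def extended_value_def norm_divide)
qed

section \<open>Boundary kernels and non-tangential limits\<close>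

text \<open>
  The boundary value \<open>\<alpha>\<close> is a parameter because the existence of the non-tangential limit is a
  consequence of properties of this function.
\<close>

definition boundary_kernel :: "(complex \<Rightarrow> complex) \<Rightarrow> complex \<Rightarrow> complex \<Rightarrow> complex \<Rightarrow> complex" where
  "boundary_kernel \<theta> \<zeta> \<alpha> z = (1 - cnj \<alpha> * \<theta> z) / (1 - cnj \<zeta> * z)"

lemma boundary_kernel_holomorphic:
  assumes "inner_function \<theta>" "cmod \<zeta> = 1"
  shows "boundary_kernel \<theta> \<zeta> \<alpha> holomorphic_on ball 0 1"
  unfolding boundary_kernel_def[abs_def]
  by (intro holomorphic_intros inner_function_holomorphic[OF assms(1)])
     (use one_minus_cnj_mult_nz[of \<zeta>] assms in auto)

lemma boundary_kernel_lower_bound: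
  assumes \<theta>: "inner_function \<theta>" and \<alpha>: "cmod \<alpha> = 1" and K: "boundary_kernel \<theta> \<zeta> \<alpha> \<in> model_space \<theta>"
  shows "1 - cmod (\<theta> 0) \<le> h2_norm (boundary_kernel \<theta> \<zeta> \<alpha>)"
proof -
  have "1 - cmod (\<theta> 0) \<le> cmod (1 - cnj \<alpha> * \<theta> 0)"
    using norm_triangle_ineq2[of 1 "cnj \<alpha> * \<theta> 0"] \<alpha> by (simp add: norm_mult)
  also have "\<dots> = cmod (boundary_kernel \<theta> \<zeta> \<alpha> 0)" by (simp add: boundary_kernel_def)
  also have "\<dots> \<le> h2_norm (boundary_kernel \<theta> \<zeta> \<alpha>)"
    using hardy2_point_bound[OF model_space_hardy2[OF K], of 0] by simp
  finally show ?thesis .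
qed

lemma kernel_tendsto_boundary_kernel:
  assumes \<theta>: "inner_function \<theta>" and \<zeta>: "cmod \<zeta> = 1"
    and z: "\<And>n. z n \<in> ball 0 1" "z \<longlonglongrightarrow> \<zeta>" and \<alpha>: "(\<lambda>n. \<theta> (z n)) \<longlonglongrightarrow> \<alpha>" and w: "w \<in> ball 0 1"
  shows "(\<lambda>n. kernel \<theta> (z n) w) \<longlonglongrightarrow> boundary_kernel \<theta> \<zeta> \<alpha> w"
proof -
  have "(\<lambda>n. (1 - cnj (\<theta> (z n)) * \<theta> w) / (1 - cnj (z n) * w)) \<longlonglongrightarrow> (1 - cnj \<alpha> * \<theta> w) / (1 - cnj \<zeta> * w)"
    by (intro tendsto_intros z \<alpha>) (use one_minus_cnj_mult_nz[of \<zeta> w] \<zeta> w in auto)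
  then show ?thesis using z by (simp add: kernel_def extended_value_def boundary_kernel_def)
qed

text \<open>
  The kernels converge pointwise to the boundary kernel, so with bounded norms they converge
  weakly. Their squared norms are \<open>(1 - \<bar>\<theta>\<bar>\<^sup>2) / (1 - \<bar>z\<bar>\<^sup>2)\<close>, and boundedness forces
  \<open>\<bar>\<theta>(z n)\<bar> \<rightarrow> 1\<close>.
\<close>

lemma boundary_kernel_weak_limit:
  assumes \<theta>: "inner_function \<theta>" and \<zeta>: "cmod \<zeta> = 1"
    and z: "\<And>n. z n \<in> ball 0 1" "z \<longlonglongrightarrow> \<zeta>" and \<alpha>: "(\<lambda>n. \<theta> (z n)) \<longlonglongrightarrow> \<alpha>"
    and M: "\<And>n. h2_norm (kernel \<theta> (z n)) \<le> M"
  shows "cmod \<alpha> = 1" "boundary_kernel \<theta> \<zeta> \<alpha> \<in> model_space \<theta>"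
    "g \<in> hardy2 \<Longrightarrow> (\<lambda>n. h2_inner (kernel \<theta> (z n)) g) \<longlonglongrightarrow> h2_inner (boundary_kernel \<theta> \<zeta> \<alpha>) g"
proof -
  note lim = kernel_tendsto_boundary_kernel[OF \<theta> \<zeta> z \<alpha>]
  show "boundary_kernel \<theta> \<zeta> \<alpha> \<in> model_space \<theta>"
    by (rule model_space_weak_limit[OF \<theta> kernel_in_model_space[OF \<theta> z(1)] M boundary_kernel_holomorphic[OF \<theta> \<zeta>]])
       (rule lim)
  show "(\<lambda>n. h2_inner (kernel \<theta> (z n)) g) \<longlonglongrightarrow> h2_inner (boundary_kernel \<theta> \<zeta> \<alpha>) g" if "g \<in> hardy2"
    by (rule hardy2_weak_limit(3)[OF hardy2_kernel[OF \<theta> z(1)] M boundary_kernel_holomorphic[OF \<theta> \<zeta>] _ that])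
       (rule lim)
  have "(\<lambda>n. 1 - (cmod (\<theta> (z n)))\<^sup>2) \<longlonglongrightarrow> 0"
  proof (rule Lim_null_comparison)
    show "\<forall>\<^sub>F n in sequentially. norm (1 - (cmod (\<theta> (z n)))\<^sup>2) \<le> M\<^sup>2 * (1 - (cmod (z n))\<^sup>2)"
    proof (rule always_eventually, rule allI)
      fix n
      have p: "0 < 1 - (cmod (z n))\<^sup>2" by (rule one_minus_cmod_sq_pos[OF z(1)])
      have "(h2_norm (kernel \<theta> (z n)))\<^sup>2 \<le> M\<^sup>2"
        using M[of n] h2_norm_nonneg[OF hardy2_kernel[OF \<theta> z(1)]] by (intro power_mono) auto
      then have "1 - (cmod (\<theta> (z n)))\<^sup>2 \<le> M\<^sup>2 * (1 - (cmod (z n))\<^sup>2)"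
        using p unfolding h2_norm_kernel_sq[OF \<theta> z(1)] by (simp add: pos_divide_le_eq)
      moreover have "(cmod (\<theta> (z n)))\<^sup>2 \<le> 1"
        using inner_function_le_1[OF \<theta> z(1)] by (intro power_le_one) auto
      ultimately show "norm (1 - (cmod (\<theta> (z n)))\<^sup>2) \<le> M\<^sup>2 * (1 - (cmod (z n))\<^sup>2)" by simp
    qed
    have "(\<lambda>n. M\<^sup>2 * (1 - (cmod (z n))\<^sup>2)) \<longlonglongrightarrow> M\<^sup>2 * (1 - (cmod \<zeta>)\<^sup>2)"
      by (intro tendsto_intros z)
    then show "(\<lambda>n. M\<^sup>2 * (1 - (cmod (z n))\<^sup>2)) \<longlonglongrightarrow> 0" using \<zeta> by simp
  qed
  moreover have "(\<lambda>n. 1 - (cmod (\<theta> (z n)))\<^sup>2) \<longlonglongrightarrow> 1 - (cmod \<alpha>)\<^sup>2"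
    by (intro tendsto_intros \<alpha>)
  ultimately have "1 - (cmod \<alpha>)\<^sup>2 = 0" using LIMSEQ_unique by blast
  then show "cmod \<alpha> = 1" using norm_ge_zero[of \<alpha>] by (auto simp: power2_eq_1_iff)
qed

lemma stolz_angle_pos: "w \<in> stolz_angle \<gamma> \<zeta> \<Longrightarrow> 0 < 1 - cmod w"
  by (simp add: stolz_angle_def)

text \<open>
  Put \<open>X = \<bar>1 - cnj \<alpha> * \<theta>(w)\<bar>\<close>. Evaluating the boundary kernel by means of the kernel at \<open>w\<close>
  gives \<open>X \<le> N \<parallel>k\<^sub>w\<parallel> \<bar>w - \<zeta>\<bar>\<close>, and \<open>\<parallel>k\<^sub>w\<parallel>\<^sup>2 \<le> 2 X / (1 - \<bar>w\<bar>)\<close> because \<open>1 - \<bar>\<theta>(w)\<bar> \<le> X\<close>.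
  Eliminating one of the two quantities bounds the other. This is Sarason's proof of the
  theorem of Julia and Caratheodory.
\<close>

lemma boundary_kernel_stolz_bound:
  assumes \<theta>: "inner_function \<theta>" and \<zeta>: "cmod \<zeta> = 1" and \<alpha>: "cmod \<alpha> = 1"
    and K: "boundary_kernel \<theta> \<zeta> \<alpha> \<in> model_space \<theta>"
    and w: "w \<in> stolz_angle \<gamma> \<zeta>"
  defines "N \<equiv> h2_norm (boundary_kernel \<theta> \<zeta> \<alpha>)"
  shows "cmod (\<theta> w - \<alpha>) \<le> 2 * N\<^sup>2 * \<gamma> * cmod (w - \<zeta>)"
    "h2_norm (kernel \<theta> w) \<le> 2 * N * \<gamma>"
proof -
  let ?k = "boundary_kernel \<theta> \<zeta> \<alpha>"
  have wb: "w \<in> ball 0 1" and ws: "cmod (w - \<zeta>) \<le> \<gamma> * (1 - cmod w)" using w by (auto simp: stolz_angle_def)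
  have w1: "0 < 1 - cmod w" using wb by simp
  have \<gamma>: "0 \<le> \<gamma>" using ws w1 by (smt (verit) norm_ge_zero mult_neg_pos)
  have N: "0 \<le> N" unfolding N_def by (rule h2_norm_nonneg[OF model_space_hardy2[OF K]])
  define X where "X = cmod (1 - cnj \<alpha> * \<theta> w)"
  have X: "X = cmod (\<theta> w - \<alpha>)" unfolding X_def by (rule cmod_one_minus_cnj_mult[OF \<alpha>])
  have X2: "(h2_norm (kernel \<theta> w))\<^sup>2 \<le> 2 * X / (1 - cmod w)"
  proof -
    have "(h2_norm (kernel \<theta> w))\<^sup>2 = (1 - (cmod (\<theta> w))\<^sup>2) / (1 - (cmod w)\<^sup>2)"
      by (rule h2_norm_kernel_sq[OF \<theta> wb])
    also have "\<dots> \<le> 2 * X / (1 - cmod w)"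
    proof (rule frac_le)
      have "cmod \<alpha> - cmod (\<theta> w) \<le> X"
        unfolding X by (metis norm_minus_commute norm_triangle_ineq2)
      moreover have "1 - (cmod (\<theta> w))\<^sup>2 \<le> 2 * (1 - cmod (\<theta> w))"
        using zero_le_power2[of "1 - cmod (\<theta> w)"] by (simp add: power2_diff)
      ultimately show "1 - (cmod (\<theta> w))\<^sup>2 \<le> 2 * X" using \<alpha> by simp
      have "(cmod w)\<^sup>2 \<le> cmod w * 1" unfolding power2_eq_square using w1 by (intro mult_left_mono) auto
      then show "1 - cmod w \<le> 1 - (cmod w)\<^sup>2" by simp
    qed (use w1 X in auto)
    finally show ?thesis .
  qed
  have "X = cmod (?k w) * cmod (w - \<zeta>)"
  proof -
    have "1 - cnj \<zeta> * w \<noteq> 0" using one_minus_cnj_mult_nz[of \<zeta> w] \<zeta> wb by simp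
    then have "1 - cnj \<alpha> * \<theta> w = ?k w * (1 - cnj \<zeta> * w)" by (simp add: boundary_kernel_def)
    then show ?thesis unfolding X_def by (simp add: norm_mult cmod_one_minus_cnj_mult[OF \<zeta>])
  qed
  also have "cmod (?k w) \<le> N * h2_norm (kernel \<theta> w)"
    using h2_cauchy_schwarz[OF model_space_hardy2[OF K] hardy2_kernel[OF \<theta> wb]] h2_inner_kernel[OF \<theta> wb K]
    by (simp add: N_def)
  finally have le: "X \<le> N * h2_norm (kernel \<theta> w) * cmod (w - \<zeta>)"
    by (simp add: mult_right_mono)
  have "X\<^sup>2 \<le> (N * h2_norm (kernel \<theta> w) * cmod (w - \<zeta>))\<^sup>2"
    using le by (intro power_mono) (simp_all add: X)
  also have "\<dots> = N\<^sup>2 * (cmod (w - \<zeta>))\<^sup>2 * (h2_norm (kernel \<theta> w))\<^sup>2" by (simp add: power_mult_distrib)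
  also have "\<dots> \<le> N\<^sup>2 * (cmod (w - \<zeta>) * (\<gamma> * (1 - cmod w))) * (2 * X / (1 - cmod w))"
    using X2 ws w1 \<gamma> by (intro mult_mono mult_left_mono) (auto simp: power2_eq_square intro!: mult_left_mono mult_nonneg_nonneg)
  also have "\<dots> = X * (2 * N\<^sup>2 * \<gamma> * cmod (w - \<zeta>))" using w1 by (simp add: field_simps)
  finally have "X * X \<le> X * (2 * N\<^sup>2 * \<gamma> * cmod (w - \<zeta>))" by (simp add: power2_eq_square)
  then have "X \<le> 2 * N\<^sup>2 * \<gamma> * cmod (w - \<zeta>)"
    using \<gamma> by (cases "X = 0") (auto simp: X mult_le_cancel_left)
  then show b1: "cmod (\<theta> w - \<alpha>) \<le> 2 * N\<^sup>2 * \<gamma> * cmod (w - \<zeta>)" by (simp add: X)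
  have "(h2_norm (kernel \<theta> w))\<^sup>2 \<le> 2 * X / (1 - cmod w)" by (rule X2)
  also have "\<dots> \<le> 2 * (2 * N\<^sup>2 * \<gamma> * (\<gamma> * (1 - cmod w))) / (1 - cmod w)"
    using b1 ws w1 \<gamma> unfolding X
    by (intro divide_right_mono mult_left_mono order_trans[OF b1] mult_left_mono mult_nonneg_nonneg) auto
  also have "\<dots> = (2 * N * \<gamma>)\<^sup>2" using w1 by (simp add: power2_eq_square)
  finally show "h2_norm (kernel \<theta> w) \<le> 2 * N * \<gamma>"
    by (rule power2_le_imp_le) (use N \<gamma> in auto)
qed

lemma boundary_value_stolz:
  assumes "inner_function \<theta>" "cmod \<zeta> = 1" "cmod \<alpha> = 1" "boundary_kernel \<theta> \<zeta> \<alpha> \<in> model_space \<theta>"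
  shows "(\<theta> \<longlongrightarrow> \<alpha>) (at \<zeta> within stolz_angle \<gamma> \<zeta>)"
proof -
  let ?C = "2 * (h2_norm (boundary_kernel \<theta> \<zeta> \<alpha>))\<^sup>2 * \<gamma>"
  have "((\<lambda>w. \<theta> w - \<alpha>) \<longlongrightarrow> 0) (at \<zeta> within stolz_angle \<gamma> \<zeta>)"
  proof (rule Lim_null_comparison)
    show "\<forall>\<^sub>F w in at \<zeta> within stolz_angle \<gamma> \<zeta>. cmod (\<theta> w - \<alpha>) \<le> ?C * cmod (w - \<zeta>)"
      unfolding eventually_at_filter using boundary_kernel_stolz_bound(1)[OF assms] by (auto intro: always_eventually)
    have "((\<lambda>w. ?C * cmod (w - \<zeta>)) \<longlongrightarrow> ?C * cmod (\<zeta> - \<zeta>)) (at \<zeta> within stolz_angle \<gamma> \<zeta>)"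
      by (intro tendsto_intros)
    then show "((\<lambda>w. ?C * cmod (w - \<zeta>)) \<longlongrightarrow> 0) (at \<zeta> within stolz_angle \<gamma> \<zeta>)" by simp
  qed
  then show ?thesis by (simp add: LIM_zero_iff)
qed

lemma stolz_angle_accumulates:
  assumes "cmod \<zeta> = 1" "\<gamma> > 1"
  shows "at \<zeta> within stolz_angle \<gamma> \<zeta> \<noteq> bot"
proof -
  have "\<exists>w\<in>stolz_angle \<gamma> \<zeta>. w \<noteq> \<zeta> \<and> dist w \<zeta> < e" if "e > 0" for e
  proof -
    define r where "r = max 0 (1 - e / 2)"
    have r: "0 \<le> r" "r < 1" "1 - r < e" using that by (auto simp: r_def)
    have d: "cmod (of_real r * \<zeta> - \<zeta>) = 1 - r"
    proof -
      have "of_real r * \<zeta> - \<zeta> = of_real (r - 1) * \<zeta>" by (simp add: algebra_simps)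
      then show ?thesis using r assms by (simp only: norm_mult norm_of_real) simp
    qed
    have "1 * (1 - r) \<le> \<gamma> * (1 - r)" using assms r by (intro mult_right_mono) auto
    then have "of_real r * \<zeta> \<in> stolz_angle \<gamma> \<zeta>"
      using r assms d by (auto simp: stolz_angle_def norm_mult)
    moreover have "of_real r * \<zeta> \<noteq> \<zeta>" using d r by auto
    ultimately show ?thesis using d r by (intro bexI[of _ "of_real r * \<zeta>"]) (auto simp: dist_norm)
  qed
  then have "\<zeta> islimpt stolz_angle \<gamma> \<zeta>" by (simp add: islimpt_approachable)
  then show ?thesis using trivial_limit_within by blast
qed

lemma nontangential_limit_eq:
  assumes "cmod \<zeta> = 1" "\<And>\<gamma>. \<gamma> > 1 \<Longrightarrow> (f \<longlongrightarrow> L) (at \<zeta> within stolz_angle \<gamma> \<zeta>)"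
  shows "nontangential_limit f \<zeta> = L"
  unfolding nontangential_limit_def
proof (rule the_equality)
  fix L' assume "\<forall>\<gamma>>1. (f \<longlongrightarrow> L') (at \<zeta> within stolz_angle \<gamma> \<zeta>)"
  then have "(f \<longlongrightarrow> L') (at \<zeta> within stolz_angle 2 \<zeta>)" by simp
  then show "L' = L"
    using tendsto_unique[OF stolz_angle_accumulates[OF assms(1), of 2]] assms(2)[of 2] by simp
qed (use assms in auto)

text \<open>
  The non-tangential limit is unique, so \<open>\<alpha>\<close> is determined by \<open>\<zeta>\<close> once some boundary kernel
  lies in the model space.
\<close>

lemma kernel_boundary_eq:
  assumes "inner_function \<theta>" "cmod \<zeta> = 1" "cmod \<alpha> = 1" "boundary_kernel \<theta> \<zeta> \<alpha> \<in> model_space \<theta>"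
  shows "nontangential_limit \<theta> \<zeta> = \<alpha>" "kernel \<theta> \<zeta> = boundary_kernel \<theta> \<zeta> \<alpha>"
proof -
  show n: "nontangential_limit \<theta> \<zeta> = \<alpha>"
    by (rule nontangential_limit_eq[OF assms(2) boundary_value_stolz[OF assms]])
  show "kernel \<theta> \<zeta> = boundary_kernel \<theta> \<zeta> \<alpha>"
    using assms(2) by (simp add: fun_eq_iff kernel_def boundary_kernel_def extended_value_def n)
qed

text \<open>
  In a Stolz angle the kernels are bounded, hence converge weakly, and it remains to prove
  \<open>\<parallel>k\<^sub>z\<parallel>\<^sup>2 \<rightarrow> c\<close>, the squared norm of the boundary kernel \<open>k\<close>. Weak convergence gives
  \<open>k(z) \<rightarrow> c\<close>. This is a first order expansion of \<open>\<theta>\<close> at \<open>\<zeta>\<close>, and inserting it in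
  \<open>(1 - \<bar>\<theta>\<bar>\<^sup>2) / (1 - \<bar>z\<bar>\<^sup>2)\<close> gives the limit \<open>c\<close>; the error is controlled since \<open>\<bar>z - \<zeta>\<bar>\<close> and
  \<open>1 - \<bar>z\<bar>\<close> are comparable.
\<close>

theorem kernel_tendsto_norm_stolz:
  assumes \<theta>: "inner_function \<theta>" and \<zeta>: "cmod \<zeta> = 1" and \<alpha>: "cmod \<alpha> = 1"
    and K: "boundary_kernel \<theta> \<zeta> \<alpha> \<in> model_space \<theta>"
    and z: "\<And>n. z n \<in> stolz_angle \<gamma> \<zeta>" "z \<longlonglongrightarrow> \<zeta>"
  shows "(\<lambda>n. h2_norm (\<lambda>w. kernel \<theta> (z n) w - boundary_kernel \<theta> \<zeta> \<alpha> w)) \<longlonglongrightarrow> 0"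
proof -
  let ?k = "boundary_kernel \<theta> \<zeta> \<alpha>"
  define c where "c = (h2_norm ?k)\<^sup>2"
  have zb: "z n \<in> ball 0 1" and zs: "cmod (z n - \<zeta>) \<le> \<gamma> * (1 - cmod (z n))" for n
    using z(1)[of n] by (auto simp: stolz_angle_def)
  note k2 = model_space_hardy2[OF K]
  have "0 \<le> \<gamma>" using zs[of 0] stolz_angle_pos[OF z(1)[of 0]] by (smt (verit) norm_ge_zero mult_neg_pos)
  have "filterlim z (at \<zeta> within stolz_angle \<gamma> \<zeta>) sequentially"
    unfolding filterlim_at using z zb \<zeta> by (auto intro!: always_eventually) (metis mem_ball_0 order_less_irrefl)
  then have lim\<theta>: "(\<lambda>n. \<theta> (z n)) \<longlonglongrightarrow> \<alpha>"
    by (rule filterlim_compose[OF boundary_value_stolz[OF \<theta> \<zeta> \<alpha> K]])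
  note weak = boundary_kernel_weak_limit(3)[OF \<theta> \<zeta> zb z(2) lim\<theta> boundary_kernel_stolz_bound(2)[OF \<theta> \<zeta> \<alpha> K z(1)]]
  have ip: "(\<lambda>n. h2_inner (kernel \<theta> (z n)) ?k) \<longlonglongrightarrow> of_real c"
    using weak[OF k2] by (simp add: h2_inner_self[OF k2] c_def)
  have kz: "h2_inner (kernel \<theta> (z n)) ?k = cnj (?k (z n))" for n
    using h2_inner_commute[OF hardy2_kernel[OF \<theta> zb] k2] h2_inner_kernel[OF \<theta> zb K] by simp
  have "(\<lambda>n. cnj (cnj (?k (z n)))) \<longlonglongrightarrow> cnj (of_real c)"
    using ip unfolding kz by (rule tendsto_cnj)
  then have kc: "(\<lambda>n. ?k (z n)) \<longlonglongrightarrow> of_real c" by simp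
  have "(\<lambda>n. (h2_norm (kernel \<theta> (z n)))\<^sup>2 - c) \<longlonglongrightarrow> 0"
  proof (rule Lim_null_comparison)
    let ?B = "\<lambda>n. \<gamma> * (2 * cmod (?k (z n) - of_real c) + ((cmod (?k (z n)))\<^sup>2 + c) * cmod (z n - \<zeta>))"
    have "?B \<longlonglongrightarrow> \<gamma> * (2 * cmod (of_real c - of_real c) + ((cmod (of_real c))\<^sup>2 + c) * cmod (\<zeta> - \<zeta>))"
      by (intro tendsto_intros kc z(2))
    then show "?B \<longlonglongrightarrow> 0" by simp
    show "\<forall>\<^sub>F n in sequentially. norm ((h2_norm (kernel \<theta> (z n)))\<^sup>2 - c) \<le> ?B n"
    proof (rule always_eventually, rule allI)
      fix n
      \<comment> \<open>In these terms \<open>cnj \<zeta> * z = 1 - u\<close> and \<open>cnj \<alpha> * \<theta>(z) = 1 - b * u\<close>.\<close>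
      define u where "u = 1 - cnj \<zeta> * z n"
      define b where "b = ?k (z n)"
      have u: "cmod u = cmod (z n - \<zeta>)" unfolding u_def by (rule cmod_one_minus_cnj_mult[OF \<zeta>])
      have p: "0 < 1 - (cmod (z n))\<^sup>2" by (rule one_minus_cmod_sq_pos[OF zb])
      have "1 - cnj \<zeta> * z n \<noteq> 0" using one_minus_cnj_mult_nz[of \<zeta> "z n"] \<zeta> zb by simp
      then have bu: "1 - b * u = cnj \<alpha> * \<theta> (z n)" by (simp add: b_def u_def boundary_kernel_def)
      have sq: "(cmod (1 - v))\<^sup>2 = 1 - 2 * Re v + (cmod v)\<^sup>2" for v
        by (simp add: cmod_power2 power2_diff)
      have e1: "(cmod (\<theta> (z n)))\<^sup>2 = 1 - 2 * Re (b * u) + (cmod b)\<^sup>2 * (cmod u)\<^sup>2"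
        using sq[of "b * u"] \<alpha> unfolding bu by (simp add: norm_mult power_mult_distrib)
      have e2: "(cmod (z n))\<^sup>2 = 1 - 2 * Re u + (cmod u)\<^sup>2"
      proof -
        have "cnj \<zeta> * z n = 1 - u" by (simp add: u_def)
        then have "cmod (z n) = cmod (1 - u)" using \<zeta> by (metis complex_mod_cnj mult_1 norm_mult)
        then show ?thesis by (simp add: sq)
      qed
      have "(1 - (cmod (\<theta> (z n)))\<^sup>2) - c * (1 - (cmod (z n))\<^sup>2)
          = 2 * Re ((b - of_real c) * u) - ((cmod b)\<^sup>2 - c) * (cmod u)\<^sup>2"
        unfolding e1 e2 by (simp add: algebra_simps)
      also have "\<bar>\<dots>\<bar> \<le> 2 * (cmod (b - of_real c) * cmod u) + ((cmod b)\<^sup>2 + c) * (cmod u)\<^sup>2"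
      proof -
        have "\<bar>Re ((b - of_real c) * u)\<bar> \<le> cmod (b - of_real c) * cmod u"
          by (metis abs_Re_le_cmod norm_mult)
        moreover have "\<bar>((cmod b)\<^sup>2 - c) * (cmod u)\<^sup>2\<bar> \<le> ((cmod b)\<^sup>2 + c) * (cmod u)\<^sup>2"
          unfolding abs_mult by (intro mult_mono) (auto simp: c_def abs_le_iff)
        ultimately show ?thesis by linarith
      qed
      also have "\<dots> = (2 * cmod (b - of_real c) + ((cmod b)\<^sup>2 + c) * cmod u) * cmod u"
        by (simp add: algebra_simps power2_eq_square)
      also have "\<dots> \<le> (2 * cmod (b - of_real c) + ((cmod b)\<^sup>2 + c) * cmod u) * (\<gamma> * (1 - (cmod (z n))\<^sup>2))"
      proof (rule mult_left_mono)
        have "(cmod (z n))\<^sup>2 \<le> cmod (z n) * 1" unfolding power2_eq_square using zb[of n] by (intro mult_left_mono) auto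
        then have "\<gamma> * (1 - cmod (z n)) \<le> \<gamma> * (1 - (cmod (z n))\<^sup>2)" using \<open>0 \<le> \<gamma>\<close> by (intro mult_left_mono) auto
        then show "cmod u \<le> \<gamma> * (1 - (cmod (z n))\<^sup>2)" using zs[of n] u by simp
      qed (auto simp: c_def)
      finally have "\<bar>(1 - (cmod (\<theta> (z n)))\<^sup>2) - c * (1 - (cmod (z n))\<^sup>2)\<bar> \<le> ?B n * (1 - (cmod (z n))\<^sup>2)"
        by (simp add: b_def u mult_ac)
      moreover have "(h2_norm (kernel \<theta> (z n)))\<^sup>2 - c = ((1 - (cmod (\<theta> (z n)))\<^sup>2) - c * (1 - (cmod (z n))\<^sup>2)) / (1 - (cmod (z n))\<^sup>2)"
        using p by (simp add: h2_norm_kernel_sq[OF \<theta> zb] diff_divide_distrib)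
      ultimately show "norm ((h2_norm (kernel \<theta> (z n)))\<^sup>2 - c) \<le> ?B n"
        using p by (simp only: real_norm_def abs_divide) (simp add: pos_divide_le_eq)
    qed
  qed
  then have nk: "(\<lambda>n. (h2_norm (kernel \<theta> (z n)))\<^sup>2) \<longlonglongrightarrow> c" by (simp add: LIM_zero_iff)
  have "(\<lambda>n. (h2_norm (\<lambda>w. kernel \<theta> (z n) w - ?k w))\<^sup>2) \<longlonglongrightarrow> c - 2 * Re (of_real c) + c"
    unfolding h2_norm_diff_sq[OF hardy2_kernel[OF \<theta> zb] k2] c_def[symmetric]
    by (intro tendsto_intros nk ip)
  then have "(\<lambda>n. sqrt ((h2_norm (\<lambda>w. kernel \<theta> (z n) w - ?k w))\<^sup>2)) \<longlonglongrightarrow> sqrt 0"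
    by (intro tendsto_real_sqrt) simp
  then show ?thesis
    by (simp add: h2_norm_nonneg[OF hardy2_diff[OF hardy2_kernel[OF \<theta> zb] k2]])
qed

section \<open>The Ahern--Clark condition\<close>

lemma blaschke_factor_defect:
  assumes "a \<in> ball 0 1" "z \<in> ball 0 1"
  shows "1 - (cmod (blaschke_factor a z))\<^sup>2 = (1 - (cmod a)\<^sup>2) * (1 - (cmod z)\<^sup>2) / (cmod (1 - cnj a * z))\<^sup>2"
proof (cases "a = 0")
  case False
  have nz: "1 - cnj a * z \<noteq> 0" using one_minus_cnj_mult_nz[of a z] assms by simp
  have id: "(cmod (1 - cnj a * z))\<^sup>2 - (cmod (a - z))\<^sup>2 = (1 - (cmod a)\<^sup>2) * (1 - (cmod z)\<^sup>2)"
    unfolding cmod_power2 by (simp add: power2_eq_square algebra_simps)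
  have "cmod (blaschke_factor a z) = cmod (a - z) / cmod (1 - cnj a * z)"
    using False by (simp add: blaschke_factor_def norm_mult norm_divide)
  then have "1 - (cmod (blaschke_factor a z))\<^sup>2 = ((cmod (1 - cnj a * z))\<^sup>2 - (cmod (a - z))\<^sup>2) / (cmod (1 - cnj a * z))\<^sup>2"
    using nz by (simp add: power_divide diff_divide_distrib)
  then show ?thesis unfolding id .
qed (simp add: blaschke_factor_def)

text \<open>
  Replacing \<open>\<zeta>\<close> by a radial point costs at most a factor \<open>2\<close> in the distance to a point of the
  closed disc. Thus the sums and integrals at radial points are bounded by those at \<open>\<zeta>\<close>.
\<close>

lemma cmod_radial_ge:
  assumes "cmod \<zeta> = 1" "0 \<le> r" "r < 1" "cmod a \<le> 1"
  shows "cmod (\<zeta> - a) \<le> 2 * cmod (\<zeta> - of_real r * a)"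
proof -
  have r: "cmod (of_real (1 - r)) = 1 - r" using assms unfolding norm_of_real by simp
  have a: "cmod ((of_real (1 - r)) * a) \<le> 1 - r"
    unfolding norm_mult r using assms by (intro mult_left_le) auto
  have "\<zeta> - a = (\<zeta> - of_real r * a) - of_real (1 - r) * a" by (simp add: algebra_simps)
  then have "cmod (\<zeta> - a) \<le> cmod (\<zeta> - of_real r * a) + cmod (of_real (1 - r) * a)"
    by (metis norm_triangle_ineq4)
  then have "cmod (\<zeta> - a) \<le> cmod (\<zeta> - of_real r * a) + (1 - r)"
    by (rule order_trans[OF _ add_left_mono[OF a]])
  moreover have "1 - r \<le> cmod (\<zeta> - of_real r * a)"
  proof -
    have "cmod (of_real r * a) \<le> r * 1" unfolding norm_mult using assms by (simp add: mult_left_le)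
    then show ?thesis using norm_triangle_ineq2[of \<zeta> "of_real r * a"] assms by simp
  qed
  ultimately show ?thesis by linarith
qed

lemma cmod_radial_kernel:
  assumes "cmod \<zeta> = 1"
  shows "cmod (1 - cnj a * (of_real r * \<zeta>)) = cmod (\<zeta> - of_real r * a)"
proof -
  have "cmod (1 - cnj \<zeta> * (of_real r * a)) = cmod (of_real r * a - \<zeta>)"
    by (rule cmod_one_minus_cnj_mult[OF assms])
  moreover have "cnj (1 - cnj a * (of_real r * \<zeta>)) = 1 - cnj \<zeta> * (of_real r * a)" by (simp add: mult_ac)
  ultimately show ?thesis by (metis complex_mod_cnj norm_minus_commute)
qed

lemma blaschke_factor_radial_defect:
  assumes \<zeta>: "cmod \<zeta> = 1" and r: "0 \<le> r" "r < 1" and a: "a \<in> ball 0 1"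
  shows "1 - (cmod (blaschke_factor a (of_real r * \<zeta>)))\<^sup>2 \<le> 4 * (1 - r\<^sup>2) * ((1 - (cmod a)\<^sup>2) / (cmod (\<zeta> - a))\<^sup>2)"
    and "cmod (blaschke_factor a (of_real r * \<zeta>)) \<le> 1"
proof -
  let ?z = "of_real r * \<zeta>"
  have z: "?z \<in> ball 0 1" "cmod ?z = r" using r \<zeta> by (auto simp: norm_mult)
  have nz: "0 < cmod (\<zeta> - a)" using \<zeta> a by auto
  have "(cmod (\<zeta> - a))\<^sup>2 \<le> (2 * cmod (\<zeta> - of_real r * a))\<^sup>2"
    using cmod_radial_ge[OF \<zeta> r] a by (intro power_mono) auto
  then have le: "(cmod (\<zeta> - a))\<^sup>2 \<le> 4 * (cmod (1 - cnj a * ?z))\<^sup>2"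
    by (simp add: cmod_radial_kernel[OF \<zeta>] power_mult_distrib)
  have pos: "0 \<le> (1 - (cmod a)\<^sup>2) * (1 - r\<^sup>2)"
    using one_minus_cmod_sq_pos[OF a] one_minus_cmod_sq_pos[OF z(1)] z by simp
  have eq: "1 - (cmod (blaschke_factor a ?z))\<^sup>2 = (1 - (cmod a)\<^sup>2) * (1 - r\<^sup>2) / (cmod (1 - cnj a * ?z))\<^sup>2"
    using blaschke_factor_defect[OF a z(1)] z(2) by simp
  also have "\<dots> \<le> (1 - (cmod a)\<^sup>2) * (1 - r\<^sup>2) / ((cmod (\<zeta> - a))\<^sup>2 / 4)"
    using le nz pos by (intro divide_left_mono) (auto simp: zero_less_mult_iff)
  also have "\<dots> = 4 * (1 - r\<^sup>2) * ((1 - (cmod a)\<^sup>2) / (cmod (\<zeta> - a))\<^sup>2)"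
    unfolding divide_divide_eq_right times_divide_eq_right by (simp only: mult_ac)
  finally show "1 - (cmod (blaschke_factor a ?z))\<^sup>2 \<le> 4 * (1 - r\<^sup>2) * ((1 - (cmod a)\<^sup>2) / (cmod (\<zeta> - a))\<^sup>2)" .
  have "0 \<le> 1 - (cmod (blaschke_factor a ?z))\<^sup>2" unfolding eq using pos by simp
  then show "cmod (blaschke_factor a ?z) \<le> 1" by (simp add: abs_square_le_1)
qed

text \<open>
  The defect \<open>1 - \<Prod>\<^sub>j \<bar>b\<^sub>j\<bar>\<^sup>2\<close> is at most the sum of the defects of the factors.
\<close>

lemma blaschke_product_radial_defect:
  assumes \<zeta>: "cmod \<zeta> = 1" and r: "0 \<le> r" "r < 1" and w: "w ` J \<subseteq> ball 0 1"
    and sum: "(\<lambda>j. (1 - (cmod (w j))\<^sup>2) / (cmod (\<zeta> - w j))\<^sup>2) summable_on J"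
    and prod: "(\<lambda>j. if j \<in> J then blaschke_factor (w j) (of_real r * \<zeta>) else 1) has_prod b"
  shows "1 - (cmod b)\<^sup>2 \<le> 4 * (\<Sum>\<^sub>\<infinity>j\<in>J. (1 - (cmod (w j))\<^sup>2) / (cmod (\<zeta> - w j))\<^sup>2) * (1 - r\<^sup>2)" "cmod b \<le> 1"
proof -
  let ?f = "\<lambda>j. if j \<in> J then blaschke_factor (w j) (of_real r * \<zeta>) else 1"
  let ?g = "\<lambda>j. (1 - (cmod (w j))\<^sup>2) / (cmod (\<zeta> - w j))\<^sup>2"
  have r2: "0 \<le> 1 - r\<^sup>2" using r by (simp add: abs_square_le_1)
  have g: "0 \<le> ?g j" if "j \<in> J" for j
    using one_minus_cmod_sq_pos[of "w j"] w that by (intro divide_nonneg_nonneg) auto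
  have f: "1 - (cmod (?f j))\<^sup>2 \<le> (if j \<in> J then 4 * (1 - r\<^sup>2) * ?g j else 0)" "cmod (?f j) \<le> 1" for j
    using blaschke_factor_radial_defect[OF \<zeta> r, of "w j"] w by auto
  have lim: "(\<lambda>n. \<Prod>i\<le>n. ?f i) \<longlonglongrightarrow> b" by (rule has_prod_imp_tendsto[OF prod])
  have "1 - (cmod (\<Prod>i\<le>n. ?f i))\<^sup>2 \<le> 4 * infsum ?g J * (1 - r\<^sup>2)" for n
  proof -
    have "1 - (cmod (\<Prod>i\<le>n. ?f i))\<^sup>2 = 1 - (\<Prod>i\<le>n. (cmod (?f i))\<^sup>2)"
      by (simp only: prod_norm[symmetric] prod_power_distrib)
    also have "\<dots> \<le> (\<Sum>i\<le>n. 1 - (cmod (?f i))\<^sup>2)"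
      using Weierstrass_prod_ineq[of "{..n}" "\<lambda>i. 1 - (cmod (?f i))\<^sup>2"] f(2) by (simp add: abs_square_le_1)
    also have "\<dots> \<le> (\<Sum>i\<le>n. if i \<in> J then 4 * (1 - r\<^sup>2) * ?g i else 0)"
      by (intro sum_mono f)
    also have "\<dots> = 4 * (1 - r\<^sup>2) * sum ?g ({..n} \<inter> J)"
      unfolding sum_distrib_left by (rule sum.inter_restrict[symmetric]) auto
    also have "\<dots> \<le> 4 * (1 - r\<^sup>2) * infsum ?g J"
      using r2 g by (intro mult_left_mono finite_sum_le_infsum[OF sum]) auto
    finally show ?thesis by (simp only: mult_ac)
  qed
  moreover have "(\<lambda>n. 1 - (cmod (\<Prod>i\<le>n. ?f i))\<^sup>2) \<longlonglongrightarrow> 1 - (cmod b)\<^sup>2"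
    by (intro tendsto_intros lim)
  ultimately show "1 - (cmod b)\<^sup>2 \<le> 4 * infsum ?g J * (1 - r\<^sup>2)"
    by (intro LIMSEQ_le_const2) auto
  have "cmod (\<Prod>i\<le>n. ?f i) \<le> 1" for n
    unfolding prod_norm[symmetric] using f(2) by (intro prod_le_1) auto
  then show "cmod b \<le> 1"
    using tendsto_norm[OF lim] by (intro LIMSEQ_le_const2) auto
qed

lemma poisson_kernel_Re:
  assumes "cmod w = 1" "z \<in> ball 0 1"
  shows "Re ((w + z) / (w - z)) = (1 - (cmod z)\<^sup>2) / (cmod (w - z))\<^sup>2"
proof -
  have "(w + z) / (w - z) = (w + z) * cnj (w - z) / of_real ((cmod (w - z))\<^sup>2)"
    using complex_div_cnj[of "w + z" "w - z"] by simp
  moreover have "Re ((w + z) * cnj (w - z)) = (cmod w)\<^sup>2 - (cmod z)\<^sup>2"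
    unfolding cmod_power2 by (simp add: power2_eq_square algebra_simps)
  ultimately show ?thesis using assms by (simp add: Re_divide_of_real del: of_real_power)
qed

text \<open>
  The modulus of the singular factor is the exponential of a Poisson integral, and
  \<open>1 - exp(-x) \<le> x\<close>.
\<close>

lemma singular_inner_radial_defect:
  assumes \<nu>: "singular_circle_measure \<nu>" and \<zeta>: "cmod \<zeta> = 1" and r: "0 \<le> r" "r < 1"
    and fin: "(\<integral>\<^sup>+ z. 1 / ennreal ((cmod (\<zeta> - z))\<^sup>2) \<partial>\<nu>) < \<infinity>"
  shows "1 - (cmod (singular_inner \<nu> (of_real r * \<zeta>)))\<^sup>2
    \<le> 8 * enn2real (\<integral>\<^sup>+ z. 1 / ennreal ((cmod (\<zeta> - z))\<^sup>2) \<partial>\<nu>) * (1 - r\<^sup>2)"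
proof -
  let ?z = "of_real r * \<zeta>" and ?I = "\<integral>\<^sup>+ z. 1 / ennreal ((cmod (\<zeta> - z))\<^sup>2) \<partial>\<nu>"
  let ?P = "\<lambda>w. (w + ?z) / (w - ?z)"
  have z: "?z \<in> ball 0 1" "cmod ?z = r" using r \<zeta> by (auto simp: norm_mult)
  have r2: "0 < 1 - r\<^sup>2" using one_minus_cmod_sq_pos[OF z(1)] z(2) by simp
  have sets: "sets \<nu> = sets borel" using \<nu> by (simp add: singular_circle_measure_def)
  obtain N where N: "N \<in> sets borel" "N \<subseteq> sphere 0 1" "emeasure \<nu> (- N) = 0"
    using \<nu> by (auto simp: singular_circle_measure_def)
  have ae: "AE w in \<nu>. cmod w = 1"
  proof (rule AE_I[where N = "- N"])
    show "{w \<in> space \<nu>. cmod w \<noteq> 1} \<subseteq> - N" using N(2) by auto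
    show "- N \<in> sets \<nu>" using N(1) by (simp add: sets)
  qed fact
  have ineq: "ennreal (Re (?P w)) \<le> ennreal (4 * (1 - r\<^sup>2)) * (1 / ennreal ((cmod (\<zeta> - w))\<^sup>2))"
    if w: "cmod w = 1" for w
  \<comment> \<open>At \<open>\<zeta>\<close> the right-hand side is \<open>\<infinity>\<close>, as \<open>1 / 0 = \<infinity>\<close> in \<open>ennreal\<close>.\<close>
  proof (cases "w = \<zeta>")
    case True
    have "ennreal (4 * (1 - r\<^sup>2)) \<noteq> 0" using r2 by simp
    then show ?thesis using True by (simp add: ennreal_mult_top)
  next
    case False
    have "cmod (\<zeta> - w) = cmod (w - \<zeta>)" by (rule norm_minus_commute)
    also have "\<dots> \<le> 2 * cmod (w - of_real r * \<zeta>)"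
      by (rule cmod_radial_ge[OF w r]) (use \<zeta> in auto)
    finally have "(cmod (\<zeta> - w))\<^sup>2 \<le> (2 * cmod (w - ?z))\<^sup>2" by (intro power_mono) auto
    then have le: "(cmod (\<zeta> - w))\<^sup>2 / 4 \<le> (cmod (w - ?z))\<^sup>2" by (simp add: power_mult_distrib)
    have p: "0 < (cmod (\<zeta> - w))\<^sup>2" using False by simp
    have "Re (?P w) = (1 - r\<^sup>2) / (cmod (w - ?z))\<^sup>2"
      using poisson_kernel_Re[OF w z(1)] z(2) by simp
    also have "\<dots> \<le> (1 - r\<^sup>2) / ((cmod (\<zeta> - w))\<^sup>2 / 4)"
      using le p r2 by (intro divide_left_mono) (auto simp: zero_less_mult_iff)
    also have "\<dots> = 4 * (1 - r\<^sup>2) * (1 / (cmod (\<zeta> - w))\<^sup>2)" by simp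
    finally have "ennreal (Re (?P w)) \<le> ennreal (4 * (1 - r\<^sup>2) * (1 / (cmod (\<zeta> - w))\<^sup>2))"
      by (rule ennreal_leI)
    also have "\<dots> = ennreal (4 * (1 - r\<^sup>2)) * (1 / ennreal ((cmod (\<zeta> - w))\<^sup>2))"
      using p r2 by (subst ennreal_mult) (auto simp: divide_ennreal[symmetric])
    finally show ?thesis .
  qed
  have q: "Re (\<integral>w. ?P w \<partial>\<nu>) \<le> 4 * (1 - r\<^sup>2) * enn2real ?I"
  proof (cases "integrable \<nu> ?P")
    case True
    then have iRe: "integrable \<nu> (\<lambda>w. Re (?P w))" by (rule integrable_Re)
    have "ennreal (Re (\<integral>w. ?P w \<partial>\<nu>)) = ennreal (\<integral>w. Re (?P w) \<partial>\<nu>)"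
      using True by simp
    also have "\<dots> = (\<integral>\<^sup>+w. ennreal (Re (?P w)) \<partial>\<nu>)"
    proof (rule nn_integral_eq_integral[symmetric, OF iRe])
      show "AE w in \<nu>. 0 \<le> Re (?P w)"
        using ae
      proof eventually_elim
        case (elim w)
        show ?case unfolding poisson_kernel_Re[OF elim z(1)] using r2 z(2) by simp
      qed
    qed
    also have "\<dots> \<le> (\<integral>\<^sup>+w. ennreal (4 * (1 - r\<^sup>2)) * (1 / ennreal ((cmod (\<zeta> - w))\<^sup>2)) \<partial>\<nu>)"
      using ae by (intro nn_integral_mono_AE) (rule eventually_mono, assumption, rule ineq)
    also have "\<dots> = ennreal (4 * (1 - r\<^sup>2)) * ?I"
      by (rule nn_integral_cmult) (simp add: measurable_cong_sets[OF sets refl])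
    also have "\<dots> = ennreal (4 * (1 - r\<^sup>2) * enn2real ?I)"
      using fin r2 by (subst ennreal_mult) (auto simp: ennreal_enn2real less_top)
    finally show ?thesis using r2 by (subst (asm) ennreal_le_iff) auto
  next
    case False
    \<comment> \<open>The integral then has the default value \<open>0\<close>.\<close>
    then show ?thesis using r2 by (simp add: not_integrable_integral_eq)
  qed
  have "1 + (- (2 * Re (\<integral>w. ?P w \<partial>\<nu>))) \<le> exp (- (2 * Re (\<integral>w. ?P w \<partial>\<nu>)))" by (rule exp_ge_add_one_self)
  also have "\<dots> = (cmod (singular_inner \<nu> ?z))\<^sup>2"
    by (simp add: singular_inner_def norm_exp_eq_Re exp_double[symmetric])
  finally show ?thesis using q by (simp add: algebra_simps)
qed

text \<open>
  The defects of the Blaschke product and of the singular factor add up, since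
  \<open>1 - x y = (1 - x) + x (1 - y)\<close> and the Blaschke product is at most \<open>1\<close> in modulus.
\<close>

theorem ahern_clark_radial_defect:
  assumes "\<zeta> \<in> ahern_clark \<theta>"
  shows "\<exists>M. \<forall>r. 0 \<le> r \<longrightarrow> r < 1 \<longrightarrow> 1 - (cmod (\<theta> (of_real r * \<zeta>)))\<^sup>2 \<le> M * (1 - r\<^sup>2)"
proof -
  from assms obtain J w \<nu> where \<zeta>: "cmod \<zeta> = 1" and can: "canonical_factorization \<theta> J w \<nu>"
    and sum: "(\<lambda>j. (1 - (cmod (w j))\<^sup>2) / (cmod (\<zeta> - w j))\<^sup>2) summable_on J"
    and fin: "(\<integral>\<^sup>+ z. 1 / ennreal ((cmod (\<zeta> - z))\<^sup>2) \<partial>\<nu>) < \<infinity>"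
    by (auto simp: ahern_clark_def)
  from can obtain c where w: "w ` J \<subseteq> ball 0 1" and \<nu>: "singular_circle_measure \<nu>" and c: "cmod c = 1"
    and fac: "\<And>z. z \<in> ball 0 1 \<Longrightarrow> \<exists>b. (\<lambda>j. if j \<in> J then blaschke_factor (w j) z else 1) has_prod b \<and> \<theta> z = c * b * singular_inner \<nu> z"
    by (auto simp: canonical_factorization_def)
  define A where "A = 4 * (\<Sum>\<^sub>\<infinity>j\<in>J. (1 - (cmod (w j))\<^sup>2) / (cmod (\<zeta> - w j))\<^sup>2)"
  define B where "B = 8 * enn2real (\<integral>\<^sup>+ z. 1 / ennreal ((cmod (\<zeta> - z))\<^sup>2) \<partial>\<nu>)"
  show ?thesis
  proof (intro exI[of _ "A + B"] allI impI)
    fix r :: real assume r: "0 \<le> r" "r < 1"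
    let ?z = "of_real r * \<zeta>"
    have "?z \<in> ball 0 1" using r \<zeta> by (simp add: norm_mult)
    then obtain b where b: "(\<lambda>j. if j \<in> J then blaschke_factor (w j) ?z else 1) has_prod b"
      and \<theta>: "\<theta> ?z = c * b * singular_inner \<nu> ?z" using fac by blast
    let ?x = "(cmod b)\<^sup>2" and ?y = "(cmod (singular_inner \<nu> ?z))\<^sup>2"
    have x: "1 - ?x \<le> A * (1 - r\<^sup>2)" "?x \<le> 1"
      using blaschke_product_radial_defect[OF \<zeta> r w sum b] by (auto simp: A_def abs_square_le_1)
    have y: "1 - ?y \<le> B * (1 - r\<^sup>2)"
      using singular_inner_radial_defect[OF \<nu> \<zeta> r fin] by (simp add: B_def)
    have B: "0 \<le> B * (1 - r\<^sup>2)" using r by (simp add: B_def abs_square_le_1)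
    have "?x * (1 - ?y) \<le> ?x * (B * (1 - r\<^sup>2))" using y by (intro mult_left_mono) auto
    also have "\<dots> \<le> 1 * (B * (1 - r\<^sup>2))" using x(2) B by (intro mult_right_mono)
    finally have xy: "?x * (1 - ?y) \<le> B * (1 - r\<^sup>2)" by simp
    have "(cmod (\<theta> ?z))\<^sup>2 = ?x * ?y" by (simp add: \<theta> norm_mult power_mult_distrib c)
    then have "1 - (cmod (\<theta> ?z))\<^sup>2 = (1 - ?x) + ?x * (1 - ?y)" by (simp add: right_diff_distrib)
    then show "1 - (cmod (\<theta> ?z))\<^sup>2 \<le> (A + B) * (1 - r\<^sup>2)" using x(1) xy by (simp add: distrib_right)
  qed
qed

text \<open>
  The previous bound says that the kernels at radial points are bounded. Along a subsequence
  \<open>\<theta>\<close> converges there, and the weak limit of the kernels is a boundary kernel.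
\<close>

theorem ahern_clark_boundary_kernel:
  assumes \<theta>: "inner_function \<theta>" and AC: "\<zeta> \<in> ahern_clark \<theta>"
  shows "\<exists>\<alpha>. cmod \<alpha> = 1 \<and> boundary_kernel \<theta> \<zeta> \<alpha> \<in> model_space \<theta>"
proof -
  have \<zeta>: "cmod \<zeta> = 1" using AC by (simp add: ahern_clark_def)
  obtain M where M: "\<And>r. 0 \<le> r \<Longrightarrow> r < 1 \<Longrightarrow> 1 - (cmod (\<theta> (of_real r * \<zeta>)))\<^sup>2 \<le> M * (1 - r\<^sup>2)"
    using ahern_clark_radial_defect[OF AC] by blast
  define r :: "nat \<Rightarrow> real" where "r k = 1 - inverse (real (Suc k))" for k
  have r: "0 \<le> r k" "r k < 1" for k by (auto simp: r_def inverse_le_1_iff)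
  have r1: "r \<longlonglongrightarrow> 1" unfolding r_def using tendsto_diff[OF tendsto_const LIMSEQ_inverse_real_of_nat, of 1] by simp
  define z where "z k = of_real (r k) * \<zeta>" for k
  have zb: "z k \<in> ball 0 1" and zr: "cmod (z k) = r k" for k
    using r[of k] \<zeta> by (auto simp: z_def norm_mult)
  have "z \<longlonglongrightarrow> of_real 1 * \<zeta>" unfolding z_def by (intro tendsto_intros r1)
  then have z\<zeta>: "z \<longlonglongrightarrow> \<zeta>" by simp
  have "bounded (range (\<lambda>k. \<theta> (z k)))"
    using inner_function_le_1[OF \<theta> zb] by (auto simp: bounded_iff)
  then obtain \<alpha> s where s: "strict_mono s" "((\<lambda>k. \<theta> (z k)) \<circ> s) \<longlonglongrightarrow> \<alpha>"
    using bounded_imp_convergent_subsequence by blast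
  have nb: "h2_norm (kernel \<theta> (z k)) \<le> sqrt M" for k
  proof (rule real_le_rsqrt)
    have "0 < 1 - (r k)\<^sup>2" using one_minus_cmod_sq_pos[OF zb[of k]] by (simp add: zr)
    then show "(h2_norm (kernel \<theta> (z k)))\<^sup>2 \<le> M"
      using M[OF r, of k] unfolding h2_norm_kernel_sq[OF \<theta> zb] zr by (simp add: pos_divide_le_eq z_def)
  qed
  have lim: "(\<lambda>k. \<theta> ((z \<circ> s) k)) \<longlonglongrightarrow> \<alpha>" using s(2) by (simp add: o_def)
  note * = boundary_kernel_weak_limit[OF \<theta> \<zeta> _ LIMSEQ_subseq_LIMSEQ[OF z\<zeta> s(1)] lim, of "sqrt M"]
  have "cmod \<alpha> = 1" by (rule *(1)) (use zb nb in auto)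
  moreover have "boundary_kernel \<theta> \<zeta> \<alpha> \<in> model_space \<theta>" by (rule *(2)) (use zb nb in auto)
  ultimately show ?thesis by blast
qed

section \<open>Moving zeros\<close>

text \<open>
  The part of a Stolz angle away from its vertex is relatively compact in the disc.
\<close>

lemma stolz_zeros_far_finite:
  assumes "f holomorphic_on ball 0 1" "\<exists>z\<in>ball 0 1. f z \<noteq> 0" "d > 0" "\<gamma> > 0"
  shows "finite {z \<in> stolz_angle \<gamma> \<zeta>. f z = 0 \<and> d \<le> cmod (z - \<zeta>)}"
proof (cases "\<exists>z\<in>ball 0 1. f z = 0")
  case True
  let ?K = "cball 0 (1 - d / \<gamma>) :: complex set"
  have "finite {z \<in> ?K. f z = 0}"
  proof (rule holomorphic_compact_finite_zeros[OF assms(1)])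
    have "0 < d / \<gamma>" using assms by simp
    then show "?K \<subseteq> ball 0 1" by (auto simp del: zero_less_divide_iff)
    show "\<not> f constant_on ball 0 1" using assms(2) True unfolding constant_on_def by metis
  qed auto
  moreover have "{z \<in> stolz_angle \<gamma> \<zeta>. f z = 0 \<and> d \<le> cmod (z - \<zeta>)} \<subseteq> {z \<in> ?K. f z = 0}"
  proof safe
    fix z assume z: "z \<in> stolz_angle \<gamma> \<zeta>" "d \<le> cmod (z - \<zeta>)"
    then have "d \<le> \<gamma> * (1 - cmod z)" by (simp add: stolz_angle_def)
    then have "d / \<gamma> \<le> 1 - cmod z" using assms by (simp add: divide_le_eq mult.commute)
    then show "z \<in> ?K" by simp
  qed
  ultimately show ?thesis by (rule rev_finite_subset)
next
  case False
  then have "{z \<in> stolz_angle \<gamma> \<zeta>. f z = 0 \<and> d \<le> cmod (z - \<zeta>)} = {}" by (auto simp: stolz_angle_def)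
  then show ?thesis by (simp only: finite.emptyI)
qed

text \<open>
  Replacing \<open>f\<close> by \<open>f (z - a) / (z - l) = f + (l - a) f / (z - l)\<close> moves the zero \<open>l\<close> to \<open>a\<close>
  and keeps all other zeros. The change is small in norm if \<open>l\<close> is a zero in the Stolz angle
  close to \<open>\<zeta>\<close> and \<open>a\<close> is closer to \<open>\<zeta>\<close>. The set \<open>S\<close> holds the zeros that were moved before.
\<close>

theorem move_stolz_zero:
  assumes \<theta>: "inner_function \<theta>" and \<zeta>: "cmod \<zeta> = 1" and \<gamma>: "\<gamma> > 0"
    and f: "f \<in> model_space \<theta>" "\<exists>z\<in>ball 0 1. f z \<noteq> 0" and inf: "infinite {z \<in> stolz_angle \<gamma> \<zeta>. f z = 0}"
    and z: "\<And>n. z n \<in> ball 0 1" "z \<longlonglongrightarrow> \<zeta>" and S: "finite S" "S \<subseteq> ball 0 1" and e: "e > 0"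
  obtains n g where "n > m" "z n \<notin> S" "g \<in> model_space \<theta>" "\<exists>z\<in>ball 0 1. g z \<noteq> 0"
    "infinite {z \<in> stolz_angle \<gamma> \<zeta>. g z = 0}" "h2_norm (\<lambda>u. g u - f u) < e"
    "g (z n) = 0" "\<And>u. u \<in> S \<Longrightarrow> f u = 0 \<Longrightarrow> g u = 0"
proof -
  let ?Z = "{z \<in> stolz_angle \<gamma> \<zeta>. f z = 0}"
  note f2 = model_space_hardy2[OF f(1)]
  have fpos: "0 < h2_norm f" using f(2) h2_norm_pos[OF f2] by blast
  \<comment> \<open>A change smaller than the norm of \<open>f\<close> cannot give the zero function.\<close>
  then have "min e (h2_norm f) > 0" using e by simp
  then obtain d where d: "d > 0" "\<And>w a. w \<in> stolz_angle \<gamma> \<zeta> \<Longrightarrow> cmod (w - \<zeta>) < d \<Longrightarrow> cmod (a - \<zeta>) \<le> cmod (w - \<zeta>)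
      \<Longrightarrow> cmod (w - a) * h2_norm (diff_quot f w) < min e (h2_norm f)"
    using diff_quot_stolz_small[OF f2 _ \<gamma>] by blast
  have "finite {z \<in> stolz_angle \<gamma> \<zeta>. f z = 0 \<and> d \<le> cmod (z - \<zeta>)}"
    by (rule stolz_zeros_far_finite[OF hardy2_holomorphic[OF f2] f(2) d(1) \<gamma>])
  then have "infinite (?Z - ({z \<in> stolz_angle \<gamma> \<zeta>. f z = 0 \<and> d \<le> cmod (z - \<zeta>)} \<union> S))"
    using inf S(1) by (intro Diff_infinite_finite) auto
  then obtain l where l: "l \<in> ?Z - ({z \<in> stolz_angle \<gamma> \<zeta>. f z = 0 \<and> d \<le> cmod (z - \<zeta>)} \<union> S)"
    using infinite_imp_nonempty by blast
  then have l: "l \<in> stolz_angle \<gamma> \<zeta>" "f l = 0" "cmod (l - \<zeta>) < d" "l \<notin> S" by auto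
  have lb: "l \<in> ball 0 1" using l by (simp add: stolz_angle_def)
  have "0 < cmod (l - \<zeta>)" using lb \<zeta> by auto
  then have "\<forall>\<^sub>F n in sequentially. cmod (z n - \<zeta>) < cmod (l - \<zeta>)"
    using z(2) unfolding tendsto_iff dist_norm by blast
  moreover have "\<forall>\<^sub>F n in sequentially. z n \<notin> S"
  proof -
    have "open (- S)" using S(1) by (simp add: finite_imp_closed open_Compl)
    moreover have "\<zeta> \<in> - S" using S(2) \<zeta> by auto
    ultimately show ?thesis using topological_tendstoD[OF z(2)] by fastforce
  qed
  moreover have "\<forall>\<^sub>F n in sequentially. n > m" by (rule eventually_gt_at_top)
  ultimately have "\<forall>\<^sub>F n in sequentially. cmod (z n - \<zeta>) < cmod (l - \<zeta>) \<and> z n \<notin> S \<and> n > m"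
    by eventually_elim auto
  then obtain n where n: "cmod (z n - \<zeta>) < cmod (l - \<zeta>)" "z n \<notin> S" "n > m"
    using eventually_happens sequentially_bot by blast
  let ?q = "diff_quot f l"
  define g where "g = (\<lambda>u. f u + (l - z n) * ?q u)"
  have q: "?q \<in> model_space \<theta>" by (rule model_space_diff_quot[OF \<theta> f(1) lb l(2)])
  note q2 = model_space_hardy2[OF q]
  have g: "g \<in> model_space \<theta>" unfolding g_def by (intro model_space_add model_space_cmult \<theta> f q)
  have gf: "h2_norm (\<lambda>u. g u - f u) < min e (h2_norm f)"
    using d(2)[OF l(1,3), of "z n"] n(1) by (simp add: g_def h2_norm_cmult[OF q2])
  have zero: "g u = 0" if "f u = 0" "u \<noteq> l" for u
    using that l(2) by (simp add: g_def diff_quot_def)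
  have gz: "\<exists>z\<in>ball 0 1. g z \<noteq> 0"
  proof (rule ccontr)
    assume "\<not> ?thesis"
    then have "h2_norm (\<lambda>u. g u - f u) = h2_norm (\<lambda>u. -1 * f u)"
      by (intro h2_norm_cong hardy2_cmult f2) auto
    then show False using gf h2_norm_cmult[OF f2, of "-1"] by simp
  qed
  have "z n \<noteq> l" using n(1) by auto
  then have "(l - z n) * (f (z n) / (z n - l)) = - f (z n)" by (simp add: field_simps)
  then have gn: "g (z n) = 0" using \<open>z n \<noteq> l\<close> l(2) by (simp add: g_def diff_quot_def)
  have "infinite (?Z - {l})" using inf by simp
  then have "infinite {z \<in> stolz_angle \<gamma> \<zeta>. g z = 0}"
    by (rule infinite_super[rotated]) (auto intro: zero)
  then show thesis
    using that[OF n(3,2) g gz _ _ gn] gf zero l(4) by (metis min_less_iff_conj)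
qed

text \<open>
  Differences that are summable in norm are summable locally uniformly, so the limit is
  holomorphic; as a bounded pointwise limit it is also a weak limit and stays in the model
  space.
\<close>

theorem model_space_complete:
  assumes \<theta>: "inner_function \<theta>" and F: "\<And>n. F n \<in> model_space \<theta>"
    and D: "\<And>n. h2_norm (\<lambda>u. F (Suc n) u - F n u) \<le> D n" "summable D"
  obtains g where "g \<in> model_space \<theta>" "\<And>z. z \<in> ball 0 1 \<Longrightarrow> (\<lambda>n. F n z) \<longlonglongrightarrow> g z"
    "h2_norm (\<lambda>u. g u - F 0 u) \<le> suminf D"
proof -
  let ?d = "\<lambda>n u. F (Suc n) u - F n u" and ?H = "\<lambda>n u. F n u - F 0 u"
  note F2 = model_space_hardy2[OF F] and d2 = hardy2_diff[OF model_space_hardy2[OF F] model_space_hardy2[OF F]]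
  have D0: "0 \<le> D n" for n using h2_norm_nonneg[OF d2] D(1) order_trans by blast
  have tel: "(\<Sum>k<n. ?d k u) = ?H n u" for n u
    by (rule sum_lessThan_telescope)
  define h where "h u = (\<Sum>k. ?d k u)" for u
  have ul: "uniform_limit (cball 0 r) ?H h sequentially" if r: "0 \<le> r" "r < 1" for r
  proof -
    have r2: "0 < 1 - r\<^sup>2" using r by (simp add: abs_square_less_1)
    have "uniform_limit (cball 0 r) (\<lambda>n u. \<Sum>k<n. ?d k u) (\<lambda>u. \<Sum>k. ?d k u) sequentially"
    proof (rule Weierstrass_m_test)
      show "summable (\<lambda>n. D n / sqrt (1 - r\<^sup>2))" by (rule summable_divide[OF D(2)])
      fix n and u :: complex assume u: "u \<in> cball 0 r"
      then have ub: "u \<in> ball 0 1" using r by simp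
      have "cmod (?d n u) \<le> h2_norm (?d n) / sqrt (1 - (cmod u)\<^sup>2)"
        by (rule hardy2_point_bound[OF d2 ub])
      also have "\<dots> \<le> D n / sqrt (1 - r\<^sup>2)"
      proof (rule frac_le)
        show "sqrt (1 - r\<^sup>2) \<le> sqrt (1 - (cmod u)\<^sup>2)"
          using u by (intro real_sqrt_le_mono diff_mono power_mono) auto
      qed (use D D0 r2 in auto)
      finally show "norm (?d n u) \<le> D n / sqrt (1 - r\<^sup>2)" .
    qed
    then show ?thesis unfolding tel h_def[symmetric] .
  qed
  have Hlim: "(\<lambda>n. ?H n u) \<longlonglongrightarrow> h u" if "u \<in> ball 0 1" for u
    by (rule tendsto_uniform_limitI[OF ul[of "cmod u"]]) (use that in auto)
  have hol: "h holomorphic_on ball 0 1"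
  proof (rule holomorphic_uniform_sequence[of _ ?H])
    show "?H n holomorphic_on ball 0 1" for n by (rule hardy2_holomorphic[OF d2])
    fix x :: complex assume x: "x \<in> ball 0 1"
    let ?e = "(1 - cmod x) / 2"
    have sub: "cball x ?e \<subseteq> cball 0 ((1 + cmod x) / 2)"
    proof
      fix y assume "y \<in> cball x ?e"
      then have "cmod (y - x) \<le> ?e" by (simp add: dist_norm norm_minus_commute)
      then show "y \<in> cball 0 ((1 + cmod x) / 2)" using norm_triangle_sub[of y x] by (simp add: field_simps)
    qed
    have "uniform_limit (cball x ?e) ?H h sequentially"
      by (rule uniform_limit_on_subset[OF ul sub]) (use x in auto)
    moreover have "cball x ?e \<subseteq> ball 0 1" using sub x by fastforce
    ultimately show "\<exists>e>0. cball x e \<subseteq> ball 0 1 \<and> uniform_limit (cball x e) ?H h sequentially"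
      using x by (intro exI[of _ ?e]) auto
  qed auto
  have bound: "h2_norm (?H n) \<le> suminf D" for n
  proof -
    have "h2_norm (?H n) \<le> sum D {..<n}"
    proof (induction n)
      case 0 then show ?case by (simp add: h2_norm_const)
    next
      case (Suc n)
      have "h2_norm (?H (Suc n)) \<le> h2_norm (?d n) + h2_norm (?H n)"
        by (rule h2_norm_triangle3[OF F2 F2 F2])
      then show ?case using Suc D(1)[of n] by simp
    qed
    also have "\<dots> \<le> suminf D" using D(2) D0 by (intro sum_le_suminf) auto
    finally show ?thesis .
  qed
  have hK: "h \<in> model_space \<theta>"
    by (rule model_space_weak_limit[OF \<theta> model_space_diff[OF \<theta> F F] bound hol]) (rule Hlim)
  show thesis
  proof (rule that)
    show "(\<lambda>u. F 0 u + h u) \<in> model_space \<theta>" by (rule model_space_add[OF \<theta> F hK])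
    show "(\<lambda>n. F n u) \<longlonglongrightarrow> F 0 u + h u" if "u \<in> ball 0 1" for u
      using tendsto_add[OF tendsto_const Hlim[OF that], of "F 0 u"] by simp
    have "h2_norm h \<le> suminf D"
      by (rule hardy2_weak_limit(2)[OF d2 bound hol]) (rule Hlim)
    then show "h2_norm (\<lambda>u. F 0 u + h u - F 0 u) \<le> suminf D" by simp
  qed
qed

text \<open>
  Infinitely many zeros are moved one after another to points of the given sequence. The total
  change is less than the norm of \<open>f\<close>, so the limit is not zero.
\<close>

theorem zero_set_transfer:
  assumes \<theta>: "inner_function \<theta>" and \<zeta>: "cmod \<zeta> = 1" and \<gamma>: "\<gamma> > 0"
    and f: "f \<in> model_space \<theta>" "\<exists>z\<in>ball 0 1. f z \<noteq> 0" and inf: "infinite {z \<in> stolz_angle \<gamma> \<zeta>. f z = 0}"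
    and z: "\<And>n. z n \<in> ball 0 1" "z \<longlonglongrightarrow> \<zeta>"
  obtains s :: "nat \<Rightarrow> nat" and g where "strict_mono s" "inj (z \<circ> s)" "g \<in> model_space \<theta>" "\<exists>u\<in>ball 0 1. g u \<noteq> 0"
    "\<And>k. g (z (s k)) = 0"
proof -
  note f2 = model_space_hardy2[OF f(1)]
  have fpos: "0 < h2_norm f" using f(2) h2_norm_pos[OF f2] by blast
  \<comment> \<open>The bounds on the changes add up to half of the norm of \<open>f\<close>.\<close>
  define D where "D k = h2_norm f / 4 * (1 / 2) ^ k" for k :: nat
  have D: "D k > 0" for k using fpos by (simp add: D_def)
  have Dsum: "D sums (h2_norm f / 2)"
    unfolding D_def using sums_mult[OF geometric_sums[of "1/2 :: real"], of "h2_norm f / 4"] by simp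
  \<comment> \<open>The state consists of the current function, the last index used and the set of points to
     which zeros have been moved.\<close>
  define P where "P = (\<lambda>(g, n :: nat, S). g \<in> model_space \<theta> \<and> (\<exists>u\<in>ball 0 1. g u \<noteq> 0) \<and>
     infinite {z \<in> stolz_angle \<gamma> \<zeta>. g z = 0} \<and> finite S \<and> S \<subseteq> ball 0 1 \<and> (\<forall>u\<in>S. g u = 0))"
  define Q where "Q = (\<lambda>k (g, n, S) (g', n', S'). h2_norm (\<lambda>u. g' u - g u) \<le> D k \<and> n < n' \<and> z n' \<notin> S \<and> S' = insert (z n') S)"
  have step: "\<exists>y. P y \<and> Q k x y" if "P x" for x k
  proof -
    obtain g n S where x: "x = (g, n, S)" by (metis prod_cases3)
    have g: "g \<in> model_space \<theta>" "\<exists>u\<in>ball 0 1. g u \<noteq> 0" "infinite {z \<in> stolz_angle \<gamma> \<zeta>. g z = 0}"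
      and S: "finite S" "S \<subseteq> ball 0 1" "\<forall>u\<in>S. g u = 0" using that by (auto simp: P_def x)
    obtain n' g' where "n' > n" "z n' \<notin> S" "g' \<in> model_space \<theta>" "\<exists>z\<in>ball 0 1. g' z \<noteq> 0"
      "infinite {z \<in> stolz_angle \<gamma> \<zeta>. g' z = 0}" "h2_norm (\<lambda>u. g' u - g u) < D k"
      "g' (z n') = 0" "\<And>u. u \<in> S \<Longrightarrow> g u = 0 \<Longrightarrow> g' u = 0"
      using move_stolz_zero[OF \<theta> \<zeta> \<gamma> g z S(1,2) D[of k], of n] by blast
    then have "P (g', n', insert (z n') S)" "Q k x (g', n', insert (z n') S)"
      using S z(1) by (auto simp: P_def Q_def x)
    then show ?thesis by blast
  qed
  have "P (f, 0, {})" using f inf by (simp add: P_def)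
  then have "\<exists>X. X 0 = (f, 0, {}) \<and> (\<forall>k. P (X k) \<and> Q k (X k) (X (Suc k)))"
  proof -
    have "\<exists>X. \<forall>k. (P (X k) \<and> (k = 0 \<longrightarrow> X k = (f, 0, {}))) \<and> Q k (X k) (X (Suc k))"
    proof (rule dependent_nat_choice)
      show "\<exists>x. P x \<and> (0 = (0::nat) \<longrightarrow> x = (f, 0, {}))" using \<open>P (f, 0, {})\<close> by blast
      show "\<exists>y. (P y \<and> (Suc k = 0 \<longrightarrow> y = (f, 0, {}))) \<and> Q k x y"
        if "P x \<and> (k = 0 \<longrightarrow> x = (f, 0, {}))" for x k
        using step that by blast
    qed
    then show ?thesis by blast
  qed
  then obtain X where X: "X 0 = (f, 0, {})" "\<And>k. P (X k)" "\<And>k. Q k (X k) (X (Suc k))" by blast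
  define G where "G k = fst (X k)" for k
  define r where "r k = fst (snd (X k))" for k
  define S where "S k = snd (snd (X k))" for k
  have Xe: "X k = (G k, r k, S k)" for k by (simp add: G_def r_def S_def)
  have GK: "G k \<in> model_space \<theta>" and GS: "\<And>u. u \<in> S k \<Longrightarrow> G k u = 0" for k
    using X(2)[of k] by (auto simp: P_def Xe)
  have GD: "h2_norm (\<lambda>u. G (Suc k) u - G k u) \<le> D k" and r: "r k < r (Suc k)"
    and new: "z (r (Suc k)) \<notin> S k" and SS: "S (Suc k) = insert (z (r (Suc k))) (S k)" for k
    using X(3)[of k] by (auto simp: Q_def Xe)
  have G0: "G 0 = f" using X(1) by (simp add: Xe)
  have Smono: "i \<le> j \<Longrightarrow> S i \<subseteq> S j" for i j
    by (rule lift_Suc_mono_le[of S]) (auto simp: SS)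
  obtain g where g: "g \<in> model_space \<theta>" "\<And>z. z \<in> ball 0 1 \<Longrightarrow> (\<lambda>n. G n z) \<longlonglongrightarrow> g z"
    "h2_norm (\<lambda>u. g u - G 0 u) \<le> suminf D"
    using model_space_complete[OF \<theta> GK GD sums_summable[OF Dsum]] by blast
  \<comment> \<open>The initial index \<open>r 0\<close> is a dummy: no zero has been moved to \<open>z (r 0)\<close>.\<close>
  show thesis
  proof (rule that[of "\<lambda>k. r (Suc k)" g])
    show "strict_mono (\<lambda>k. r (Suc k))" using r by (simp add: strict_mono_Suc_iff)
    have "z (r (Suc i)) \<noteq> z (r (Suc j))" if "i < j" for i j
    proof -
      have "z (r (Suc i)) \<in> S j" using Smono[of "Suc i" j] that SS[of i] by auto
      then show ?thesis using new[of j] by auto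
    qed
    then show "inj (z \<circ> (\<lambda>k. r (Suc k)))" by (intro linorder_injI) simp
    show "g \<in> model_space \<theta>" by fact
    show "\<exists>u\<in>ball 0 1. g u \<noteq> 0"
    proof (rule ccontr)
      assume "\<not> ?thesis"
      then have "h2_norm (\<lambda>u. g u - f u) = h2_norm (\<lambda>u. -1 * f u)"
        by (intro h2_norm_cong hardy2_cmult f2) auto
      then show False using g(3) fpos h2_norm_cmult[OF f2, of "-1"] sums_unique[OF Dsum] by (simp add: G0)
    qed
    fix k
    have "(\<lambda>n. G n (z (r (Suc k)))) \<longlonglongrightarrow> 0"
    proof (rule tendsto_eventually, rule eventually_sequentiallyI)
      fix n assume "Suc k \<le> n"
      then have "z (r (Suc k)) \<in> S n" using Smono SS[of k] by blast
      then show "G n (z (r (Suc k))) = 0" by (rule GS)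
    qed
    then show "g (z (r (Suc k))) = 0" using g(2)[OF z(1)] LIMSEQ_unique by blast
  qed
qed

section \<open>Minimal and uniformly minimal sequences\<close>

lemma hardy2_lin:
  assumes "S \<subseteq> hardy2" "g \<in> lin S"
  shows "g \<in> hardy2"
proof -
  obtain F c where "F \<subseteq> S" "g = (\<lambda>z. \<Sum>h\<in>F. c h * h z)" using assms(2) by (auto simp: lin_def)
  then show ?thesis using assms(1) by (auto intro!: hardy2_sum hardy2_cmult)
qed

lemma lin_subset_h2_closure:
  assumes "S \<subseteq> hardy2"
  shows "lin S \<subseteq> h2_closure (lin S)"
proof
  fix g assume g: "g \<in> lin S"
  have "h2_norm (\<lambda>z. g z - g z) = 0" by (simp add: h2_norm_const)
  then show "g \<in> h2_closure (lin S)"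
    using g hardy2_lin[OF assms g] unfolding h2_closure_def by (auto intro!: bexI[of _ g])
qed

lemma lin_zero: "(\<lambda>z. 0) \<in> lin S"
  unfolding lin_def by (rule CollectI, rule exI[of _ "{}"]) auto

lemma lin_superset:
  assumes "f \<in> S"
  shows "f \<in> lin S"
  unfolding lin_def by (rule CollectI, rule exI[of _ "{f}"], rule exI[of _ "\<lambda>_. 1"]) (use assms in auto)

lemma h2_closure_lin_orthogonal:
  assumes S: "S \<subseteq> hardy2" and q: "q \<in> hardy2" and orth: "\<And>s. s \<in> S \<Longrightarrow> h2_inner s q = 0"
    and f: "f \<in> h2_closure (lin S)"
  shows "h2_inner f q = 0"
proof (rule ccontr)
  assume nz: "h2_inner f q \<noteq> 0"
  have f2: "f \<in> hardy2" using f by (simp add: h2_closure_def)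
  define e where "e = cmod (h2_inner f q) / (h2_norm q + 1)"
  have q0: "0 \<le> h2_norm q" by (rule h2_norm_nonneg[OF q])
  then have "e > 0" using nz by (simp add: e_def)
  then obtain g where g: "g \<in> lin S" "h2_norm (\<lambda>z. f z - g z) < e"
    using f by (auto simp: h2_closure_def)
  note g2 = hardy2_lin[OF S g(1)]
  obtain F c where F: "F \<subseteq> S" "g = (\<lambda>z. \<Sum>h\<in>F. c h * h z)" using g(1) by (auto simp: lin_def)
  have "h2_inner g q = (\<Sum>h\<in>F. h2_inner (\<lambda>z. c h * h z) q)"
    unfolding F(2) by (rule h2_inner_sum_left) (use F(1) S q in \<open>auto intro: hardy2_cmult\<close>)
  also have "\<dots> = 0"
    using F(1) S q orth by (intro sum.neutral) (auto simp: h2_inner_cmult_left subset_iff)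
  finally have "h2_inner f q = h2_inner (\<lambda>z. f z - g z) q"
    by (simp add: h2_inner_diff_left[OF f2 g2 q])
  then have "cmod (h2_inner f q) \<le> h2_norm (\<lambda>z. f z - g z) * h2_norm q"
    using h2_cauchy_schwarz[OF hardy2_diff[OF f2 g2] q] by simp
  also have "\<dots> \<le> e * h2_norm q" using g(2) q0 by (intro mult_right_mono) auto
  also have "\<dots> < e * (h2_norm q + 1)" using \<open>e > 0\<close> by (intro mult_strict_left_mono) auto
  also have "\<dots> = cmod (h2_inner f q)" using q0 by (simp add: e_def)
  finally show False by simp
qed

lemma normalized_kernel_eq: "normalized_kernel \<theta> a = (\<lambda>z. inverse (of_real (h2_norm (kernel \<theta> a))) * kernel \<theta> a z)"
  by (auto simp: normalized_kernel_def divide_inverse mult.commute)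

lemma normalized_kernel_model_space:
  assumes "inner_function \<theta>" "a \<in> ball 0 1"
  shows "normalized_kernel \<theta> a \<in> model_space \<theta>"
  unfolding normalized_kernel_eq by (intro model_space_cmult kernel_in_model_space assms)

lemma h2_inner_normalized_kernel:
  assumes \<theta>: "inner_function \<theta>" and a: "a \<in> ball 0 1" and q: "q \<in> model_space \<theta>"
  shows "h2_inner (normalized_kernel \<theta> a) q = cnj (q a) / of_real (h2_norm (kernel \<theta> a))"
proof -
  note q2 = model_space_hardy2[OF q] and k2 = hardy2_kernel[OF \<theta> a]
  have "h2_inner (kernel \<theta> a) q = cnj (q a)"
    unfolding h2_inner_commute[OF k2 q2] h2_inner_kernel[OF \<theta> a q] ..
  then show ?thesis
    unfolding normalized_kernel_eq h2_inner_cmult_left[OF k2 q2] by (simp add: divide_inverse mult.commute)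
qed

text \<open>
  Removing from \<open>g\<close> its zero at \<open>p n\<close> leaves a function that is orthogonal to all kernels of
  the sequence except the one at \<open>p n\<close>.
\<close>

theorem minimal_seq_of_common_zeros:
  assumes \<theta>: "inner_function \<theta>" and p: "\<And>k. p k \<in> ball 0 1" "inj p"
    and g: "g \<in> model_space \<theta>" "\<exists>u\<in>ball 0 1. g u \<noteq> 0" "\<And>k. g (p k) = 0"
  shows "minimal_seq (\<lambda>k. normalized_kernel \<theta> (p k))"
  unfolding minimal_seq_def
proof
  fix n
  let ?x = "\<lambda>k. normalized_kernel \<theta> (p k)"
  obtain q where q: "q \<in> model_space \<theta>" "q (p n) \<noteq> 0" "\<And>u. u \<in> ball 0 1 \<Longrightarrow> u \<noteq> p n \<Longrightarrow> g u = 0 \<Longrightarrow> q u = 0"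
    using model_space_remove_zero[OF \<theta> g(1,2) p(1)[of n]] by blast
  note x2 = model_space_hardy2[OF normalized_kernel_model_space[OF \<theta> p(1)]]
  have "h2_inner (?x n) q \<noteq> 0"
    using kernel_nonzero[OF \<theta> g(1,2) p(1)[of n]] q(2) by (simp add: h2_inner_normalized_kernel[OF \<theta> p(1) q(1)])
  moreover have "h2_inner (?x n) q = 0" if "?x n \<in> h2_closure (lin {?x m |m. m \<noteq> n})"
  proof (rule h2_closure_lin_orthogonal[OF _ model_space_hardy2[OF q(1)] _ that])
    show "{?x m |m. m \<noteq> n} \<subseteq> hardy2" using x2 by auto
    fix s assume "s \<in> {?x m |m. m \<noteq> n}"
    then obtain m where m: "s = ?x m" "m \<noteq> n" by blast
    have "q (p m) = 0" using q(3)[OF p(1)] g(3) m(2) p(2) by (auto simp: inj_eq)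
    then show "h2_inner s q = 0" by (simp add: m(1) h2_inner_normalized_kernel[OF \<theta> p(1) q(1)])
  qed
  ultimately show "?x n \<notin> h2_closure (lin {?x m |m. m \<noteq> n})" by blast
qed

lemma uniformly_minimal_lower:
  assumes x: "\<And>n. x n \<in> hardy2" and u: "uniformly_minimal_seq x"
  obtains d where "d > 0" "\<And>n m. m \<noteq> n \<Longrightarrow> d \<le> h2_norm (\<lambda>z. x n z - x m z)"
proof -
  let ?C = "\<lambda>n. h2_closure (lin {x m |m. m \<noteq> n})"
  let ?I = "\<lambda>n. INF g\<in>?C n. h2_norm (\<lambda>z. x n z - g z)"
  have sub: "{x m |m. m \<noteq> n} \<subseteq> hardy2" for n using x by auto
  have nn: "0 \<le> h2_norm (\<lambda>z. x n z - g z)" if "g \<in> ?C n" for n g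
    using that x by (intro h2_norm_nonneg hardy2_diff) (auto simp: h2_closure_def)
  have ne: "?C n \<noteq> {}" for n using lin_subset_h2_closure[OF sub[of n]] lin_zero by blast
  have "0 \<le> ?I n" for n using nn by (intro cINF_greatest ne) auto
  then have bdd: "bdd_below (range ?I)" by (intro bdd_belowI2) auto
  show thesis
  proof (rule that)
    show "0 < (INF n. ?I n)" using u by (simp add: uniformly_minimal_seq_def)
    fix n m :: nat assume mn: "m \<noteq> n"
    have "(INF n. ?I n) \<le> ?I n" by (rule cINF_lower[OF bdd]) simp
    also have "\<dots> \<le> h2_norm (\<lambda>z. x n z - x m z)"
    proof (rule cINF_lower)
      show "bdd_below ((\<lambda>g. h2_norm (\<lambda>z. x n z - g z)) ` ?C n)" by (rule bdd_belowI2[of _ 0]) (rule nn)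
      have "x m \<in> {x m |m. m \<noteq> n}" using mn by auto
      then show "x m \<in> ?C n" by (rule subsetD[OF lin_subset_h2_closure[OF sub[of n]] lin_superset])
    qed
    finally show "(INF n. ?I n) \<le> h2_norm (\<lambda>z. x n z - x m z)" .
  qed
qed

text \<open>
  The span is dense in its closure, so both have the same distance from \<open>x n\<close>.
\<close>

lemma uniformly_minimal_seqI:
  assumes x: "\<And>n. x n \<in> hardy2" and d: "d > 0"
    and le: "\<And>n g. g \<in> lin {x m |m. m \<noteq> n} \<Longrightarrow> d \<le> h2_norm (\<lambda>z. x n z - g z)"
  shows "uniformly_minimal_seq x"
proof -
  let ?C = "\<lambda>n. h2_closure (lin {x m |m. m \<noteq> n})"
  let ?I = "\<lambda>n. INF g\<in>?C n. h2_norm (\<lambda>z. x n z - g z)"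
  have sub: "{x m |m. m \<noteq> n} \<subseteq> hardy2" for n using x by auto
  have ne: "?C n \<noteq> {}" for n using lin_subset_h2_closure[OF sub[of n]] lin_zero by blast
  have "d \<le> h2_norm (\<lambda>z. x n z - g z)" if g: "g \<in> ?C n" for n g
  proof (rule field_le_epsilon)
    fix e :: real assume "e > 0"
    then obtain h where h: "h \<in> lin {x m |m. m \<noteq> n}" "h2_norm (\<lambda>z. g z - h z) < e"
      using g by (auto simp: h2_closure_def)
    have g2: "g \<in> hardy2" using g by (simp add: h2_closure_def)
    have "d \<le> h2_norm (\<lambda>z. x n z - h z)" by (rule le[OF h(1)])
    also have "\<dots> \<le> h2_norm (\<lambda>z. x n z - g z) + h2_norm (\<lambda>z. g z - h z)"
      by (rule h2_norm_triangle3[OF x g2 hardy2_lin[OF sub h(1)]])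
    finally show "d \<le> h2_norm (\<lambda>z. x n z - g z) + e" using h(2) by simp
  qed
  then have "d \<le> ?I n" for n by (intro cINF_greatest ne)
  then have "d \<le> (INF n. ?I n)" by (rule cINF_greatest[OF UNIV_not_empty])
  then show ?thesis using d by (simp add: uniformly_minimal_seq_def)
qed

text \<open>
  In a convergent sequence neighbouring elements come arbitrarily close to each other.
\<close>

theorem not_uniformly_minimal_of_convergent:
  assumes x: "\<And>n. x n \<in> hardy2" and y: "y \<in> hardy2" and lim: "(\<lambda>n. h2_norm (\<lambda>z. x n z - y z)) \<longlonglongrightarrow> 0"
  shows "\<not> contains_seq uniformly_minimal_seq x"
proof
  assume "contains_seq uniformly_minimal_seq x"
  then obtain r where r: "strict_mono r" "uniformly_minimal_seq (x \<circ> r)" by (auto simp: contains_seq_def)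
  obtain d where d: "d > 0" "\<And>n m. m \<noteq> n \<Longrightarrow> d \<le> h2_norm (\<lambda>z. (x \<circ> r) n z - (x \<circ> r) m z)"
    using uniformly_minimal_lower[of "x \<circ> r", OF _ r(2)] x by auto
  have "(\<lambda>n. h2_norm (\<lambda>z. x (r n) z - y z)) \<longlonglongrightarrow> 0"
    using LIMSEQ_subseq_LIMSEQ[OF lim r(1)] by (simp add: o_def)
  then obtain N where N: "\<And>n. n \<ge> N \<Longrightarrow> h2_norm (\<lambda>z. x (r n) z - y z) < d / 2"
    using LIMSEQ_D[of _ 0 "d / 2"] d(1) h2_norm_nonneg[OF hardy2_diff[OF x y]] by fastforce
  have "d \<le> h2_norm (\<lambda>z. x (r N) z - x (r (Suc N)) z)" using d(2)[of "Suc N" N] by simp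
  also have "\<dots> \<le> h2_norm (\<lambda>z. x (r N) z - y z) + h2_norm (\<lambda>z. y z - x (r (Suc N)) z)"
    by (rule h2_norm_triangle3[OF x y x])
  also have "h2_norm (\<lambda>z. y z - x (r (Suc N)) z) = h2_norm (\<lambda>z. x (r (Suc N)) z - y z)"
    by (rule h2_norm_minus_commute[OF y x])
  finally show False using N[of N] N[of "Suc N"] by simp
qed

lemma normalized_tendsto:
  assumes k: "\<And>n. k n \<in> hardy2" "\<And>n. 0 < h2_norm (k n)" and l: "l \<in> hardy2" "0 < h2_norm l"
    and lim: "(\<lambda>n. h2_norm (\<lambda>z. k n z - l z)) \<longlonglongrightarrow> 0"
  shows "(\<lambda>n. h2_norm (\<lambda>z. inverse (of_real (h2_norm (k n))) * k n z - inverse (of_real (h2_norm l)) * l z)) \<longlonglongrightarrow> 0"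
proof (rule Lim_null_comparison)
  let ?c = "h2_norm l"
  show "\<forall>\<^sub>F n in sequentially. norm (h2_norm (\<lambda>z. inverse (of_real (h2_norm (k n))) * k n z - inverse (of_real ?c) * l z))
      \<le> 2 * h2_norm (\<lambda>z. k n z - l z) / ?c"
  proof (rule always_eventually, rule allI)
    fix n
    let ?N = "h2_norm (k n)" and ?d = "h2_norm (\<lambda>z. k n z - l z)"
    let ?a = "inverse (of_real ?N) :: complex" and ?b = "inverse (of_real ?c) :: complex"
    have "\<bar>?N - ?c\<bar> \<le> ?d"
      using h2_norm_triangle_sub[OF k(1) l(1), of n] h2_norm_triangle_sub[OF l(1) k(1), of n]
        h2_norm_minus_commute[OF k(1) l(1), of n] by simp
    moreover have "cmod (?a - ?b) * ?N = \<bar>?N - ?c\<bar> / ?c"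
    proof -
      have "?a - ?b = of_real (inverse ?N - inverse ?c)" by simp
      then have "cmod (?a - ?b) = \<bar>inverse ?N - inverse ?c\<bar>" by (simp only: norm_of_real)
      also have "inverse ?N - inverse ?c = (?c - ?N) / (?N * ?c)" using k(2)[of n] l(2) by (simp add: field_simps)
      finally show ?thesis using k(2)[of n] l(2) by (simp add: abs_mult abs_minus_commute)
    qed
    moreover have "cmod ?b = inverse ?c" using l(2) by (simp add: norm_inverse)
    moreover have "h2_norm (\<lambda>z. ?a * k n z - ?b * l z) \<le> cmod (?a - ?b) * ?N + cmod ?b * ?d"
    proof -
      have "(\<lambda>z. ?a * k n z - ?b * l z) = (\<lambda>z. (?a - ?b) * k n z + ?b * (k n z - l z))"
        by (auto simp: algebra_simps)
      then show ?thesis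
        using h2_norm_triangle[OF hardy2_cmult[OF k(1)] hardy2_cmult[OF hardy2_diff[OF k(1) l(1)]], of "?a - ?b" n ?b n]
        by (simp only: h2_norm_cmult[OF k(1)] h2_norm_cmult[OF hardy2_diff[OF k(1) l(1)]])
    qed
    ultimately have "h2_norm (\<lambda>z. ?a * k n z - ?b * l z) \<le> \<bar>?N - ?c\<bar> / ?c + inverse ?c * ?d" by simp
    also have "\<dots> \<le> ?d / ?c + inverse ?c * ?d"
      using \<open>\<bar>?N - ?c\<bar> \<le> ?d\<close> l(2) by (intro add_right_mono divide_right_mono) auto
    also have "\<dots> = 2 * ?d / ?c" using l(2) by (simp add: field_simps)
    finally show "norm (h2_norm (\<lambda>z. ?a * k n z - ?b * l z)) \<le> 2 * ?d / ?c"
      using h2_norm_nonneg[OF hardy2_diff[OF hardy2_cmult[OF k(1)] hardy2_cmult[OF l(1)]]] by simp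
  qed
  have "(\<lambda>n. 2 * h2_norm (\<lambda>z. k n z - l z) / ?c) \<longlonglongrightarrow> 2 * 0 / ?c"
    by (intro tendsto_intros lim) (use l in auto)
  then show "(\<lambda>n. 2 * h2_norm (\<lambda>z. k n z - l z) / ?c) \<longlonglongrightarrow> 0" by simp
qed

section \<open>Almost orthogonal sequences\<close>

text \<open>
  The Gram matrix of the vectors is a diagonal with entries at least \<open>e\<^sup>2\<close>, up to a
  perturbation dominated by the rank one matrix \<open>\<tau> i * \<tau> j\<close>. By the Cauchy--Schwarz inequality
  the perturbation takes away at most half of the diagonal.
\<close>

theorem almost_orthogonal_coefficient_bound:
  fixes u :: "nat \<Rightarrow> complex \<Rightarrow> complex" and b :: "nat \<Rightarrow> complex"
  assumes u: "\<And>i. u i \<in> hardy2" and e: "e > 0" "\<And>i. e \<le> h2_norm (u i)"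
    and \<tau>: "\<And>i. 0 \<le> \<tau> i" "\<And>i j. i \<noteq> j \<Longrightarrow> cmod (h2_inner (u i) (u j)) \<le> \<tau> i * \<tau> j"
    and I: "finite I" "(\<Sum>i\<in>I. (\<tau> i)\<^sup>2) \<le> e\<^sup>2 / 2" "n \<in> I"
  shows "e\<^sup>2 / 2 * (cmod (b n))\<^sup>2 \<le> (h2_norm (\<lambda>z. \<Sum>i\<in>I. b i * u i z))\<^sup>2"
proof -
  let ?v = "\<lambda>z. \<Sum>i\<in>I. b i * u i z"
  have bu: "(\<lambda>z. b i * u i z) \<in> hardy2" for i by (intro hardy2_cmult u)
  have v: "?v \<in> hardy2" by (intro hardy2_sum bu)
  have "h2_inner ?v ?v = (\<Sum>i\<in>I. \<Sum>j\<in>I. b i * (cnj (b j) * h2_inner (u i) (u j)))"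
    by (simp only: h2_inner_sum_left[OF bu v] h2_inner_sum_right[OF bu bu] h2_inner_cmult_left[OF u bu] h2_inner_cmult_right[OF u u])
  then have "(h2_norm ?v)\<^sup>2 = (\<Sum>i\<in>I. \<Sum>j\<in>I. Re (b i * (cnj (b j) * h2_inner (u i) (u j))))"
    unfolding h2_inner_self[OF v] by (metis (mono_tags, lifting) Re_complex_of_real Re_sum sum.cong)
  also have "\<dots> \<ge> (\<Sum>i\<in>I. \<Sum>j\<in>I. (if i = j then e\<^sup>2 * (cmod (b i))\<^sup>2 else 0) - (cmod (b i) * \<tau> i) * (cmod (b j) * \<tau> j))"
  proof (intro sum_mono)
    fix i j
    show "(if i = j then e\<^sup>2 * (cmod (b i))\<^sup>2 else 0) - (cmod (b i) * \<tau> i) * (cmod (b j) * \<tau> j)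
        \<le> Re (b i * (cnj (b j) * h2_inner (u i) (u j)))"
    proof (cases "i = j")
      case True
      have "b i * (cnj (b i) * h2_inner (u i) (u i)) = of_real ((cmod (b i))\<^sup>2 * (h2_norm (u i))\<^sup>2)"
        unfolding h2_inner_self[OF u] of_real_mult complex_norm_square by (rule mult.assoc[symmetric])
      then have "Re (b i * (cnj (b j) * h2_inner (u i) (u j))) = (cmod (b i))\<^sup>2 * (h2_norm (u i))\<^sup>2"
        using True by (metis Re_complex_of_real)
      moreover have "(cmod (b i))\<^sup>2 * e\<^sup>2 \<le> (cmod (b i))\<^sup>2 * (h2_norm (u i))\<^sup>2"
        using e by (intro mult_left_mono power_mono) auto
      moreover have "0 \<le> (cmod (b i) * \<tau> i) * (cmod (b j) * \<tau> j)" using \<tau>(1) by simp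
      ultimately show ?thesis unfolding if_P[OF True] mult.commute[of "e\<^sup>2"] by linarith
    next
      case False
      have "\<bar>Re (b i * (cnj (b j) * h2_inner (u i) (u j)))\<bar> \<le> cmod (b i) * (cmod (b j) * cmod (h2_inner (u i) (u j)))"
        using abs_Re_le_cmod[of "b i * (cnj (b j) * h2_inner (u i) (u j))"] by (simp add: norm_mult)
      also have "\<dots> \<le> cmod (b i) * (cmod (b j) * (\<tau> i * \<tau> j))"
        using \<tau>(2)[OF False] by (intro mult_left_mono) auto
      finally have "\<bar>Re (b i * (cnj (b j) * h2_inner (u i) (u j)))\<bar> \<le> (cmod (b i) * \<tau> i) * (cmod (b j) * \<tau> j)"
        by (simp only: mult_ac)
      then show ?thesis using False by simp
    qed
  qed
  also have "(\<Sum>i\<in>I. \<Sum>j\<in>I. (if i = j then e\<^sup>2 * (cmod (b i))\<^sup>2 else 0) - (cmod (b i) * \<tau> i) * (cmod (b j) * \<tau> j))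
      = e\<^sup>2 * (\<Sum>i\<in>I. (cmod (b i))\<^sup>2) - (\<Sum>i\<in>I. cmod (b i) * \<tau> i)\<^sup>2"
    using I(1) unfolding power2_eq_square[of "\<Sum>i\<in>I. cmod (b i) * \<tau> i"] sum_product
    by (simp add: sum_subtractf sum_distrib_left)
  finally have low: "e\<^sup>2 * (\<Sum>i\<in>I. (cmod (b i))\<^sup>2) - (\<Sum>i\<in>I. cmod (b i) * \<tau> i)\<^sup>2 \<le> (h2_norm ?v)\<^sup>2" .
  have B0: "0 \<le> (\<Sum>i\<in>I. (cmod (b i))\<^sup>2)" by (intro sum_nonneg) auto
  have "(\<Sum>i\<in>I. cmod (b i) * \<tau> i)\<^sup>2 \<le> (\<Sum>i\<in>I. (cmod (b i))\<^sup>2) * (\<Sum>i\<in>I. (\<tau> i)\<^sup>2)"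
    by (rule Cauchy_Schwarz_ineq_sum)
  also have "\<dots> \<le> (\<Sum>i\<in>I. (cmod (b i))\<^sup>2) * (e\<^sup>2 / 2)" by (intro mult_left_mono I B0)
  finally have "e\<^sup>2 / 2 * (\<Sum>i\<in>I. (cmod (b i))\<^sup>2) \<le> (h2_norm ?v)\<^sup>2" using low by (simp add: field_simps)
  moreover have "(cmod (b n))\<^sup>2 \<le> (\<Sum>i\<in>I. (cmod (b i))\<^sup>2)"
    by (rule member_le_sum[OF I(3) _ I(1)]) auto
  then have "e\<^sup>2 / 2 * (cmod (b n))\<^sup>2 \<le> e\<^sup>2 / 2 * (\<Sum>i\<in>I. (cmod (b i))\<^sup>2)" by (intro mult_left_mono) auto
  ultimately show ?thesis by linarith
qed

text \<open>
  Each new index is chosen so large that \<open>y\<close> there is almost orthogonal to \<open>e\<close> and to all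
  \<open>y i\<close> with \<open>i\<close> up to the previous index.
\<close>

lemma almost_orthogonal_subsequence:
  assumes y: "\<And>n. y n \<in> hardy2" and e: "e \<in> hardy2" and \<eta>: "\<eta> > 0"
    and lim: "(\<lambda>n. h2_inner (y n) e) \<longlonglongrightarrow> 0" "\<And>i. (\<lambda>n. h2_inner (y n) (y i)) \<longlonglongrightarrow> 0"
  obtains r :: "nat \<Rightarrow> nat" where "strict_mono r" "\<And>k. cmod (h2_inner (y (r k)) e) < \<eta> / 4 ^ Suc k"
    "\<And>i k. i < k \<Longrightarrow> cmod (h2_inner (y (r k)) (y (r i))) < \<eta> / 4 ^ Suc k"
proof -
  have small: "\<forall>\<^sub>F n in sequentially. cmod (h2_inner (y n) g) < \<eta> / 4 ^ k"
    if "(\<lambda>n. h2_inner (y n) g) \<longlonglongrightarrow> 0" for g and k :: nat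
  proof -
    have "\<eta> / 4 ^ k > 0" using \<eta> by simp
    then show ?thesis using that unfolding tendsto_iff dist_norm by fastforce
  qed
  let ?P = "\<lambda>k r. cmod (h2_inner (y r) e) < \<eta> / 4 ^ Suc k"
  let ?Q = "\<lambda>k (r :: nat) r'. r < r' \<and> (\<forall>i\<le>r. cmod (h2_inner (y r') (y i)) < \<eta> / 4 ^ Suc (Suc k))"
  have "\<exists>r. \<forall>k. ?P k (r k) \<and> ?Q k (r k) (r (Suc k))"
  proof (rule dependent_nat_choice)
    show "\<exists>x. ?P 0 x"
      using small[OF lim(1), of "Suc 0"] eventually_happens sequentially_bot by blast
    fix x k
    have "\<forall>\<^sub>F n in sequentially. \<forall>i\<in>{..x}. cmod (h2_inner (y n) (y i)) < \<eta> / 4 ^ Suc (Suc k)"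
      by (rule eventually_ball_finite[OF finite_atMost ballI[OF small[OF lim(2)]]])
    then have "\<forall>\<^sub>F n in sequentially. ?P (Suc k) n \<and> ?Q k x n"
      using small[OF lim(1), of "Suc (Suc k)"] eventually_gt_at_top[of x] by eventually_elim auto
    then show "\<exists>n. ?P (Suc k) n \<and> ?Q k x n"
      using eventually_happens sequentially_bot by blast
  qed
  then obtain r where r: "\<And>k. ?P k (r k)" "\<And>k. ?Q k (r k) (r (Suc k))" by blast
  have mono: "strict_mono r" using r(2) by (simp add: strict_mono_Suc_iff)
  show thesis
  proof (rule that[OF mono r(1)])
    fix i k :: nat assume "i < k"
    then obtain k' where k: "k = Suc k'" "i \<le> k'" by (cases k) auto
    have "r i \<le> r k'" using mono k(2) by (simp add: strict_mono_less_eq)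
    then show "cmod (h2_inner (y (r k)) (y (r i))) < \<eta> / 4 ^ Suc k" using r(2)[of k'] k(1) by blast
  qed
qed

text \<open>
  A span is formed over a set of functions; here its elements are indexed by the members of
  the family, which avoids the index \<open>n\<close> even if the family takes a value repeatedly.
\<close>

lemma lin_family_expand:
  assumes "g \<in> lin {x m |m. m \<noteq> n}"
  obtains M c where "finite M" "n \<notin> M" "g = (\<lambda>z. \<Sum>m\<in>M. c m * x m z)"
proof -
  obtain F c where F: "finite F" "F \<subseteq> {x m |m. m \<noteq> n}" "g = (\<lambda>z. \<Sum>h\<in>F. c h * h z)"
    using assms by (auto simp: lin_def)
  have "\<forall>h\<in>F. \<exists>m. h = x m \<and> m \<noteq> n" using F(2) by blast
  then obtain i where i: "\<And>h. h \<in> F \<Longrightarrow> h = x (i h) \<and> i h \<noteq> n" by metis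
  show thesis
  proof (rule that)
    show "finite (i ` F)" using F(1) by simp
    show "n \<notin> i ` F" using i by blast
    have "inj_on i F" using i by (metis inj_onI)
    then have "(\<Sum>m\<in>i ` F. c (x m) * x m z) = (\<Sum>h\<in>F. c (x (i h)) * x (i h) z)" for z
      by (simp add: sum.reindex)
    moreover have "(\<Sum>h\<in>F. c (x (i h)) * x (i h) z) = (\<Sum>h\<in>F. c h * h z)" for z
      by (rule sum.cong) (use i in auto)
    ultimately show "g = (\<lambda>z. \<Sum>m\<in>i ` F. c (x m) * x m z)" by (simp add: F(3))
  qed
qed

text \<open>
  Let \<open>y n\<close> be \<open>x n\<close> minus the multiple \<open>a n\<close> of \<open>e\<close>. The sequence \<open>y\<close> is bounded below in
  norm and tends to \<open>0\<close> against \<open>e\<close> and each of its own members. A subsequence of \<open>y\<close>,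
  together with \<open>e\<close>, is almost orthogonal. In a difference between \<open>x n\<close> and a combination of
  the other \<open>x m\<close> the coefficient of \<open>y n\<close> is \<open>1\<close>, whatever the coefficient of \<open>e\<close> is, so the
  norm of the difference is bounded below.
\<close>

theorem contains_uniformly_minimal:
  assumes x: "\<And>n. x n \<in> hardy2" and e: "e \<in> hardy2" "0 < h2_norm e"
    and d: "d > 0" "\<And>n. d \<le> h2_norm (\<lambda>z. x n z - a n * e z)"
    and lim: "\<And>g. g = e \<or> (\<exists>i. g = (\<lambda>z. x i z - a i * e z)) \<Longrightarrow> (\<lambda>n. h2_inner (\<lambda>z. x n z - a n * e z) g) \<longlonglongrightarrow> 0"
  shows "contains_seq uniformly_minimal_seq x"
proof -
  define y where "y n = (\<lambda>z. x n z - a n * e z)" for n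
  define \<epsilon> where "\<epsilon> = min d (h2_norm e)"
  have \<epsilon>: "\<epsilon> > 0" using d e by (simp add: \<epsilon>_def)
  have y: "y n \<in> hardy2" for n unfolding y_def by (intro hardy2_diff hardy2_cmult x e)
  have lims: "(\<lambda>n. h2_inner (y n) e) \<longlonglongrightarrow> 0" "(\<lambda>n. h2_inner (y n) (y i)) \<longlonglongrightarrow> 0" for i
    unfolding y_def by (rule lim; blast)+
  \<comment> \<open>This choice makes \<open>\<Sum>\<^sub>i \<tau> i\<^sup>2 = (4/3) t\<^sup>2 = \<epsilon>\<^sup>2 / 3\<close> for the weights \<open>\<tau>\<close> below.\<close>
  define t where "t = \<epsilon> / 2"
  have t: "t > 0" using \<epsilon> by (simp add: t_def)
  then have "t\<^sup>2 > 0" by simp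
  from almost_orthogonal_subsequence[OF y e(1) this lims]
  obtain r :: "nat \<Rightarrow> nat" where r: "strict_mono r" "\<And>k. cmod (h2_inner (y (r k)) e) < t\<^sup>2 / 4 ^ Suc k"
    "\<And>i k. i < k \<Longrightarrow> cmod (h2_inner (y (r k)) (y (r i))) < t\<^sup>2 / 4 ^ Suc k" by blast
  \<comment> \<open>The vector \<open>e\<close> takes part in the almost orthogonal family with index \<open>0\<close>.\<close>
  define u where "u i = (case i of 0 \<Rightarrow> e | Suc k \<Rightarrow> y (r k))" for i
  define \<tau> where "\<tau> i = t / 2 ^ i" for i :: nat
  have u: "u i \<in> hardy2" for i using e y by (simp add: u_def split: nat.split)
  have un: "\<epsilon> \<le> h2_norm (u i)" for i
    using d(2) by (auto simp: u_def \<epsilon>_def y_def split: nat.split) (metis min.coboundedI1)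
  have \<tau>0: "0 \<le> \<tau> i" for i using t by (simp add: \<tau>_def)
  have \<tau>sq: "\<tau> j * \<tau> j = t\<^sup>2 / 4 ^ j" for j
    by (simp add: \<tau>_def power2_eq_square power_mult_distrib[symmetric])
  have ij: "cmod (h2_inner (u j) (u i)) \<le> \<tau> i * \<tau> j" if "i < j" for i j
  proof -
    obtain k where k: "j = Suc k" using \<open>i < j\<close> by (cases j) auto
    have "cmod (h2_inner (u j) (u i)) \<le> t\<^sup>2 / 4 ^ j"
    proof (cases i)
      case 0 then show ?thesis using r(2)[of k] k by (simp add: u_def)
    next
      case (Suc l) then show ?thesis using r(3)[of l k] k \<open>i < j\<close> by (simp add: u_def)
    qed
    also have "t\<^sup>2 / 4 ^ j = \<tau> j * \<tau> j" by (rule \<tau>sq[symmetric])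
    also have "\<dots> \<le> \<tau> i * \<tau> j"
      using \<open>i < j\<close> t by (intro mult_right_mono \<tau>0) (auto simp: \<tau>_def intro!: divide_left_mono power_increasing)
    finally show ?thesis .
  qed
  have off: "cmod (h2_inner (u i) (u j)) \<le> \<tau> i * \<tau> j" if "i \<noteq> j" for i j
  proof (cases "i < j")
    case True
    have "cmod (h2_inner (u i) (u j)) = cmod (h2_inner (u j) (u i))"
      unfolding h2_inner_commute[OF u u, of i j] by simp
    then show ?thesis using ij[OF True] by simp
  next
    case False
    then show ?thesis using ij[of j i] that by (simp add: mult.commute)
  qed
  have \<tau>sum: "(\<Sum>i\<in>I. (\<tau> i)\<^sup>2) \<le> \<epsilon>\<^sup>2 / 2" if "finite I" for I
  proof -
    have s: "(\<lambda>i. t\<^sup>2 * (1 / 4) ^ i) sums (t\<^sup>2 * (4 / 3))"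
      using sums_mult[OF geometric_sums[of "1/4 :: real"], of "t\<^sup>2"] by simp
    have "(\<Sum>i\<in>I. (\<tau> i)\<^sup>2) = (\<Sum>i\<in>I. t\<^sup>2 * (1 / 4) ^ i)"
      unfolding power2_eq_square[of "\<tau> _"] \<tau>sq by (simp add: power_divide)
    also have "\<dots> \<le> t\<^sup>2 * (4 / 3)"
      using sum_le_suminf[OF sums_summable[OF s] that] sums_unique[OF s] by simp
    also have "\<dots> \<le> \<epsilon>\<^sup>2 / 2" by (simp add: t_def power_divide)
    finally show ?thesis .
  qed
  have "uniformly_minimal_seq (x \<circ> r)"
  proof (rule uniformly_minimal_seqI)
    show "(x \<circ> r) n \<in> hardy2" for n using x by simp
    show "sqrt (\<epsilon>\<^sup>2 / 2) > 0" using \<epsilon> by simp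
    fix n g assume "g \<in> lin {(x \<circ> r) m |m. m \<noteq> n}"
    then obtain M c where M: "finite M" "n \<notin> M" "g = (\<lambda>z. \<Sum>m\<in>M. c m * (x \<circ> r) m z)"
      by (rule lin_family_expand)
    define b where "b i = (case i of 0 \<Rightarrow> a (r n) - (\<Sum>m\<in>M. c m * a (r m)) | Suc m \<Rightarrow> if m = n then 1 else - c m)" for i
    let ?I = "insert 0 (Suc ` insert n M)"
    have xy: "x k z = a k * e z + y k z" for k z by (simp add: y_def)
    have "(\<Sum>i\<in>?I. b i * u i z) = (x \<circ> r) n z - g z" for z
    proof -
      have "(\<Sum>i\<in>?I. b i * u i z) = b 0 * u 0 z + (\<Sum>i\<in>Suc ` insert n M. b i * u i z)"
        using M(1) by (intro sum.insert) auto
      also have "(\<Sum>i\<in>Suc ` insert n M. b i * u i z) = (\<Sum>m\<in>insert n M. b (Suc m) * u (Suc m) z)"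
        by (subst sum.reindex) auto
      also have "b 0 * u 0 z + (\<Sum>m\<in>insert n M. b (Suc m) * u (Suc m) z)
          = b 0 * e z + (\<Sum>m\<in>insert n M. b (Suc m) * y (r m) z)"
        by (simp only: u_def nat.case)
      also have "(\<Sum>m\<in>insert n M. b (Suc m) * y (r m) z) = y (r n) z + (\<Sum>m\<in>M. b (Suc m) * y (r m) z)"
        using M(1,2) by (simp add: b_def)
      also have "(\<Sum>m\<in>M. b (Suc m) * y (r m) z) = (\<Sum>m\<in>M. - (c m * y (r m) z))"
        using M(2) by (intro sum.cong) (auto simp: b_def)
      also have "b 0 * e z = (a (r n) - (\<Sum>m\<in>M. c m * a (r m))) * e z" by (simp add: b_def)
      also have "(\<Sum>m\<in>M. - (c m * y (r m) z)) = - (\<Sum>m\<in>M. c m * y (r m) z)" by (rule sum_negf)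
      finally have lhs: "(\<Sum>i\<in>?I. b i * u i z) = (a (r n) - (\<Sum>m\<in>M. c m * a (r m))) * e z
        + (y (r n) z + - (\<Sum>m\<in>M. c m * y (r m) z))" .
      have "g z = (\<Sum>m\<in>M. c m * a (r m) * e z + c m * y (r m) z)"
        unfolding M(3) o_apply xy by (simp add: distrib_left mult.assoc)
      also have "\<dots> = (\<Sum>m\<in>M. c m * a (r m)) * e z + (\<Sum>m\<in>M. c m * y (r m) z)"
        by (simp only: sum.distrib sum_distrib_right)
      finally have rhs: "g z = (\<Sum>m\<in>M. c m * a (r m)) * e z + (\<Sum>m\<in>M. c m * y (r m) z)" .
      show ?thesis unfolding lhs rhs o_apply xy[of "r n"] left_diff_distrib by simp
    qed
    then have eq: "(\<lambda>z. (x \<circ> r) n z - g z) = (\<lambda>z. \<Sum>i\<in>?I. b i * u i z)" by simp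
    have "\<epsilon>\<^sup>2 / 2 * (cmod (b (Suc n)))\<^sup>2 \<le> (h2_norm (\<lambda>z. \<Sum>i\<in>?I. b i * u i z))\<^sup>2"
    proof (rule almost_orthogonal_coefficient_bound[where u = u and \<tau> = \<tau> and e = \<epsilon>])
      show I: "finite ?I" using M(1) by simp
      show "(\<Sum>i\<in>?I. (\<tau> i)\<^sup>2) \<le> \<epsilon>\<^sup>2 / 2" by (rule \<tau>sum[OF I])
      show "Suc n \<in> ?I" by simp
    qed (fact u \<epsilon> un \<tau>0 off)+
    then have "\<epsilon>\<^sup>2 / 2 \<le> (h2_norm (\<lambda>z. (x \<circ> r) n z - g z))\<^sup>2" unfolding eq by (simp add: b_def)
    then show "sqrt (\<epsilon>\<^sup>2 / 2) \<le> h2_norm (\<lambda>z. (x \<circ> r) n z - g z)"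
      unfolding eq by (intro real_le_lsqrt h2_norm_nonneg hardy2_sum hardy2_cmult u)
  qed
  then show ?thesis using r(1) by (auto simp: contains_seq_def)
qed

section \<open>Kernels at points tending to an Ahern--Clark point\<close>

lemma contains_seq_subseq:
  assumes "strict_mono r" "contains_seq P (x \<circ> r)"
  shows "contains_seq P x"
  using assms unfolding contains_seq_def by (metis comp_assoc strict_mono_o)

text \<open>
  Pairing the normalized kernels with a bounded function in the model space gives its values
  divided by norms that tend to infinity, hence a sequence tending to \<open>0\<close>. The kernels at
  points of the disc are such functions, so the normalized kernels become almost orthogonal to
  each other and to the kernel at \<open>0\<close>.
\<close>

lemma unbounded_kernels_uniformly_minimal:
  assumes \<theta>: "inner_function \<theta>" and nz: "\<And>w. w \<in> ball 0 1 \<Longrightarrow> 0 < h2_norm (kernel \<theta> w)"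
    and z: "\<And>n. z n \<in> ball 0 1" and lim: "filterlim (\<lambda>n. h2_norm (kernel \<theta> (z n))) at_top sequentially"
  shows "contains_seq uniformly_minimal_seq (\<lambda>n. normalized_kernel \<theta> (z n))"
proof (rule contains_uniformly_minimal[where e = "kernel \<theta> 0" and a = "\<lambda>_. 0" and d = 1])
  let ?x = "\<lambda>n. normalized_kernel \<theta> (z n)"
  show x2: "?x n \<in> hardy2" for n by (rule model_space_hardy2[OF normalized_kernel_model_space[OF \<theta> z]])
  show "kernel \<theta> 0 \<in> hardy2" by (rule hardy2_kernel[OF \<theta>]) simp
  show "0 < h2_norm (kernel \<theta> 0)" by (rule nz) simp
  have "h2_norm (?x n) = 1" for n
    unfolding normalized_kernel_eq h2_norm_cmult[OF hardy2_kernel[OF \<theta> z]]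
    using nz[OF z, of n] by (simp add: norm_inverse)
  then show "1 \<le> h2_norm (\<lambda>w. ?x n w - 0 * kernel \<theta> 0 w)" for n by simp
  have decay: "(\<lambda>n. h2_inner (?x n) g) \<longlonglongrightarrow> 0"
    if g: "g \<in> model_space \<theta>" and B: "\<And>u. u \<in> ball 0 1 \<Longrightarrow> cmod (g u) \<le> B" for g B
  proof (rule Lim_null_comparison)
    show "\<forall>\<^sub>F n in sequentially. cmod (h2_inner (?x n) g) \<le> B / h2_norm (kernel \<theta> (z n))"
    proof (rule always_eventually, rule allI)
      fix n
      show "cmod (h2_inner (?x n) g) \<le> B / h2_norm (kernel \<theta> (z n))"
        using B[OF z, of n] nz[OF z, of n]
        by (simp add: h2_inner_normalized_kernel[OF \<theta> z g] norm_divide divide_right_mono)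
    qed
    show "(\<lambda>n. B / h2_norm (kernel \<theta> (z n))) \<longlonglongrightarrow> 0"
      by (rule real_tendsto_divide_at_top[OF tendsto_const lim])
  qed
  fix g assume "g = kernel \<theta> 0 \<or> (\<exists>i. g = (\<lambda>w. ?x i w - 0 * kernel \<theta> 0 w))"
  then consider "g = kernel \<theta> 0" | i where "g = ?x i" by auto
  then have "(\<lambda>n. h2_inner (?x n) g) \<longlonglongrightarrow> 0"
  proof cases
    case 1
    show ?thesis unfolding 1
      by (rule decay[OF kernel_in_model_space[OF \<theta>] kernel_bounded[OF \<theta>]]) auto
  next
    case 2
    show ?thesis unfolding 2
    proof (rule decay[OF normalized_kernel_model_space[OF \<theta> z]])
      fix u :: complex assume u: "u \<in> ball 0 1"
      show "cmod (?x i u) \<le> 2 / (1 - cmod (z i)) / h2_norm (kernel \<theta> (z i))"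
        using divide_right_mono[OF kernel_bounded[OF \<theta> z u, of i], of "h2_norm (kernel \<theta> (z i))"] nz[OF z, of i]
        by (simp add: normalized_kernel_def norm_divide)
    qed
  qed
  then show "(\<lambda>n. h2_inner (\<lambda>w. ?x n w - 0 * kernel \<theta> 0 w) g) \<longlonglongrightarrow> 0" by simp
qed simp

text \<open>
  The kernels converge weakly but not in norm to the boundary kernel, so after normalization
  they are multiples of it plus a weakly null sequence that is bounded below.
\<close>

lemma bounded_kernels_uniformly_minimal:
  assumes \<theta>: "inner_function \<theta>" and \<zeta>: "cmod \<zeta> = 1" and \<theta>0: "cmod (\<theta> 0) < 1"
    and \<alpha>: "cmod \<alpha> = 1" and K: "boundary_kernel \<theta> \<zeta> \<alpha> \<in> model_space \<theta>"
    and z: "\<And>n. z n \<in> ball 0 1" "z \<longlonglongrightarrow> \<zeta>" and lim: "(\<lambda>n. \<theta> (z n)) \<longlonglongrightarrow> \<alpha>"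
    and M: "\<And>n. h2_norm (kernel \<theta> (z n)) \<le> M"
    and d: "d > 0" "\<And>n. d \<le> h2_norm (\<lambda>w. kernel \<theta> (z n) w - boundary_kernel \<theta> \<zeta> \<alpha> w)"
  shows "contains_seq uniformly_minimal_seq (\<lambda>n. normalized_kernel \<theta> (z n))"
proof -
  let ?x = "\<lambda>n. normalized_kernel \<theta> (z n)" and ?e = "boundary_kernel \<theta> \<zeta> \<alpha>" and ?k = "\<lambda>n. kernel \<theta> (z n)"
  define N where "N n = h2_norm (?k n)" for n
  define a where "a n = inverse (complex_of_real (N n))" for n
  define L where "L = 1 - cmod (\<theta> 0)"
  have L: "L > 0" using \<theta>0 by (simp add: L_def)
  have N: "L \<le> N n" "N n \<le> M" for n
    using kernel_lower_bound[OF \<theta> z(1)] M by (auto simp: L_def N_def)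
  have Mpos: "M > 0" using N[of 0] L by linarith
  note k2 = hardy2_kernel[OF \<theta> z(1)] and e2 = model_space_hardy2[OF K]
  note d2 = hardy2_diff[OF k2 e2]
  have y: "(\<lambda>w. ?x n w - a n * ?e w) = (\<lambda>w. a n * (?k n w - ?e w))" for n
    by (simp add: normalized_kernel_eq a_def N_def right_diff_distrib)
  have ca: "cmod (a n) = inverse (N n)" for n using N(1)[of n] L by (simp add: a_def norm_inverse)
  show ?thesis
  proof (rule contains_uniformly_minimal[where e = ?e and a = a and d = "inverse M * d"])
    show "?x n \<in> hardy2" for n by (rule model_space_hardy2[OF normalized_kernel_model_space[OF \<theta> z(1)]])
    show "?e \<in> hardy2" by (rule e2)
    show "0 < h2_norm ?e" using boundary_kernel_lower_bound[OF \<theta> \<alpha> K] L by (simp add: L_def)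
    show "0 < inverse M * d" using Mpos d by simp
    show "inverse M * d \<le> h2_norm (\<lambda>w. ?x n w - a n * ?e w)" for n
      unfolding y h2_norm_cmult[OF d2] ca
      using N[of n] L d Mpos by (intro mult_mono) (auto intro!: le_imp_inverse_le)
    fix g assume "g = ?e \<or> (\<exists>i. g = (\<lambda>w. ?x i w - a i * ?e w))"
    then have g: "g \<in> hardy2" using e2 by (auto simp: y intro!: hardy2_cmult d2)
    have "(\<lambda>n. h2_inner (?k n) g - h2_inner ?e g) \<longlonglongrightarrow> h2_inner ?e g - h2_inner ?e g"
      by (intro tendsto_diff tendsto_const boundary_kernel_weak_limit(3)[OF \<theta> \<zeta> z lim M g])
    then have lim0: "(\<lambda>n. cmod (h2_inner (\<lambda>w. ?k n w - ?e w) g)) \<longlonglongrightarrow> 0"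
      unfolding h2_inner_diff_left[OF k2 e2 g] by (simp add: tendsto_norm_zero)
    show "(\<lambda>n. h2_inner (\<lambda>w. ?x n w - a n * ?e w) g) \<longlonglongrightarrow> 0"
    proof (rule Lim_null_comparison)
      show "\<forall>\<^sub>F n in sequentially. cmod (h2_inner (\<lambda>w. ?x n w - a n * ?e w) g)
          \<le> inverse L * cmod (h2_inner (\<lambda>w. ?k n w - ?e w) g)"
        unfolding y h2_inner_cmult_left[OF d2 g] norm_mult ca
        using N L by (intro always_eventually allI mult_right_mono le_imp_inverse_le) auto
      show "(\<lambda>n. inverse L * cmod (h2_inner (\<lambda>w. ?k n w - ?e w) g)) \<longlonglongrightarrow> 0"
        using tendsto_mult_right_zero[OF lim0] by simp
    qed
  qed
qed

lemma infinite_subsequence: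
  fixes A :: "nat set"
  assumes "infinite A"
  shows "\<exists>r :: nat \<Rightarrow> nat. strict_mono r \<and> (\<forall>n. r n \<in> A)"
  using strict_mono_enumerate[OF assms] enumerate_in_set[OF assms] by blast

theorem theorem1p9:
  fixes \<theta> :: "complex \<Rightarrow> complex" and \<zeta> :: complex and z :: "nat \<Rightarrow> complex"
  assumes "inner_function \<theta>"
    and "\<zeta> \<in> ahern_clark \<theta>"
    and "\<not> localization_point \<theta> \<zeta>"
    and "range z \<subseteq> ball 0 1"
  shows "(tendsto_nontangentially z \<zeta> \<longrightarrow>
            contains_seq minimal_seq (\<lambda>n. normalized_kernel \<theta> (z n)) \<and>
            \<not> contains_seq uniformly_minimal_seq (\<lambda>n. normalized_kernel \<theta> (z n))) \<and>
         (z \<longlonglongrightarrow> \<zeta> \<and>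
          \<not> (\<lambda>n. h2_norm (\<lambda>w. kernel \<theta> (z n) w - kernel \<theta> \<zeta> w)) \<longlonglongrightarrow> 0 \<longrightarrow>
            contains_seq uniformly_minimal_seq (\<lambda>n. normalized_kernel \<theta> (z n)))"
proof -
  note \<theta> = assms(1)
  have \<zeta>: "cmod \<zeta> = 1" using assms(2) by (simp add: ahern_clark_def)
  have z: "z n \<in> ball 0 1" for n using assms(4) by blast
  obtain f \<gamma>0 where f: "f \<in> model_space \<theta>" "\<exists>z\<in>ball 0 1. f z \<noteq> 0"
    and \<gamma>0: "\<gamma>0 > 1" "infinite {z \<in> stolz_angle \<gamma>0 \<zeta>. f z = 0}"
    using assms(3) unfolding localization_point_def by blast
  have \<theta>0: "cmod (\<theta> 0) < 1" by (rule inner_value_0_less_1[OF \<theta> f])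
  obtain \<alpha> where \<alpha>: "cmod \<alpha> = 1" and K: "boundary_kernel \<theta> \<zeta> \<alpha> \<in> model_space \<theta>"
    using ahern_clark_boundary_kernel[OF \<theta> assms(2)] by blast
  let ?k = "boundary_kernel \<theta> \<zeta> \<alpha>"
  have k\<zeta>: "kernel \<theta> \<zeta> = ?k" by (rule kernel_boundary_eq(2)[OF \<theta> \<zeta> \<alpha> K])
  note k2 = model_space_hardy2[OF K]
  have kpos: "0 < h2_norm ?k" using boundary_kernel_lower_bound[OF \<theta> \<alpha> K] \<theta>0 by simp
  have part1: "contains_seq minimal_seq (\<lambda>n. normalized_kernel \<theta> (z n))"
    "\<not> contains_seq uniformly_minimal_seq (\<lambda>n. normalized_kernel \<theta> (z n))"
    if nt: "tendsto_nontangentially z \<zeta>"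
  proof -
    have lim: "z \<longlonglongrightarrow> \<zeta>" using nt by (simp add: tendsto_nontangentially_def)
    obtain \<gamma> where \<gamma>: "z n \<in> stolz_angle \<gamma> \<zeta>" for n
      using nt unfolding tendsto_nontangentially_def by blast
    have "\<gamma>0 > 0" using \<gamma>0(1) by simp
    from zero_set_transfer[OF \<theta> \<zeta> this f \<gamma>0(2) z lim]
    obtain s :: "nat \<Rightarrow> nat" and g where s: "strict_mono s" "inj (z \<circ> s)" "g \<in> model_space \<theta>"
      "\<exists>u\<in>ball 0 1. g u \<noteq> 0" "\<And>k. g (z (s k)) = 0" by blast
    have "minimal_seq (\<lambda>k. normalized_kernel \<theta> ((z \<circ> s) k))"
      by (rule minimal_seq_of_common_zeros[OF \<theta> _ s(2-4)]) (use z s(5) in auto)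
    then show "contains_seq minimal_seq (\<lambda>n. normalized_kernel \<theta> (z n))"
      using s(1) unfolding contains_seq_def by (intro exI[of _ s]) (simp add: o_def)
    have "(\<lambda>n. h2_norm (\<lambda>w. normalized_kernel \<theta> (z n) w - inverse (of_real (h2_norm ?k)) * ?k w)) \<longlonglongrightarrow> 0"
      unfolding normalized_kernel_eq
      by (rule normalized_tendsto[OF hardy2_kernel[OF \<theta> z] kernel_nonzero[OF \<theta> f z] k2 kpos
            kernel_tendsto_norm_stolz[OF \<theta> \<zeta> \<alpha> K \<gamma> lim]])
    then show "\<not> contains_seq uniformly_minimal_seq (\<lambda>n. normalized_kernel \<theta> (z n))"
      by (rule not_uniformly_minimal_of_convergent[rotated 2])
         (intro model_space_hardy2[OF normalized_kernel_model_space[OF \<theta> z]] hardy2_cmult k2)+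
  qed
  have part2: "contains_seq uniformly_minimal_seq (\<lambda>n. normalized_kernel \<theta> (z n))"
    if lim: "z \<longlonglongrightarrow> \<zeta>" and no: "\<not> (\<lambda>n. h2_norm (\<lambda>w. kernel \<theta> (z n) w - kernel \<theta> \<zeta> w)) \<longlonglongrightarrow> 0"
  proof -
    let ?d = "\<lambda>n. h2_norm (\<lambda>w. kernel \<theta> (z n) w - ?k w)"
    have d0: "0 \<le> ?d n" for n by (rule h2_norm_nonneg[OF hardy2_diff[OF hardy2_kernel[OF \<theta> z] k2]])
    obtain d where d: "d > 0" "\<And>m. \<exists>n\<ge>m. d \<le> ?d n"
      using no d0 unfolding k\<zeta> LIMSEQ_iff by (auto simp: not_less)
    have "infinite {n. d \<le> ?d n}" unfolding infinite_nat_iff_unbounded_le using d(2) by blast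
    from infinite_subsequence[OF this]
    obtain r :: "nat \<Rightarrow> nat" where r: "strict_mono r" "\<And>n. r n \<in> {n. d \<le> ?d n}"
      by (elim exE conjE) metis
    let ?N = "\<lambda>n. h2_norm (kernel \<theta> (z (r n)))"
    \<comment> \<open>Either the norms of the kernels tend to infinity, or they are bounded on a subsequence.\<close>
    show ?thesis
    proof (cases "\<forall>M. finite {n. ?N n \<le> M}")
      case True
      have "filterlim ?N at_top sequentially"
        unfolding filterlim_at_top
      proof
        fix M
        show "\<forall>\<^sub>F n in sequentially. M \<le> ?N n"
          using True by (auto simp: cofinite_eq_sequentially[symmetric] eventually_cofinite not_le intro: finite_subset[of _ "{n. ?N n \<le> M}"])
      qed
      then have "contains_seq uniformly_minimal_seq (\<lambda>n. normalized_kernel \<theta> ((z \<circ> r) n))"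
        by (intro unbounded_kernels_uniformly_minimal[OF \<theta> kernel_nonzero[OF \<theta> f]]) (use z in auto)
      then show ?thesis
        using contains_seq_subseq[OF r(1), of uniformly_minimal_seq "\<lambda>n. normalized_kernel \<theta> (z n)"] by (simp add: o_def)
    next
      case False
      then obtain M where "infinite {n. ?N n \<le> M}" by blast
      from infinite_subsequence[OF this]
      obtain s :: "nat \<Rightarrow> nat" where s: "strict_mono s" "\<And>n. s n \<in> {n. ?N n \<le> M}"
        by (elim exE conjE) metis
      have "bounded (range (\<lambda>n. \<theta> (z (r (s n)))))"
        using inner_function_le_1[OF \<theta> z] by (auto simp: bounded_iff)
      then obtain \<beta> and t :: "nat \<Rightarrow> nat" where t: "strict_mono t" "((\<lambda>n. \<theta> (z (r (s n)))) \<circ> t) \<longlonglongrightarrow> \<beta>"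
        using bounded_imp_convergent_subsequence by blast
      define q where "q = r \<circ> s \<circ> t"
      have q: "strict_mono q" unfolding q_def by (intro strict_mono_o r s t)
      have zq: "(\<lambda>n. z (q n)) \<longlonglongrightarrow> \<zeta>" using LIMSEQ_subseq_LIMSEQ[OF lim q] by (simp add: o_def)
      have \<theta>q: "(\<lambda>n. \<theta> (z (q n))) \<longlonglongrightarrow> \<beta>" using t(2) by (simp add: q_def o_def)
      have Mq: "h2_norm (kernel \<theta> (z (q n))) \<le> M" and dq: "d \<le> ?d (q n)" for n
        using s(2)[of "t n"] r(2)[of "s (t n)"] by (auto simp: q_def)
      note \<beta> = boundary_kernel_weak_limit(1,2)[OF \<theta> \<zeta> z zq \<theta>q Mq]
      \<comment> \<open>Both are the non-tangential limit of \<open>\<theta>\<close> at \<open>\<zeta>\<close>, although \<open>z\<close> may tend to \<open>\<zeta>\<close> tangentially.\<close>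
      have "\<beta> = \<alpha>"
        using kernel_boundary_eq(1)[OF \<theta> \<zeta> \<beta>] kernel_boundary_eq(1)[OF \<theta> \<zeta> \<alpha> K] by simp
      then have "contains_seq uniformly_minimal_seq (\<lambda>n. normalized_kernel \<theta> (z (q n)))"
        using bounded_kernels_uniformly_minimal[OF \<theta> \<zeta> \<theta>0 \<alpha> K z zq _ Mq d(1) dq] \<theta>q by simp
      then show ?thesis
        using contains_seq_subseq[OF q, of uniformly_minimal_seq "\<lambda>n. normalized_kernel \<theta> (z n)"] by (simp add: o_def)
    qed
  qed
  show ?thesis using part1 part2 by blast
qed

end
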